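(* Let $k$ be an even positive integer. There is a constant $d_k$, independent of $m$, and non-zero unless $k=\frac12$ or $k=\frac32$, such that for every $m\ge1$ $$\{\phi,\psi\}=d_k\cdot\langle\phi,\psi\rangle$$ for all $\phi,\psi\in J_{k,m}$ such that at least one of them is a cusp form.
   Context: $J_{k,m}$ is the space of Jacobi forms of weight $k$ and index $m$ on $\Gamma^J=\mathrm{SL}(2,\mathbf Z)\ltimes\mathbf Z^2$; $\phi=\sum_{4mn\ge r^2}c(n,r)e^{2\pi i(n\tau+rz)}$ is a cusp form if $c(n,r)=0$ whenever $4mn=r^2$. Write $\tau=u+iv$, $z=x+iy$. The usual and extended Petersson products are $$\langle\phi,\psi\rangle=\int_{\Gamma^J\backslash\mathbf H_1\times\mathbf C}\phi\bar\psi\,v^ke^{-4\pi my^2/v}\frac{du\,dx\,dv\,dy}{v^3},\qquad \{\phi,\psi\}=\int_{\Gamma^J\backslash\mathbf H_1\times\mathbf C}\mathcal D^J\big(\phi\bar\psi\,v^ke^{-4\pi my^2/v}\big)\frac{du\,dx\,dv\,dy}{v^3},$$ where $$\mathcal D^J=4v^2\partial_\tau\partial_{\bar\tau}+4y^2\partial_z\partial_{\bar z}+4vy\,(\partial_{\bar\tau}\partial_z+\partial_\tau\partial_{\bar z})-(k-\tfrac12)(k-\tfrac32),$$ and the fundamental domain is: $\tau$ in a fundamental domain of $\mathrm{SL}(2,\mathbf Z)\backslash\mathbf H_1$, $x$ mod $1$, $y$ mod $v$. *)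

theory Defs
  imports "HOL-Analysis.Analysis"
begin

definition upper_half_plane :: "complex set" where
  "upper_half_plane = {\<tau>. Im \<tau> > 0}"

text \<open>
  Functions on \<open>\<H>\<^sub>1 \<times> \<complex>\<close> are total functions on \<open>complex \<times> complex\<close>; their values
  at pairs whose first component lies outside the upper half plane are never used.
\<close>

definition e2pi :: "complex \<Rightarrow> complex" where
  "e2pi w = exp (2 * of_real pi * \<i> * w)"

text \<open>Holomorphy in two variables on an open set: the Frechet derivative exists and is complex linear.\<close>

definition holomorphic2_on :: "(complex \<times> complex \<Rightarrow> complex) \<Rightarrow> (complex \<times> complex) set \<Rightarrow> bool" where
  "holomorphic2_on f S \<longleftrightarrow>
     (\<forall>p\<in>S. \<exists>A B. (f has_derivative (\<lambda>(h, l). A * h + B * l)) (at p))"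

text \<open>
  The expansion runs over \<open>n, r \<in> \<int>\<close> with \<open>4 m n \<ge> r\<^sup>2\<close>; the coefficients \<open>c n r\<close> in this range
  are uniquely determined by \<open>\<phi>\<close>.
\<close>

definition jacobi_expansion ::
  "nat \<Rightarrow> (complex \<times> complex \<Rightarrow> complex) \<Rightarrow> (int \<Rightarrow> int \<Rightarrow> complex) \<Rightarrow> bool" where
  "jacobi_expansion m \<phi> c \<longleftrightarrow>
     (\<forall>\<tau>\<in>upper_half_plane. \<forall>z.
        ((\<lambda>(n, r). c n r * e2pi (of_int n * \<tau> + of_int r * z)) has_sum \<phi> (\<tau>, z))
          {(n, r). r\<^sup>2 \<le> 4 * int m * n})"

definition jacobi_forms :: "nat \<Rightarrow> nat \<Rightarrow> (complex \<times> complex \<Rightarrow> complex) set" where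
  "jacobi_forms k m = {\<phi>.
     holomorphic2_on \<phi> (upper_half_plane \<times> UNIV) \<and>
     (\<forall>a b c d :: int. a * d - b * c = 1 \<longrightarrow>
        (\<forall>\<tau>\<in>upper_half_plane. \<forall>z.
           \<phi> ((of_int a * \<tau> + of_int b) / (of_int c * \<tau> + of_int d), z / (of_int c * \<tau> + of_int d)) =
             (of_int c * \<tau> + of_int d) ^ k *
             e2pi (of_nat m * of_int c * z\<^sup>2 / (of_int c * \<tau> + of_int d)) * \<phi> (\<tau>, z))) \<and>
     (\<forall>l \<mu> :: int. \<forall>\<tau>\<in>upper_half_plane. \<forall>z.
        \<phi> (\<tau>, z + of_int l * \<tau> + of_int \<mu>) =
          e2pi (- of_nat m * ((of_int l)\<^sup>2 * \<tau> + 2 * of_int l * z)) * \<phi> (\<tau>, z)) \<and>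
     (\<exists>c. jacobi_expansion m \<phi> c)}"

definition jacobi_cusp_forms :: "nat \<Rightarrow> nat \<Rightarrow> (complex \<times> complex \<Rightarrow> complex) set" where
  "jacobi_cusp_forms k m = {\<phi> \<in> jacobi_forms k m.
     \<exists>c. jacobi_expansion m \<phi> c \<and> (\<forall>n r. 4 * int m * n = r\<^sup>2 \<longrightarrow> c n r = 0)}"

text \<open>Real partial derivative in the direction \<open>w\<close>, and the Wirtinger derivatives built from it.\<close>

definition pdiff ::
  "complex \<times> complex \<Rightarrow> (complex \<times> complex \<Rightarrow> complex) \<Rightarrow> complex \<times> complex \<Rightarrow> complex" where
  "pdiff w f p = vector_derivative (\<lambda>t::real. f (p + t *\<^sub>R w)) (at 0)"

definition d_tau :: "(complex \<times> complex \<Rightarrow> complex) \<Rightarrow> complex \<times> complex \<Rightarrow> complex" where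
  "d_tau f p = (pdiff (1, 0) f p - \<i> * pdiff (\<i>, 0) f p) / 2"

definition d_tau_bar :: "(complex \<times> complex \<Rightarrow> complex) \<Rightarrow> complex \<times> complex \<Rightarrow> complex" where
  "d_tau_bar f p = (pdiff (1, 0) f p + \<i> * pdiff (\<i>, 0) f p) / 2"

definition d_z :: "(complex \<times> complex \<Rightarrow> complex) \<Rightarrow> complex \<times> complex \<Rightarrow> complex" where
  "d_z f p = (pdiff (0, 1) f p - \<i> * pdiff (0, \<i>) f p) / 2"

definition d_z_bar :: "(complex \<times> complex \<Rightarrow> complex) \<Rightarrow> complex \<times> complex \<Rightarrow> complex" where
  "d_z_bar f p = (pdiff (0, 1) f p + \<i> * pdiff (0, \<i>) f p) / 2"

definition D_J :: "nat \<Rightarrow> (complex \<times> complex \<Rightarrow> complex) \<Rightarrow> complex \<times> complex \<Rightarrow> complex" where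
  "D_J k f = (\<lambda>(\<tau>, z). let v = complex_of_real (Im \<tau>); y = complex_of_real (Im z) in
     4 * v\<^sup>2 * d_tau (d_tau_bar f) (\<tau>, z)
     + 4 * y\<^sup>2 * d_z (d_z_bar f) (\<tau>, z)
     + 4 * v * y * (d_tau_bar (d_z f) (\<tau>, z) + d_tau (d_z_bar f) (\<tau>, z))
     - (of_nat k - 1 / 2) * (of_nat k - 3 / 2) * f (\<tau>, z))"

text \<open>
  The standard domain for \<open>\<tau>\<close>, with \<open>x\<close> mod \<open>1\<close> and \<open>y\<close> mod \<open>v\<close>. The additional identification
  \<open>z \<mapsto> -z\<close> coming from \<open>-1 \<in> SL(2,\<int>)\<close> is not divided out, so this region covers the quotient
  by \<open>\<Gamma>\<^sup>J\<close> twice.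
\<close>

definition jacobi_fund_domain :: "(complex \<times> complex) set" where
  "jacobi_fund_domain = {(\<tau>, z). Im \<tau> > 0 \<and> \<bar>Re \<tau>\<bar> \<le> 1 / 2 \<and> cmod \<tau> \<ge> 1 \<and>
     0 \<le> Re z \<and> Re z < 1 \<and> 0 \<le> Im z \<and> Im z < Im \<tau>}"

definition petersson_density ::
  "nat \<Rightarrow> nat \<Rightarrow> (complex \<times> complex \<Rightarrow> complex) \<Rightarrow> (complex \<times> complex \<Rightarrow> complex) \<Rightarrow>
   complex \<times> complex \<Rightarrow> complex" where
  "petersson_density k m \<phi> \<psi> = (\<lambda>(\<tau>, z). \<phi> (\<tau>, z) * cnj (\<psi> (\<tau>, z)) *
     of_real (Im \<tau> ^ k * exp (- 4 * pi * real m * (Im z)\<^sup>2 / Im \<tau>)))"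

text \<open>
  Integration against \<open>du dx dv dy / v\<^sup>3\<close>: Lebesgue measure on \<open>complex \<times> complex\<close> is
  \<open>du dv dx dy\<close> for \<open>\<tau> = u + \<i> v\<close>, \<open>z = x + \<i> y\<close>.
\<close>

definition jacobi_integrable :: "(complex \<times> complex \<Rightarrow> complex) \<Rightarrow> bool" where
  "jacobi_integrable f \<longleftrightarrow>
     set_integrable lborel jacobi_fund_domain (\<lambda>(\<tau>, z). f (\<tau>, z) / of_real (Im \<tau> ^ 3))"

definition jacobi_integral :: "(complex \<times> complex \<Rightarrow> complex) \<Rightarrow> complex" where
  "jacobi_integral f =
     set_lebesgue_integral lborel jacobi_fund_domain (\<lambda>(\<tau>, z). f (\<tau>, z) / of_real (Im \<tau> ^ 3))"

definition petersson ::
  "nat \<Rightarrow> nat \<Rightarrow> (complex \<times> complex \<Rightarrow> complex) \<Rightarrow> (complex \<times> complex \<Rightarrow> complex) \<Rightarrow> complex" where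
  "petersson k m \<phi> \<psi> = jacobi_integral (petersson_density k m \<phi> \<psi>)"

definition ext_petersson ::
  "nat \<Rightarrow> nat \<Rightarrow> (complex \<times> complex \<Rightarrow> complex) \<Rightarrow> (complex \<times> complex \<Rightarrow> complex) \<Rightarrow> complex" where
  "ext_petersson k m \<phi> \<psi> = jacobi_integral (D_J k (petersson_density k m \<phi> \<psi>))"

end

theory Submission
  imports Defs "HOL-Complex_Analysis.Complex_Analysis"
begin

text \<open>
  The constant is \<open>d = - (k - 1/2) (k - 3/2)\<close>: the second-order part \<open>L\<close> of \<open>D_J\<close> integrates to
  zero on the density \<open>F\<close> of the Petersson product, so only the constant term of \<open>D_J\<close> remains.

  Why does \<open>L\<close> integrate to zero? Write \<open>z = p \<tau> + q\<close> with real \<open>p\<close>, \<open>q\<close>; from here on all derivatives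
  are taken in \<open>\<tau>\<close> at fixed \<open>p\<close>, \<open>q\<close>. In these coordinates \<open>L\<close> is the hyperbolic Laplacian
  \<open>4 v\<^sup>2 d_tau d_tau_bar\<close>, and the measure
  \<open>du dv dx dy / v\<^sup>3\<close> becomes \<open>du dv dp dq / v\<^sup>2\<close>. The factor \<open>exp (- 4 \<pi> m y\<^sup>2 / v)\<close> of \<open>F\<close> is the
  squared modulus of \<open>e2pi (m p\<^sup>2 \<tau>)\<close>; hence \<open>F = f (cnj g) v\<^sup>k\<close> where
  \<open>f (\<tau>) = e2pi (m p\<^sup>2 \<tau>) \<phi> (\<tau>, p \<tau> + q)\<close> and likewise \<open>g\<close> for \<open>\<psi>\<close>, both holomorphic in \<open>\<tau>\<close>
  (\<open>jacobi_lift\<close>). So \<open>L F = 4 v\<^sup>2 d_tau w\<close> with the single function \<open>w = d_tau_bar F = f (cnj (R g)) v\<^sup>k / v\<close>,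
  where \<open>R\<close> is (up to the factor \<open>v\<close>) the raising operator of Maass.

  Under \<open>SL(2,\<int>)\<close> the lifts \<open>f\<close>, \<open>g\<close> for \<open>(p, q)\<close> go to those for a transformed pair \<open>(p, q)\<close> with the
  usual weight \<open>k\<close> factor and a common unimodular constant; adding an integer to \<open>p\<close> or \<open>q\<close> also changes
  both by a common unimodular constant. Therefore \<open>W (\<tau>) = \<integral> w dp dq\<close> over the unit square transforms like a
  form \<open>W d(cnj \<tau>)\<close> that is invariant under the modular group. By the theorem of Stokes the integral of
  \<open>d_tau W\<close> over the standard domain is a boundary integral; the vertical sides cancel, the two halves
  of the unit arc cancel, and the top tends to zero (\<open>stokes_modular_domain\<close>).

  The cusp condition enters through the Fourier expansion: the term \<open>c n r\<close> contributes to \<open>f\<close> the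
  exponential decay rate \<open>2 \<pi> (n + r p + m p\<^sup>2) \<ge> 2 \<pi> (n - r\<^sup>2 / (4 m))\<close>, which is at least
  \<open>2 \<pi> / (4 m)\<close> for a cusp form and at least \<open>0\<close> for any Jacobi form. Hence \<open>f\<close> and \<open>g\<close> are bounded and
  one of them decays exponentially, uniformly in \<open>p\<close> and \<open>q\<close> (\<open>jacobi_lift_decay\<close>). This gives
  both the integrability and the vanishing of the boundary term at the cusp.
\<close>

section \<open>Integration over the torus\<close>

lemma integral_shift_Icc:
  fixes f :: "real \<Rightarrow> 'a::banach"
  assumes "continuous_on {a + c..b + c} f"
  shows "integral {a..b} (\<lambda>x. f (x + c)) = integral {a + c..b + c} f"
proof (cases "a \<le> b")
  case True
  have "(f has_integral integral {a + c..b + c} f) (cbox (a + c) (b + c))"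
    using integrable_integral[OF integrable_continuous_interval[OF assms]] by simp
  from has_integral_affinity[OF this, of 1 c]
  have "((\<lambda>x. f (x + c)) has_integral integral {a + c..b + c} f) ((\<lambda>x. x - c) ` cbox (a + c) (b + c))"
    using True by simp
  moreover have "(\<lambda>x. x - c) ` cbox (a + c) (b + c) = {a..b}"
    using image_add_atLeastAtMost[of "-c" "a+c" "b+c"] by (simp add: add.commute)
  ultimately show ?thesis by (simp add: integral_unique)
qed auto

lemma periodic_of_int:
  fixes f :: "real \<Rightarrow> 'a"
  assumes "\<And>x. f (x + 1) = f x"
  shows "f (x + of_int n) = f x"
proof (induction n arbitrary: x rule: int_induct[where k = 0])
  case (step1 i)
  then show ?case using assms[of "x + of_int i"] by (simp add: add_ac)
next
  case (step2 i)
  then show ?case using assms[of "x + of_int (i - 1)"] by (simp add: add_ac)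
qed simp

lemma integral_periodic_shift:
  fixes f :: "real \<Rightarrow> complex"
  assumes cont: "continuous_on UNIV f" and per: "\<And>x. f (x + 1) = f x"
  shows "integral {0..1} (\<lambda>x. f (x + a)) = integral {0..1} f"
proof -
  let ?b = "frac a"
  have b: "0 \<le> ?b" "?b \<le> 1" using frac_lt_1[of a] by (simp_all add: less_imp_le)
  have int: "f integrable_on {u..v}" for u v
    by (intro integrable_continuous_interval continuous_on_subset[OF cont]) auto
  have "f (x + a) = f (x + ?b)" for x
    using periodic_of_int[of f "x + ?b" "\<lfloor>a\<rfloor>"] per by (simp add: frac_def)
  then have "integral {0..1} (\<lambda>x. f (x + a)) = integral {0..1} (\<lambda>x. f (x + ?b))"
    by simp
  also have "\<dots> = integral {?b..1 + ?b} f"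
    using integral_shift_Icc[of 0 ?b 1 f] by (simp add: continuous_on_subset[OF cont])
  also have "\<dots> = integral {?b..1} f + integral {1..1 + ?b} f"
    by (rule Henstock_Kurzweil_Integration.integral_combine[symmetric]) (use b int in auto)
  also have "integral {1..1 + ?b} f = integral {0..?b} (\<lambda>x. f (x + 1))"
    using integral_shift_Icc[of 0 1 ?b f] by (simp add: continuous_on_subset[OF cont] add.commute)
  also have "\<dots> = integral {0..?b} f" by (simp add: per)
  also have "integral {?b..1} f + integral {0..?b} f = integral {0..1} f"
    using Henstock_Kurzweil_Integration.integral_combine[of 0 ?b 1 f] b int by (simp add: add.commute)
  finally show ?thesis .
qed

text \<open>
  The unit square stands for the torus of pairs \<open>(p, q)\<close> modulo \<open>1\<close>. The integrals below are only formed
  for continuous integrands, so the Henstock-Kurzweil integral can be used throughout.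
\<close>
definition torus_integral :: "(real \<Rightarrow> real \<Rightarrow> complex) \<Rightarrow> complex" where
  "torus_integral K = integral (cbox (0, 0) (1, 1)) (\<lambda>(p, q). K p q)"

lemma torus_integral_iterated:
  assumes "continuous_on UNIV (\<lambda>(p, q). K p q)"
  shows "torus_integral K = integral {0..1} (\<lambda>p. integral {0..1} (\<lambda>q. K p q))"
  unfolding torus_integral_def
  by (subst integral_prod_continuous) (auto intro: continuous_on_subset[OF assms] simp: cbox_interval)

lemma torus_integral_iterated':
  assumes "continuous_on UNIV (\<lambda>(p, q). K p q)"
  shows "torus_integral K = integral {0..1} (\<lambda>q. integral {0..1} (\<lambda>p. K p q))"
  unfolding torus_integral_iterated[OF assms]
  using integral_swap_continuous[of 0 0 1 1 K] continuous_on_subset[OF assms]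
  by (simp add: cbox_interval)

text \<open>
  A shear of the torus preserves its measure, because each circle of constant \<open>p\<close> is only rotated. It is
  used twice: with \<open>c p = p\<close> it is the action of \<open>\<tau> \<mapsto> \<tau> + 1\<close> on the coordinates \<open>(p, q)\<close>, and with
  \<open>c p = p * Re \<tau>\<close> it turns the coordinate \<open>x\<close> of the fibre into \<open>q\<close>.
\<close>
lemma torus_integral_shear:
  assumes cont: "continuous_on UNIV (\<lambda>(p, q). K p q)"
    and per: "\<And>p q. K p (q + 1) = K p q" and c: "continuous_on UNIV c"
  shows "torus_integral (\<lambda>p q. K p (q + c p)) = torus_integral K"
proof -
  have K: "continuous_on UNIV (\<lambda>x. K (f x) (g x))"
    if "continuous_on UNIV f" "continuous_on UNIV g" for f g :: "'x::topological_space \<Rightarrow> real"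
    using continuous_on_compose2[OF cont, of UNIV "\<lambda>x. (f x, g x)"] that
    by (auto intro!: continuous_intros)
  have c': "continuous_on UNIV (\<lambda>x::real \<times> real. c (fst x))"
    by (rule continuous_on_compose2[OF c]) (auto intro!: continuous_intros)
  have "continuous_on UNIV (\<lambda>(p, q). K p (q + c p))"
    unfolding split_beta by (intro K continuous_intros c')
  then have "torus_integral (\<lambda>p q. K p (q + c p)) =
      integral {0..1} (\<lambda>p. integral {0..1} (\<lambda>q. K p (q + c p)))"
    by (rule torus_integral_iterated)
  also have "\<dots> = integral {0..1} (\<lambda>p. integral {0..1} (\<lambda>q. K p q))"
    by (intro integral_cong integral_periodic_shift K per continuous_intros)
  finally show ?thesis by (simp add: torus_integral_iterated[OF cont])
qed

text \<open>
  The map \<open>(p, q) \<mapsto> (- q, p)\<close> is the action of \<open>\<tau> \<mapsto> - 1 / \<tau>\<close> on the coordinates \<open>(p, q)\<close>. It maps the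
  unit square to another fundamental square of the torus, so periodicity in the first variable
  suffices.
\<close>
lemma torus_integral_rotate:
  assumes cont: "continuous_on UNIV (\<lambda>(p, q). K p q)"
    and per: "\<And>p q. K (p + 1) q = K p q"
  shows "torus_integral (\<lambda>p q. K (- q) p) = torus_integral K"
proof -
  have K: "continuous_on UNIV (\<lambda>x. K (f x) (g x))"
    if "continuous_on UNIV f" "continuous_on UNIV g" for f g :: "'x::topological_space \<Rightarrow> real"
    using continuous_on_compose2[OF cont, of UNIV "\<lambda>x. (f x, g x)"] that
    by (auto intro!: continuous_intros)
  have "continuous_on UNIV (\<lambda>(p, q). K (- q) p)"
    unfolding split_beta by (intro K continuous_intros)
  then have "torus_integral (\<lambda>p q. K (- q) p) =
      integral {0..1} (\<lambda>p. integral {0..1} (\<lambda>q. K (- q) p))"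
    by (rule torus_integral_iterated)
  also have "integral {0..1} (\<lambda>q. K (- q) p) = integral {0..1} (\<lambda>q. K q p)" for p
  proof -
    have "integral {0..1} (\<lambda>q. K (- q) p) = integral {-1..-0} (\<lambda>q. K q p)"
      using Henstock_Kurzweil_Integration.integral_reflect_real[of 0 "-1" "\<lambda>q. K q p"]
      by (simp only: minus_minus minus_zero)
    also have "\<dots> = integral {-1..0} (\<lambda>q. K (q + 1) p)" by (simp add: per)
    also have "\<dots> = integral {0..1} (\<lambda>q. K q p)"
      using integral_shift_Icc[of "-1" 1 0 "\<lambda>q. K q p"] by (simp add: continuous_on_subset[OF K] continuous_intros)
    finally show ?thesis .
  qed
  then have "integral {0..1} (\<lambda>p. integral {0..1} (\<lambda>q. K (- q) p)) =
      integral {0..1} (\<lambda>p. integral {0..1} (\<lambda>q. K q p))" by simp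
  finally show ?thesis by (simp add: torus_integral_iterated'[OF cont])
qed

section \<open>Lebesgue measure on the complex plane\<close>

lemma measurable_Complex [measurable]:
  assumes [measurable]: "f \<in> borel_measurable M" "g \<in> borel_measurable M"
  shows "(\<lambda>x. Complex (f x) (g x)) \<in> borel_measurable M"
  unfolding Complex_eq by measurable

lemma measurable_Complex_shear:
  assumes [measurable]: "h \<in> borel_measurable borel"
  shows "(\<lambda>(u, s). Complex u (h u + s)) \<in> borel_measurable lborel"
proof -
  have "(\<lambda>(u, s). Complex u (h u + s)) \<in> borel_measurable (lborel \<Otimes>\<^sub>M lborel)"
    unfolding split_beta by measurable
  then show ?thesis by (simp add: lborel_prod)
qed

lemmas measurable_Complex_pair = measurable_Complex_shear[of "\<lambda>_. 0", simplified]

lemma distr_lborel_Complex: "distr lborel borel (\<lambda>(u, v). Complex u v) = lborel"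
proof (rule lborel_eqI[symmetric])
  fix l u :: complex
  assume le: "\<And>b. b \<in> Basis \<Longrightarrow> l \<bullet> b \<le> u \<bullet> b"
  note [measurable] = measurable_Complex_pair
  have "(\<lambda>(u, v). Complex u v) -` box l u = box (Re l, Im l) (Re u, Im u)"
    by (auto simp: box_def Basis_prod_def Basis_complex_def)
  then have "emeasure (distr lborel borel (\<lambda>(u, v). Complex u v)) (box l u) =
      emeasure lborel (box (Re l, Im l) (Re u, Im u))"
    by (subst emeasure_distr) auto
  also have "\<dots> = (\<Prod>b\<in>Basis. ((Re u, Im u) - (Re l, Im l)) \<bullet> b)"
    using le[of 1] le[of \<i>] by (subst emeasure_lborel_box) (auto simp: Basis_prod_def Basis_complex_def)
  also have "\<dots> = (\<Prod>b\<in>Basis. (u - l) \<bullet> b)"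
  proof -
    have *: "(Basis :: (real \<times> real) set) = {(1, 0), (0, 1)}" by (auto simp: Basis_prod_def)
    show ?thesis unfolding * Basis_complex_def by (simp add: complex_eq_iff)
  qed
  finally show "emeasure (distr lborel borel (\<lambda>(u, v). Complex u v)) (box l u) =
      (\<Prod>b\<in>Basis. (u - l) \<bullet> b)" .
qed simp

lemma nn_integral_complex_iterated:
  assumes [measurable]: "g \<in> borel_measurable borel"
  shows "(\<integral>\<^sup>+ z. g z \<partial>lborel) = (\<integral>\<^sup>+ u. \<integral>\<^sup>+ v. g (Complex u v) \<partial>lborel \<partial>lborel)"
proof -
  note [measurable] = measurable_Complex_pair
  have "(\<integral>\<^sup>+ z. g z \<partial>lborel) = (\<integral>\<^sup>+ z. g z \<partial>distr lborel borel (\<lambda>(u, v). Complex u v))"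
    by (simp add: distr_lborel_Complex)
  also have "\<dots> = (\<integral>\<^sup>+ x. g (Complex (fst x) (snd x)) \<partial>(lborel \<Otimes>\<^sub>M lborel))"
    by (subst nn_integral_distr) (auto simp: lborel_prod split_beta)
  also have "\<dots> = (\<integral>\<^sup>+ u. \<integral>\<^sup>+ v. g (Complex u v) \<partial>lborel \<partial>lborel)"
    by (subst lborel.nn_integral_fst[symmetric]) auto
  finally show ?thesis .
qed

text \<open>
  The shear is measure preserving by Fubini, since for each \<open>u\<close> it is a translation in \<open>s\<close>. With
  the height of the unit arc above \<open>u\<close> for \<open>h u\<close> it straightens the modular domain into a strip.
\<close>
lemma distr_lborel_Complex_shear:
  fixes h :: "real \<Rightarrow> real"
  assumes [measurable]: "h \<in> borel_measurable borel"
  shows "distr lborel borel (\<lambda>(u, s). Complex u (h u + s)) = lborel"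
proof (rule measure_eqI)
  fix A :: "complex set" assume "A \<in> sets (distr lborel borel (\<lambda>(u, s). Complex u (h u + s)))"
  then have [measurable]: "A \<in> sets borel" by simp
  note [measurable] = measurable_Complex_shear[OF assms]
  have "emeasure (distr lborel borel (\<lambda>(u, s). Complex u (h u + s))) A =
      (\<integral>\<^sup>+ z. indicator A z \<partial>distr lborel borel (\<lambda>(u, s). Complex u (h u + s)))"
    by simp
  also have "\<dots> = (\<integral>\<^sup>+ x. indicator A (Complex (fst x) (h (fst x) + snd x)) \<partial>(lborel \<Otimes>\<^sub>M lborel))"
    by (subst nn_integral_distr) (auto simp: lborel_prod split_beta)
  also have "\<dots> = (\<integral>\<^sup>+ u. \<integral>\<^sup>+ s. indicator A (Complex u (h u + s)) \<partial>lborel \<partial>lborel)"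
    by (subst lborel.nn_integral_fst[symmetric]) auto
  also have "\<dots> = (\<integral>\<^sup>+ u. \<integral>\<^sup>+ v. indicator A (Complex u v) \<partial>lborel \<partial>lborel)"
    by (rule nn_integral_cong, subst (2) nn_integral_real_affine[where c = 1]) auto
  also have "\<dots> = emeasure lborel A"
    by (simp add: nn_integral_complex_iterated[symmetric])
  finally show "emeasure (distr lborel borel (\<lambda>(u, s). Complex u (h u + s))) A = emeasure lborel A" .
qed simp


section \<open>The theorem of Stokes on the modular domain\<close>

definition modular_domain :: "complex set" where
  "modular_domain = {\<tau>. Im \<tau> > 0 \<and> \<bar>Re \<tau>\<bar> \<le> 1 / 2 \<and> cmod \<tau> \<ge> 1}"

lemma modular_domain_Im:
  assumes "\<tau> \<in> modular_domain"
  shows "Im \<tau> \<ge> 1 / 2"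
proof (rule ccontr)
  assume "\<not> ?thesis"
  then have "(Im \<tau>)\<^sup>2 < (1/2)\<^sup>2" using assms by (intro power_strict_mono) (auto simp: modular_domain_def)
  moreover have "(Re \<tau>)\<^sup>2 \<le> (1/2)\<^sup>2" using assms by (auto simp: modular_domain_def abs_le_square_iff[symmetric])
  moreover have "1 \<le> (cmod \<tau>)\<^sup>2" using assms by (auto simp: modular_domain_def)
  then have "1 \<le> (Re \<tau>)\<^sup>2 + (Im \<tau>)\<^sup>2" by (simp only: cmod_power2)
  ultimately show False by (simp add: power2_eq_square)
qed

lemma sets_modular_domain [measurable]: "modular_domain \<in> sets borel"
  unfolding modular_domain_def by measurable

definition arc_height :: "real \<Rightarrow> real" where
  "arc_height u = sqrt (1 - u\<^sup>2)"

lemma arc_height_ge: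
  assumes "\<bar>u\<bar> \<le> 1 / 2"
  shows "arc_height u \<ge> 1 / 2"
proof -
  have "u\<^sup>2 \<le> (1/2)\<^sup>2" using assms by (simp add: abs_le_square_iff[symmetric])
  then show ?thesis unfolding arc_height_def by (intro real_le_rsqrt) (auto simp: power2_eq_square)
qed

lemma arc_height_square:
  assumes "\<bar>u\<bar> \<le> 1 / 2"
  shows "(arc_height u)\<^sup>2 = 1 - u\<^sup>2"
proof -
  have "u\<^sup>2 \<le> (1/2)\<^sup>2" using assms by (simp add: abs_le_square_iff[symmetric])
  then show ?thesis unfolding arc_height_def by (auto simp: power2_eq_square)
qed

lemma arc_height_minus [simp]: "arc_height (- u) = arc_height u"
  by (simp add: arc_height_def)

lemma arc_height_deriv:
  assumes "\<bar>u\<bar> \<le> 1 / 2"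
  shows "(arc_height has_real_derivative - u / arc_height u) (at u)"
proof -
  have "u\<^sup>2 \<le> (1/2)\<^sup>2" using assms by (simp add: abs_le_square_iff[symmetric])
  then have "1 - u\<^sup>2 > 0" by (simp add: power2_eq_square)
  then show ?thesis unfolding arc_height_def[abs_def]
    by (auto intro!: derivative_eq_intros simp: field_simps)
qed

lemma continuous_arc_height [continuous_intros]:
  "continuous_on S f \<Longrightarrow> continuous_on S (\<lambda>x. arc_height (f x))"
  unfolding arc_height_def by (intro continuous_intros)

lemma modular_domain_shear:
  assumes "\<bar>u\<bar> \<le> 1 / 2"
  shows "Complex u (arc_height u + s) \<in> modular_domain \<longleftrightarrow> s \<ge> 0"
proof -
  note h = arc_height_ge[OF assms] arc_height_square[OF assms]
  have "cmod (Complex u (arc_height u + s)) \<ge> 1 \<longleftrightarrow> (cmod (Complex u (arc_height u + s)))\<^sup>2 \<ge> 1\<^sup>2"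
    by (simp only: abs_le_square_iff[symmetric] abs_norm_cancel) simp
  also have "\<dots> \<longleftrightarrow> (arc_height u + s)\<^sup>2 \<ge> (arc_height u)\<^sup>2"
    using h(2) unfolding cmod_power2 complex.sel by auto
  also have "\<dots> \<longleftrightarrow> \<bar>arc_height u\<bar> \<le> \<bar>arc_height u + s\<bar>"
    by (rule abs_le_square_iff[symmetric])
  finally show ?thesis using h(1) assms by (auto simp: modular_domain_def)
qed

text \<open>
  In the coordinates \<open>\<tau> = u + \<i> (h u + s)\<close> with \<open>h u = sqrt (1 - u\<^sup>2)\<close> the modular domain is the
  strip \<open>\<bar>u\<bar> \<le> 1/2\<close>, \<open>s \<ge> 0\<close>. For \<open>V (u, s) = W (u + \<i> (h u + s))\<close> the chain rule gives
  \<open>Wu - \<i> Wv = \<partial>V/\<partial>u - \<partial>(c V)/\<partial>s\<close> where \<open>c u = h' u + \<i>\<close> does not depend on \<open>s\<close>. On a truncated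
  strip both terms can be integrated directly. The first one vanishes since \<open>V\<close> has equal values at
  \<open>u = - 1/2\<close> and \<open>u = 1/2\<close>. The second one gives the integrals of \<open>c V\<close> over the top, which tends to
  zero, and over the arc \<open>s = 0\<close>, which vanishes since \<open>c V\<close> is odd there.
\<close>
lemma stokes_modular_domain_real:
  fixes W Wu Wv :: "complex \<Rightarrow> complex"
  assumes der: "\<And>\<tau>. Im \<tau> > 0 \<Longrightarrow>
      (W has_derivative (\<lambda>h. of_real (Re h) * Wu \<tau> + of_real (Im h) * Wv \<tau>)) (at \<tau>)"
    and cont: "continuous_on {\<tau>. Im \<tau> > 0} Wu" "continuous_on {\<tau>. Im \<tau> > 0} Wv"
    and translate: "\<And>\<tau>. Im \<tau> > 0 \<Longrightarrow> W (\<tau> + 1) = W \<tau>"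
    and invert: "\<And>\<tau>. Im \<tau> > 0 \<Longrightarrow> W (- 1 / \<tau>) = (cnj \<tau>)\<^sup>2 * W \<tau>"
    and decay: "\<And>\<tau>. Im \<tau> \<ge> 1 \<Longrightarrow> cmod (W \<tau>) \<le> M / Im \<tau>"
    and int: "set_integrable lborel modular_domain (\<lambda>\<tau>. Wu \<tau> - \<i> * Wv \<tau>)"
  shows "(LINT \<tau>:modular_domain|lborel. Wu \<tau> - \<i> * Wv \<tau>) = 0"
proof -
  let ?h = arc_height and ?\<gamma> = "\<lambda>u s. Complex u (arc_height u + s)"
  let ?S = "{- 1/2..1/2} \<times> {0..} :: (real \<times> real) set"
  let ?A = "\<lambda>N. cbox (- 1/2, 0) (1/2, N) :: (real \<times> real) set"
  define K where "K = (\<lambda>x. Wu (?\<gamma> (fst x) (snd x)) - \<i> * Wv (?\<gamma> (fst x) (snd x)))"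
  define c :: "real \<Rightarrow> complex" where "c u = of_real (- u / ?h u) + \<i>" for u
  have [measurable]: "?h \<in> borel_measurable borel"
    unfolding arc_height_def by measurable
  note [measurable] = measurable_Complex_shear[OF this]
  have ind: "indicator modular_domain (?\<gamma> (fst x) (snd x)) = (indicator ?S x :: real)" for x
    using modular_domain_shear[of "fst x" "snd x"]
    by (cases x, cases "\<bar>fst x\<bar> \<le> 1 / 2") (auto simp: indicator_def modular_domain_def)
  \<comment> \<open>the shear straightens the domain into a half-infinite strip\<close>
  have int': "integrable (distr lborel borel (\<lambda>(u, s). ?\<gamma> u s))
      (\<lambda>\<tau>. indicator modular_domain \<tau> *\<^sub>R (Wu \<tau> - \<i> * Wv \<tau>))"
    unfolding distr_lborel_Complex_shear[OF \<open>?h \<in> borel_measurable borel\<close>]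
    using int by (simp add: set_integrable_def)
  have meas: "(\<lambda>\<tau>. indicator modular_domain \<tau> *\<^sub>R (Wu \<tau> - \<i> * Wv \<tau>)) \<in> borel_measurable borel"
    using borel_measurable_integrable[OF int'] by simp
  have intS: "set_integrable lborel ?S K"
    using integrable_distr[OF _ int'] ind
    by (simp add: set_integrable_def K_def split_beta)
  have "(LINT \<tau>:modular_domain|lborel. Wu \<tau> - \<i> * Wv \<tau>) =
      (LINT \<tau>|distr lborel borel (\<lambda>(u, s). ?\<gamma> u s). indicator modular_domain \<tau> *\<^sub>R (Wu \<tau> - \<i> * Wv \<tau>))"
    unfolding distr_lborel_Complex_shear[OF \<open>?h \<in> borel_measurable borel\<close>]
    by (simp add: set_lebesgue_integral_def)
  also have "\<dots> = (LINT x:?S|lborel. K x)"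
    by (subst integral_distr[OF _ meas]) (simp_all add: set_lebesgue_integral_def K_def split_beta ind)
  finally have total: "(LINT \<tau>:modular_domain|lborel. Wu \<tau> - \<i> * Wv \<tau>) = (LINT x:?S|lborel. K x)" .
  have S_eq: "?S = (\<Union>N::nat. ?A (real N))"
    by (auto simp: cbox_Pair_eq real_arch_simple)
  have lim: "(\<lambda>N. LINT x:?A (real N)|lborel. K x) \<longlonglongrightarrow> (LINT x:?S|lborel. K x)"
    unfolding S_eq
  proof (rule set_integral_cont_up)
    show "incseq (\<lambda>N. ?A (real N))" by (auto simp: incseq_def cbox_Pair_eq)
    show "set_integrable lborel (\<Union>N. ?A (real N)) K" using intS unfolding S_eq .
  qed auto
  have Im_pos: "?h u + s > 0" if "u \<in> {-1/2..1/2}" "s \<ge> 0" for u s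
  proof -
    have "\<bar>u\<bar> \<le> 1 / 2" using that(1) by auto
    then show ?thesis using arc_height_ge[of u] that(2) by linarith
  qed
  have \<gamma>_cont: "continuous_on T (\<lambda>x. G (?\<gamma> (fst x) (snd x)))"
    if "continuous_on {\<tau>. Im \<tau> > 0} G" "T \<subseteq> ?S" for G :: "complex \<Rightarrow> complex" and T
  proof (rule continuous_on_compose2[OF that(1)])
    show "continuous_on T (\<lambda>x. ?\<gamma> (fst x) (snd x))"
      unfolding Complex_eq by (intro continuous_intros)
    show "(\<lambda>x. ?\<gamma> (fst x) (snd x)) ` T \<subseteq> {\<tau>. Im \<tau> > 0}"
      using that(2) Im_pos by fastforce
  qed
  have W_cont: "continuous_on {\<tau>. Im \<tau> > 0} W"
    using der by (intro continuous_at_imp_continuous_on ballI has_derivative_continuous) blast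
  have c_cont: "continuous_on T (\<lambda>x. c (f x))" if "continuous_on T f" "f ` T \<subseteq> {-1/2..1/2}" for f and T :: "'t::topological_space set"
    unfolding c_def using that Im_pos[of _ 0]
    by (intro continuous_intros) fastforce+
  \<comment> \<open>on the arc \<open>- 1 / \<tau> = - cnj \<tau>\<close> and \<open>c u = - cnj \<tau> / h u\<close>, so inversion changes the sign of \<open>c V\<close>\<close>
  have arc_odd: "c (- u) * W (?\<gamma> (- u) 0) = - (c u * W (?\<gamma> u 0))" if u: "u \<in> {-1/2..1/2}" for u
  proof -
    have h: "?h u > 0" "(?h u)\<^sup>2 = 1 - u\<^sup>2"
      using Im_pos[of u 0] arc_height_square[of u] u by auto
    let ?t = "?\<gamma> u 0"
    have "?t * cnj ?t = 1" using h(2) by (simp add: complex_mult_cnj)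
    then have "- 1 / ?t = - cnj ?t" by (auto simp: divide_simps mult.commute)
    also have "\<dots> = ?\<gamma> (- u) 0" by (simp add: complex_eq_iff)
    finally have W: "W (?\<gamma> (- u) 0) = (cnj ?t)\<^sup>2 * W ?t"
      using invert[of ?t] h by simp
    have "c u = - cnj ?t / of_real (?h u)" "c (- u) = ?t / of_real (?h u)"
      using h(1) by (auto simp: c_def complex_eq_iff)
    then show ?thesis unfolding W using \<open>?t * cnj ?t = 1\<close>
      by (simp add: power2_eq_square algebra_simps)
  qed
  have arc: "integral {-1/2..1/2} (\<lambda>u. c u * W (?\<gamma> u 0)) = 0"
  proof -
    have "integral {-1/2..1/2} (\<lambda>u. c u * W (?\<gamma> u 0)) = integral {-1/2..1/2} (\<lambda>u. c (- u) * W (?\<gamma> (- u) 0))"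
      using Henstock_Kurzweil_Integration.integral_reflect_real[of "1/2" "-1/2" "\<lambda>u. c u * W (?\<gamma> u 0)"]
      by simp
    also have "\<dots> = integral {-1/2..1/2} (\<lambda>u. - (c u * W (?\<gamma> u 0)))"
      by (intro integral_cong arc_odd)
    finally show ?thesis by simp
  qed
  have box_eq: "(LINT x:?A N|lborel. K x) = - integral {-1/2..1/2} (\<lambda>u. c u * W (?\<gamma> u N))"
    if N: "N \<ge> 0" for N
  proof -
    have sub: "?A N \<subseteq> ?S" by (auto simp: cbox_Pair_eq)
    \<comment> \<open>\<open>D\<close> and \<open>E\<close> are the \<open>u\<close>-derivative of \<open>V\<close> and the \<open>s\<close>-derivative of \<open>c V\<close>\<close>
    define D where "D = (\<lambda>u s. Wu (?\<gamma> u s) + of_real (- u / ?h u) * Wv (?\<gamma> u s))"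
    define E where "E = (\<lambda>u s. c u * Wv (?\<gamma> u s))"
    have cf: "fst ` ?A N \<subseteq> {-1/2..1/2}" by (auto simp: cbox_Pair_eq)
    have E_cont: "continuous_on (?A N) (\<lambda>(u, s). E u s)"
      unfolding E_def split_beta by (intro continuous_intros \<gamma>_cont cont sub c_cont cf)
    have K_cont: "continuous_on (?A N) K"
      unfolding K_def by (intro continuous_intros \<gamma>_cont cont sub)
    have D_eq: "D u s = K (u, s) + E u s" for u s
      by (simp add: D_def E_def K_def c_def algebra_simps)
    have D_cont: "continuous_on (?A N) (\<lambda>(u, s). D u s)"
      using continuous_on_add[OF K_cont E_cont] by (simp add: D_eq split_beta)
    have "(LINT x:?A N|lborel. K x) = integral (?A N) K"
      using set_borel_integral_eq_integral(2)[OF set_integrable_subset[OF intS _ sub]] by simp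
    also have "\<dots> = integral (?A N) (\<lambda>x. (\<lambda>(u, s). D u s) x - (\<lambda>(u, s). E u s) x)"
      by (intro integral_cong) (auto simp: D_eq)
    also have "\<dots> = integral (?A N) (\<lambda>(u, s). D u s) - integral (?A N) (\<lambda>(u, s). E u s)"
      by (intro Henstock_Kurzweil_Integration.integral_diff integrable_continuous D_cont E_cont)
    also have "integral (?A N) (\<lambda>(u, s). D u s) = integral {0..N} (\<lambda>s. integral {-1/2..1/2} (\<lambda>u. D u s))"
      using integral_prod_continuous[OF D_cont] integral_swap_continuous[OF D_cont]
      by (simp add: cbox_interval)
    also have "\<dots> = integral {0..N} (\<lambda>s. 0)"
    proof (rule integral_cong)
      fix s assume s: "s \<in> {0..N}"
      have "((\<lambda>u. D u s) has_integral (W (?\<gamma> (1/2) s) - W (?\<gamma> (-1/2) s))) {-1/2..1/2}"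
      proof (rule fundamental_theorem_of_calculus)
        fix u :: real assume u: "u \<in> {-1/2..1/2}"
        have 1: "((\<lambda>u. ?\<gamma> u s) has_derivative (\<lambda>x. Complex x (x * (- u / ?h u)))) (at u)"
        proof -
          have "\<bar>u\<bar> \<le> 1 / 2" using u by auto
          from arc_height_deriv[OF this]
          have "(?h has_derivative (\<lambda>x. x * (- u / ?h u))) (at u)"
            unfolding has_field_derivative_def by (rule has_derivative_eq_rhs) auto
          then show ?thesis
            unfolding Complex_eq by (auto intro!: derivative_eq_intros)
        qed
        have "((\<lambda>u. W (?\<gamma> u s)) has_derivative (\<lambda>x. of_real (Re (Complex x (x * (- u / ?h u)))) * Wu (?\<gamma> u s)
            + of_real (Im (Complex x (x * (- u / ?h u)))) * Wv (?\<gamma> u s))) (at u)"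
          using has_derivative_compose[OF 1 der[of "?\<gamma> u s"]] Im_pos[of u s] u s by simp
        then show "((\<lambda>u. W (?\<gamma> u s)) has_vector_derivative D u s) (at u within {-1/2..1/2})"
          unfolding has_vector_derivative_def
          by (rule has_derivative_at_withinI[OF has_derivative_eq_rhs])
            (auto simp: D_def scaleR_conv_of_real algebra_simps)
      qed simp
      moreover have "W (?\<gamma> (1/2) s) = W (?\<gamma> (-1/2) s)"
      proof -
        have "?\<gamma> (1/2) s = ?\<gamma> (-1/2) s + 1"
          using arc_height_minus[of "1/2"] by (simp add: complex_eq_iff)
        then show ?thesis using translate[of "?\<gamma> (-1/2) s"] Im_pos[of "-1/2" s] s by simp
      qed
      ultimately show "integral {-1/2..1/2} (\<lambda>u. D u s) = 0" by (simp add: integral_unique)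
    qed
    also have "integral (?A N) (\<lambda>(u, s). E u s) = integral {-1/2..1/2} (\<lambda>u. integral {0..N} (E u))"
      using integral_prod_continuous[OF E_cont] by (simp add: cbox_interval)
    also have "\<dots> = integral {-1/2..1/2} (\<lambda>u. c u * W (?\<gamma> u N) - c u * W (?\<gamma> u 0))"
    proof (rule integral_cong)
      fix u :: real assume u: "u \<in> {-1/2..1/2}"
      have "(E u has_integral (c u * W (?\<gamma> u N) - c u * W (?\<gamma> u 0))) {0..N}"
      proof (rule fundamental_theorem_of_calculus)
        fix s assume s: "s \<in> {0..N}"
        have 1: "((\<lambda>s. ?\<gamma> u s) has_derivative (\<lambda>x. Complex 0 x)) (at s)"
          unfolding Complex_eq by (auto intro!: derivative_eq_intros)
        have "((\<lambda>s. W (?\<gamma> u s)) has_derivative (\<lambda>x. of_real (Re (Complex 0 x)) * Wu (?\<gamma> u s)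
            + of_real (Im (Complex 0 x)) * Wv (?\<gamma> u s))) (at s)"
          using has_derivative_compose[OF 1 der[of "?\<gamma> u s"]] Im_pos[of u s] u s by simp
        then have "((\<lambda>s. W (?\<gamma> u s)) has_vector_derivative Wv (?\<gamma> u s)) (at s within {0..N})"
          unfolding has_vector_derivative_def
          by (rule has_derivative_at_withinI[OF has_derivative_eq_rhs])
            (auto simp: scaleR_conv_of_real algebra_simps)
        then show "((\<lambda>s. c u * W (?\<gamma> u s)) has_vector_derivative E u s) (at s within {0..N})"
          unfolding E_def by (rule has_vector_derivative_mult_right)
      qed (use N in simp)
      then show "integral {0..N} (E u) = c u * W (?\<gamma> u N) - c u * W (?\<gamma> u 0)"
        by (rule integral_unique)
    qed
    also have "\<dots> = integral {-1/2..1/2} (\<lambda>u. c u * W (?\<gamma> u N)) - integral {-1/2..1/2} (\<lambda>u. c u * W (?\<gamma> u 0))"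
    proof (rule Henstock_Kurzweil_Integration.integral_diff)
      have "continuous_on {-1/2..1/2} (\<lambda>u. c u * W (?\<gamma> u s))" if "s \<ge> 0" for s
      proof -
        have "continuous_on {-1/2..1/2} (\<lambda>u. W (?\<gamma> u s))"
          by (rule continuous_on_compose2[OF \<gamma>_cont[OF W_cont order_refl], of _ "\<lambda>u. (u, s)", simplified])
            (use that in \<open>auto intro!: continuous_intros\<close>)
        then show ?thesis by (intro continuous_intros c_cont) auto
      qed
      from this[OF N] this[OF order_refl]
      show "(\<lambda>u. c u * W (?\<gamma> u N)) integrable_on {-1/2..1/2}"
        "(\<lambda>u. c u * W (?\<gamma> u 0)) integrable_on {-1/2..1/2}"
        by (simp_all only: integrable_continuous_interval)
    qed
    finally show ?thesis unfolding arc by simp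
  qed
  have "cmod (LINT x:?A (real N)|lborel. K x) \<le> 2 * M / real N" if N: "N > 0" for N
  proof -
    have M: "M \<ge> 0" using order_trans[OF norm_ge_zero decay[of \<i>]] by simp
    have "cmod (integral (cbox (-1/2) (1/2)) (\<lambda>u. c u * W (?\<gamma> u (real N)))) \<le>
        2 * M / real N * measure lborel (cbox (-1/2) (1/2 :: real))"
    proof (rule integrable_bound)
      show "(\<lambda>u. c u * W (?\<gamma> u (real N))) integrable_on cbox (-1/2) (1/2)"
      proof -
        have "continuous_on {-1/2..1/2} (\<lambda>u. W (?\<gamma> u (real N)))"
          by (rule continuous_on_compose2[OF \<gamma>_cont[OF W_cont order_refl], of _ "\<lambda>u. (u, real N)", simplified])
            (auto intro!: continuous_intros)
        then show ?thesis unfolding cbox_interval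
          by (intro integrable_continuous_interval continuous_intros c_cont) auto
      qed
      fix u :: real assume "u \<in> cbox (-1/2) (1/2)"
      then have u: "\<bar>u\<bar> \<le> 1/2" by auto
      have h: "?h u \<ge> 1/2" by (rule arc_height_ge[OF u])
      have "cmod (c u) \<le> cmod (of_real (- u / ?h u)) + cmod \<i>"
        unfolding c_def by (rule norm_triangle_ineq)
      also have "\<dots> \<le> 2" using u h by (simp add: norm_divide divide_simps)
      finally have "cmod (c u) \<le> 2" .
      moreover have "cmod (W (?\<gamma> u (real N))) \<le> M / (?h u + real N)"
        using decay[of "?\<gamma> u (real N)"] N h by simp
      moreover have "M / (?h u + real N) \<le> M / real N"
        using M N h by (intro divide_left_mono) auto
      ultimately show "cmod (c u * W (?\<gamma> u (real N))) \<le> 2 * M / real N"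
        unfolding norm_mult using mult_mono[of "cmod (c u)" 2 "cmod (W (?\<gamma> u (real N)))" "M / real N"]
        by simp
    qed (use M in simp)
    then show ?thesis by (simp only: box_eq of_nat_0_le_iff norm_minus_cancel) (simp add: cbox_interval)
  qed
  then have "\<forall>\<^sub>F N in sequentially. cmod (LINT x:?A (real N)|lborel. K x) \<le> 2 * M / real N"
    by (intro eventually_sequentiallyI[of 1]) auto
  then have "(\<lambda>N. LINT x:?A (real N)|lborel. K x) \<longlonglongrightarrow> 0"
    by (rule Lim_null_comparison) (rule lim_const_over_n)
  with lim have "(LINT x:?S|lborel. K x) = 0" by (rule LIMSEQ_unique)
  with total show ?thesis by simp
qed

text \<open>
  The hypotheses say that \<open>W d(cnj \<tau>)\<close> is invariant under the generators of the modular group;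
  the differential of this form is \<open>D d\<tau> \<and> d(cnj \<tau>)\<close>, which is why only the derivative \<open>D\<close>
  with respect to \<open>\<tau>\<close> occurs in the conclusion.
\<close>
theorem stokes_modular_domain:
  fixes W D D' :: "complex \<Rightarrow> complex"
  assumes der: "\<And>\<tau>. \<tau> \<in> upper_half_plane \<Longrightarrow> (W has_derivative (\<lambda>h. D \<tau> * h + D' \<tau> * cnj h)) (at \<tau>)"
    and cont: "continuous_on upper_half_plane D" "continuous_on upper_half_plane D'"
    and translate: "\<And>\<tau>. \<tau> \<in> upper_half_plane \<Longrightarrow> W (\<tau> + 1) = W \<tau>"
    and invert: "\<And>\<tau>. \<tau> \<in> upper_half_plane \<Longrightarrow> W (- 1 / \<tau>) = (cnj \<tau>)\<^sup>2 * W \<tau>"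
    and decay: "\<And>\<tau>. Im \<tau> \<ge> 1 \<Longrightarrow> cmod (W \<tau>) \<le> M / Im \<tau>"
    and int: "set_integrable lborel modular_domain D"
  shows "(LINT \<tau>:modular_domain|lborel. D \<tau>) = 0"
proof -
  note H = upper_half_plane_def
  define Wu Wv where "Wu = (\<lambda>\<tau>. D \<tau> + D' \<tau>)" and "Wv = (\<lambda>\<tau>. \<i> * (D \<tau> - D' \<tau>))"
  have 2: "Wu \<tau> - \<i> * Wv \<tau> = 2 * D \<tau>" for \<tau> by (simp add: Wu_def Wv_def algebra_simps)
  have "(LINT \<tau>:modular_domain|lborel. Wu \<tau> - \<i> * Wv \<tau>) = 0"
  proof (rule stokes_modular_domain_real)
    show "(W has_derivative (\<lambda>h. of_real (Re h) * Wu \<tau> + of_real (Im h) * Wv \<tau>)) (at \<tau>)" if "Im \<tau> > 0" for \<tau>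
    proof -
      have "D \<tau> * h + D' \<tau> * cnj h = of_real (Re h) * Wu \<tau> + of_real (Im h) * Wv \<tau>" for h
        by (simp add: Wu_def Wv_def complex_eq_iff algebra_simps)
      then show ?thesis using der[of \<tau>] that by (simp add: H)
    qed
    show "continuous_on {\<tau>. Im \<tau> > 0} Wu" "continuous_on {\<tau>. Im \<tau> > 0} Wv"
      using cont unfolding Wu_def Wv_def H by (auto intro!: continuous_intros)
    show "set_integrable lborel modular_domain (\<lambda>\<tau>. Wu \<tau> - \<i> * Wv \<tau>)"
      unfolding 2 by (intro set_integrable_mult_right int)
  qed (use translate invert decay in \<open>auto simp: H\<close>)
  then show ?thesis unfolding 2 by simp
qed


section \<open>Integration over the Jacobi fundamental domain\<close>

text \<open>
  The half-open cell of the fundamental domain over \<open>\<tau>\<close> and the parallelogram spanned by \<open>1\<close> and \<open>\<tau>\<close>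
  are related by the scaling \<open>y = p v\<close>, which produces the factor \<open>v\<close>, and by the shear
  \<open>x = q + p u\<close>, which is harmless because the integrand has period \<open>1\<close>.
\<close>
lemma fibre_integral:
  fixes g :: "complex \<Rightarrow> complex"
  assumes cont: "continuous_on UNIV g" and per: "\<And>z. g (z + 1) = g z" and \<tau>: "Im \<tau> > 0"
  shows "(LINT z:{z. 0 \<le> Re z \<and> Re z < 1 \<and> 0 \<le> Im z \<and> Im z < Im \<tau>}|lborel. g z) =
    of_real (Im \<tau>) * torus_integral (\<lambda>p q. g (of_real p * \<tau> + of_real q))"
proof -
  let ?v = "Im \<tau>"
  let ?S = "{z. 0 \<le> Re z \<and> Re z < 1 \<and> 0 \<le> Im z \<and> Im z < ?v}"
  let ?R = "{0..<1} \<times> {0..<?v} :: (real \<times> real) set"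
  let ?C = "cbox (0, 0) (1, ?v) :: (real \<times> real) set"
  define k where "k = (\<lambda>x. g (Complex (fst x) (snd x)))"
  have g: "continuous_on T (\<lambda>x. g (f x))" if "continuous_on T f" for f :: "'t::topological_space \<Rightarrow> complex" and T
    by (rule continuous_on_compose2[OF cont that]) auto
  have k: "continuous_on T k" for T
    unfolding k_def Complex_eq by (intro g continuous_intros)
  note [measurable] = measurable_Complex_pair
  have [measurable]: "g \<in> borel_measurable borel"
    using cont by (rule borel_measurable_continuous_onI)
  have [measurable]: "?S \<in> sets borel" by measurable
  have "(LINT z:?S|lborel. g z) =
      (LINT z|distr lborel borel (\<lambda>(u, v). Complex u v). indicator ?S z *\<^sub>R g z)"
    unfolding distr_lborel_Complex by (simp add: set_lebesgue_integral_def)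
  also have "\<dots> = (LINT x:?R|lborel. k x)"
    unfolding set_lebesgue_integral_def
    by (subst integral_distr) (auto simp: k_def indicator_def intro!: Bochner_Integration.integral_cong)
  also have "\<dots> = integral ?R k"
  proof (rule set_borel_integral_eq_integral)
    have "set_integrable lborel ?C k"
      unfolding set_integrable_def by (intro borel_integrable_compact k compact_cbox)
    then show "set_integrable lborel ?R k"
      by (rule set_integrable_subset) (auto simp: cbox_Pair_eq borel_prod[symmetric] intro!: pair_measureI)
  qed
  also have "\<dots> = integral ?C k"
  proof (rule integral_subset_negligible)
    show "?R \<subseteq> ?C" by (auto simp: cbox_Pair_eq)
    show "negligible (?C - ?R)"
      by (rule negligible_subset[OF negligible_frontier_interval[of "(0, 0)" "(1, ?v)"]])
        (auto simp: box_def Basis_prod_def)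
  qed
  also have "\<dots> = integral {0..?v} (\<lambda>y. integral {0..1} (\<lambda>x. k (x, y)))"
    using integral_prod_continuous[OF k, of 0 0 1 ?v] integral_swap_continuous[of 0 0 1 ?v "\<lambda>x y. k (x, y)"] k[of ?C]
    by (simp add: cbox_interval)
  also have "\<dots> = of_real ?v * integral {0..1} (\<lambda>p. integral {0..1} (\<lambda>x. k (x, ?v * p)))"
  proof -
    let ?G = "\<lambda>y. integral {0..1} (\<lambda>x. k (x, y))"
    have "continuous_on (cbox (0, 0) (?v, 1)) (\<lambda>x. k (snd x, fst x))"
      unfolding k_def Complex_eq by (intro g continuous_intros)
    from integral_integrable_2dim[OF this]
    have "(?G has_integral integral (cbox 0 ?v) ?G) (cbox 0 ?v)"
      by (simp add: cbox_interval integrable_integral)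
    from has_integral_affinity[OF this, of ?v 0] \<tau>
    have "((\<lambda>p. ?G (?v * p)) has_integral integral {0..?v} ?G /\<^sub>R ?v) ((\<lambda>x. x / ?v) ` {0..?v})"
      by (simp add: inverse_eq_divide)
    moreover have "(\<lambda>x. x / ?v) ` {0..?v} = {0..1}"
      using \<tau> by (auto simp: image_iff divide_simps intro!: bexI[of _ "_ * ?v"])
    ultimately have "integral {0..1} (\<lambda>p. ?G (?v * p)) = integral {0..?v} ?G /\<^sub>R ?v"
      by (simp add: integral_unique)
    then show ?thesis using \<tau> by (simp add: scaleR_conv_of_real field_simps)
  qed
  also have "integral {0..1} (\<lambda>p. integral {0..1} (\<lambda>x. k (x, ?v * p))) =
      torus_integral (\<lambda>p q. k (q, ?v * p))"
    unfolding k_def Complex_eq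
    by (subst torus_integral_iterated) (auto simp: split_beta intro!: g continuous_intros)
  also have "\<dots> = torus_integral (\<lambda>p q. k (q + p * Re \<tau>, ?v * p))"
  proof (rule torus_integral_shear[symmetric])
    show "continuous_on UNIV (\<lambda>(p, q). k (q, ?v * p))"
      unfolding k_def Complex_eq split_beta by (intro g continuous_intros)
    show "k (q + 1, ?v * p) = k (q, ?v * p)" for p q
      using per[of "Complex q (?v * p)"] by (simp add: k_def one_complex.code complex_add)
  qed (intro continuous_intros)
  also have "(\<lambda>p q. k (q + p * Re \<tau>, ?v * p)) = (\<lambda>p q. g (of_real p * \<tau> + of_real q))"
  proof -
    have "Complex (q + p * Re \<tau>) (?v * p) = of_real p * \<tau> + of_real q" for p q
      by (simp add: complex_eq_iff)
    then show ?thesis by (simp add: k_def)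
  qed
  finally show ?thesis .
qed

lemma jacobi_fund_domain_eq:
  "jacobi_fund_domain = {x. fst x \<in> modular_domain \<and>
     0 \<le> Re (snd x) \<and> Re (snd x) < 1 \<and> 0 \<le> Im (snd x) \<and> Im (snd x) < Im (fst x)}"
  by (auto simp: jacobi_fund_domain_def modular_domain_def)

lemma sets_jacobi_fund_domain [measurable]: "jacobi_fund_domain \<in> sets borel"
proof -
  have "{x \<in> space (borel \<Otimes>\<^sub>M borel). fst x \<in> modular_domain \<and>
      0 \<le> Re (snd x) \<and> Re (snd x) < 1 \<and> 0 \<le> Im (snd x) \<and> Im (snd x) < Im (fst x)}
      \<in> sets (borel \<Otimes>\<^sub>M borel)"
    by measurable
  then show ?thesis unfolding borel_prod jacobi_fund_domain_eq by simp
qed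

lemma jacobi_fund_domain_subset: "jacobi_fund_domain \<subseteq> upper_half_plane \<times> UNIV"
  by (auto simp: jacobi_fund_domain_def upper_half_plane_def)

text \<open>
  Finiteness of the hyperbolic area: the domain lies in the strip \<open>\<bar>u\<bar> \<le> 1/2\<close>, \<open>v \<ge> 1/2\<close>, on which
  \<open>1 / v\<^sup>2\<close> has a finite integral.
\<close>
lemma nn_integral_modular_domain:
  assumes "M \<ge> 0"
  shows "(\<integral>\<^sup>+ \<tau>. indicator modular_domain \<tau> * ennreal (M / (Im \<tau>)\<^sup>2) \<partial>lborel) < \<infinity>"
proof -
  have "(\<integral>\<^sup>+ \<tau>. indicator modular_domain \<tau> * ennreal (M / (Im \<tau>)\<^sup>2) \<partial>lborel) =
      (\<integral>\<^sup>+ u. \<integral>\<^sup>+ v. indicator modular_domain (Complex u v) * ennreal (M / v\<^sup>2) \<partial>lborel \<partial>lborel)"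
    by (subst nn_integral_complex_iterated) auto
  also have "\<dots> \<le> (\<integral>\<^sup>+ u. \<integral>\<^sup>+ v. indicator {-1/2..1/2::real} u * (ennreal (M / v\<^sup>2) * indicator {1/2..} v) \<partial>lborel \<partial>lborel)"
  proof (intro nn_integral_mono)
    fix u v :: real
    show "indicator modular_domain (Complex u v) * ennreal (M / v\<^sup>2)
        \<le> indicator {-1/2..1/2} u * (ennreal (M / v\<^sup>2) * indicator {1/2..} v)"
      using modular_domain_Im[of "Complex u v"]
      by (auto simp: indicator_def modular_domain_def)
  qed
  also have "\<dots> = (\<integral>\<^sup>+ u. indicator {-1/2..1/2::real} u * (\<integral>\<^sup>+ v. ennreal (M / v\<^sup>2) * indicator {1/2..} v \<partial>lborel) \<partial>lborel)"
    by (simp add: nn_integral_cmult)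
  also have "(\<integral>\<^sup>+ v. ennreal (M / v\<^sup>2) * indicator {1/2..} v \<partial>lborel) = 0 - (- M / (1/2))"
  proof (rule nn_integral_FTC_atLeast)
    show "((\<lambda>v. - M / v) has_real_derivative M / v\<^sup>2) (at v)" if "1/2 \<le> v" for v
      using that by (auto intro!: derivative_eq_intros simp: power2_eq_square field_simps)
    show "((\<lambda>v. - M / v) \<longlongrightarrow> 0) at_top"
      by (intro tendsto_divide_0[OF tendsto_const] filterlim_at_top_imp_at_infinity filterlim_ident)
  qed (use assms in auto)
  also have "(\<integral>\<^sup>+ u. indicator {-1/2..1/2::real} u * ennreal (0 - (- M / (1/2))) \<partial>lborel) < \<infinity>"
    by (subst nn_integral_multc) (auto simp: ennreal_mult_less_top)
  finally show ?thesis .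
qed

text \<open>
  The fibre over \<open>\<tau>\<close> has area \<open>v\<close>, so the total volume with respect to \<open>du dv dx dy / v\<^sup>3\<close> is the
  hyperbolic area of the modular domain. It is finite, and boundedness is enough for integrability.
\<close>
lemma jacobi_integrableI:
  assumes cont: "continuous_on (upper_half_plane \<times> UNIV) \<Phi>"
    and bound: "\<And>x. x \<in> jacobi_fund_domain \<Longrightarrow> cmod (\<Phi> x) \<le> M"
  shows "jacobi_integrable \<Phi>"
proof -
  let ?D = jacobi_fund_domain
  let ?f = "\<lambda>x. indicator ?D x *\<^sub>R (\<Phi> x / of_real (Im (fst x) ^ 3))"
  define M' where "M' = max M 0"
  have M': "M' \<ge> 0" "\<And>x. x \<in> ?D \<Longrightarrow> cmod (\<Phi> x) \<le> M'" using bound by (fastforce simp: M'_def)+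
  have "continuous_on ?D (\<lambda>x. \<Phi> x / of_real (Im (fst x) ^ 3))"
    using jacobi_fund_domain_subset
    by (intro continuous_intros continuous_on_subset[OF cont]) (auto simp: upper_half_plane_def)
  then have meas: "?f \<in> borel_measurable borel"
    by (intro borel_measurable_continuous_on_indicator) auto
  let ?B = "\<lambda>\<tau> z. indicator modular_domain \<tau> * ennreal (M' / Im \<tau> ^ 3) * indicator (cbox 0 (Complex 1 (Im \<tau>))) z :: ennreal"
  have [measurable]: "(\<lambda>x. ?B (fst x) (snd x)) \<in> borel_measurable (lborel \<Otimes>\<^sub>M lborel)"
  proof -
    have "(\<lambda>x. ?B (fst x) (snd x)) = (\<lambda>x. indicator modular_domain (fst x) * ennreal (M' / Im (fst x) ^ 3) *
        indicator {x. 0 \<le> Re (snd x) \<and> Re (snd x) \<le> 1 \<and> 0 \<le> Im (snd x) \<and> Im (snd x) \<le> Im (fst x)} x)"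
      by (auto simp: fun_eq_iff indicator_def in_cbox_complex_iff)
    also have "\<dots> \<in> borel_measurable (lborel \<Otimes>\<^sub>M lborel)"
      by measurable
    finally show ?thesis .
  qed
  have "(\<integral>\<^sup>+ x. ennreal (norm (?f x)) \<partial>lborel) \<le> (\<integral>\<^sup>+ x. ?B (fst x) (snd x) \<partial>lborel)"
  proof (rule nn_integral_mono)
    fix x :: "complex \<times> complex"
    show "ennreal (norm (?f x)) \<le> ?B (fst x) (snd x)"
    proof (cases "x \<in> ?D")
      case True
      then have "fst x \<in> modular_domain" "snd x \<in> cbox 0 (Complex 1 (Im (fst x)))" "Im (fst x) > 0"
        by (auto simp: jacobi_fund_domain_eq in_cbox_complex_iff modular_domain_def)
      then show ?thesis using True M'(2)[OF True]
        by (auto intro!: ennreal_leI divide_right_mono simp: norm_divide norm_power)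
    qed auto
  qed
  also have "\<dots> = (\<integral>\<^sup>+ \<tau>. \<integral>\<^sup>+ z. ?B \<tau> z \<partial>lborel \<partial>lborel)"
    by (simp add: lborel_prod[symmetric] lborel.nn_integral_fst[symmetric])
  also have "\<dots> = (\<integral>\<^sup>+ \<tau>. indicator modular_domain \<tau> * ennreal (M' / (Im \<tau>)\<^sup>2) \<partial>lborel)"
  proof (rule nn_integral_cong)
    fix \<tau> :: complex
    show "(\<integral>\<^sup>+ z. ?B \<tau> z \<partial>lborel) = indicator modular_domain \<tau> * ennreal (M' / (Im \<tau>)\<^sup>2)"
    proof (cases "\<tau> \<in> modular_domain")
      case True
      then have v: "Im \<tau> > 0" by (auto simp: modular_domain_def)
      have "emeasure lborel (cbox 0 (Complex 1 (Im \<tau>))) = ennreal (Im \<tau>)"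
        using v by (subst emeasure_lborel_cbox) (auto simp: Basis_complex_def)
      then show ?thesis using True v M'(1)
        by (simp add: nn_integral_cmult ennreal_mult[symmetric] power2_eq_square power3_eq_cube)
    qed simp
  qed
  also have "\<dots> < \<infinity>" by (rule nn_integral_modular_domain[OF M'(1)])
  finally have "integrable lborel ?f"
    using meas by (intro integrableI_bounded) auto
  then show ?thesis
    unfolding jacobi_integrable_def set_integrable_def split_beta by simp
qed

lemma jacobi_integral_fibres:
  assumes cont: "continuous_on (upper_half_plane \<times> UNIV) \<Phi>" and int: "jacobi_integrable \<Phi>"
    and per: "\<And>\<tau> z. \<tau> \<in> upper_half_plane \<Longrightarrow> \<Phi> (\<tau>, z + 1) = \<Phi> (\<tau>, z)"
  defines "I \<equiv> \<lambda>\<tau>. torus_integral (\<lambda>p q. \<Phi> (\<tau>, of_real p * \<tau> + of_real q)) / of_real ((Im \<tau>)\<^sup>2)"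
  shows "set_integrable lborel modular_domain I"
    and "jacobi_integral \<Phi> = (LINT \<tau>:modular_domain|lborel. I \<tau>)"
proof -
  let ?D = jacobi_fund_domain
  let ?f = "\<lambda>x. indicator ?D x *\<^sub>R (\<Phi> x / of_real (Im (fst x) ^ 3))"
  have f: "integrable (lborel \<Otimes>\<^sub>M lborel) ?f"
    using int unfolding jacobi_integrable_def set_integrable_def split_beta by (simp add: lborel_prod)
  have fibre: "(\<integral> z. ?f (\<tau>, z) \<partial>lborel) = indicator modular_domain \<tau> *\<^sub>R I \<tau>" for \<tau>
  proof (cases "\<tau> \<in> modular_domain")
    case True
    then have v: "Im \<tau> > 0" "\<tau> \<in> upper_half_plane" by (auto simp: modular_domain_def upper_half_plane_def)
    have c: "continuous_on UNIV (\<lambda>z. \<Phi> (\<tau>, z))"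
      by (rule continuous_on_compose2[OF cont]) (use v in \<open>auto intro!: continuous_intros\<close>)
    let ?S = "{z. 0 \<le> Re z \<and> Re z < 1 \<and> 0 \<le> Im z \<and> Im z < Im \<tau>}"
    have "(\<lambda>z. ?f (\<tau>, z)) = (\<lambda>z. (indicator ?S z *\<^sub>R \<Phi> (\<tau>, z)) / of_real (Im \<tau> ^ 3))"
      using True by (auto simp: jacobi_fund_domain_eq indicator_def)
    then have "(\<integral> z. ?f (\<tau>, z) \<partial>lborel) =
        (LINT z:?S|lborel. \<Phi> (\<tau>, z)) / of_real (Im \<tau> ^ 3)"
      unfolding set_lebesgue_integral_def by (simp only: Bochner_Integration.integral_divide_zero)
    also have "\<dots> = I \<tau>"
      unfolding I_def using v
      by (subst fibre_integral[OF c per[OF v(2)] v(1)]) (simp add: power2_eq_square power3_eq_cube)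
    finally show ?thesis using True by simp
  qed (simp add: jacobi_fund_domain_eq)
  show "set_integrable lborel modular_domain I"
    using lborel_pair.integrable_fst'[OF f] unfolding fibre set_integrable_def .
  have "jacobi_integral \<Phi> = integral\<^sup>L (lborel \<Otimes>\<^sub>M lborel) ?f"
    unfolding jacobi_integral_def set_lebesgue_integral_def split_beta by (simp add: lborel_prod)
  then show "jacobi_integral \<Phi> = (LINT \<tau>:modular_domain|lborel. I \<tau>)"
    using lborel_pair.integral_fst'[OF f] unfolding fibre set_lebesgue_integral_def by simp
qed

section \<open>Holomorphic functions of two variables\<close>

lemma continuous_on_swap_pair:
  assumes "continuous_on (V \<times> U) (\<lambda>(z, w). g z w)"
  shows "continuous_on (U \<times> V) (\<lambda>(w, z). g z w)"
proof -
  have "continuous_on (U \<times> V) (\<lambda>x. (\<lambda>(z, w). g z w) (snd x, fst x))"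
    by (rule continuous_on_compose2[OF assms]) (auto intro!: continuous_intros)
  then show ?thesis by (simp add: split_beta)
qed

text \<open>
  By the inequality of Cauchy on a small circle, the difference of the derivatives at two parameters
  is controlled by the difference of the functions, which is uniformly small on compact sets.
\<close>
lemma continuous_on_deriv_param:
  fixes f :: "complex \<times> 'b::metric_space \<Rightarrow> complex"
  assumes cont: "continuous_on (U \<times> P) f" and U: "open U"
    and hol: "\<And>p. p \<in> P \<Longrightarrow> (\<lambda>w. f (w, p)) holomorphic_on U"
  shows "continuous_on (U \<times> P) (\<lambda>(w, p). deriv (\<lambda>w. f (w, p)) w)"
proof (intro iffD2[OF continuous_on_eq_continuous_within] ballI)
  fix x assume "x \<in> U \<times> P"
  then obtain w0 p0 where x: "x = (w0, p0)" and w0: "w0 \<in> U" and p0: "p0 \<in> P" by auto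
  obtain r' where r': "r' > 0" "cball w0 r' \<subseteq> U"
    using open_contains_cball U w0 by blast
  define r where "r = r' / 2"
  have r: "r > 0" "cball w0 (2 * r) \<subseteq> U" using r' by (auto simp: r_def)
  let ?d = "\<lambda>w p. deriv (\<lambda>w. f (w, p)) w"
  have "((\<lambda>(w, p). ?d w p) \<longlongrightarrow> ?d w0 p0) (at (w0, p0) within U \<times> P)"
  proof (rule tendstoI)
    fix e :: real assume e: "e > 0"
    have "continuous_on (P \<times> cball w0 (2 * r)) (\<lambda>(p, w). f (w, p))"
      unfolding split_beta
      by (rule continuous_on_compose2[OF cont]) (use r in \<open>auto intro!: continuous_intros\<close>)
    then obtain X where X: "p0 \<in> X" "open X"
      and Xe: "\<forall>p\<in>X \<inter> P. \<forall>w\<in>cball w0 (2 * r).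
        dist ((\<lambda>(p, w). f (w, p)) (p, w)) ((\<lambda>(p, w). f (w, p)) (p0, w)) \<le> e * r / 2"
      by (rule continuous_on_prod_compactE[OF _ compact_cball p0, of _ _ _ "e * r / 2"]) (use e r in auto)
    have "continuous_on U (\<lambda>w. ?d w p0)"
      using hol[OF p0] U by (intro holomorphic_on_imp_continuous_on holomorphic_deriv)
    then obtain \<delta> where \<delta>: "\<delta> > 0" "\<And>w. w \<in> U \<Longrightarrow> dist w w0 < \<delta> \<Longrightarrow> dist (?d w p0) (?d w0 p0) < e / 2"
      using w0 e unfolding continuous_on_iff by (metis half_gt_zero)
    have "dist (?d w p) (?d w0 p0) < e"
      if w: "w \<in> ball w0 (min r \<delta>)" and p: "p \<in> X" "p \<in> P" for w p
    proof -
      have sub: "cball w r \<subseteq> cball w0 (2 * r)"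
      proof
        fix v assume "v \<in> cball w r"
        then show "v \<in> cball w0 (2 * r)" using w dist_triangle[of w0 v w] by auto
      qed
      have wU: "w \<in> U" using sub r by force
      have h: "(\<lambda>w. f (w, p) - f (w, p0)) holomorphic_on U"
        using hol p0 p by (intro holomorphic_intros)
      have "cmod ((deriv ^^ 1) (\<lambda>w. f (w, p) - f (w, p0)) w) \<le> fact 1 * (e * r / 2) / r ^ 1"
      proof (rule Cauchy_inequality)
        show "(\<lambda>w. f (w, p) - f (w, p0)) holomorphic_on ball w r"
          using h sub r ball_subset_cball by (blast intro: holomorphic_on_subset)
        show "continuous_on (cball w r) (\<lambda>w. f (w, p) - f (w, p0))"
          using h sub r by (intro holomorphic_on_imp_continuous_on) (blast intro: holomorphic_on_subset)
        fix v assume "cmod (w - v) = r"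
        then have "v \<in> cball w0 (2 * r)" using sub by (auto simp: dist_norm)
        then show "cmod (f (v, p) - f (v, p0)) \<le> e * r / 2" using Xe p by (auto simp: dist_norm)
      qed (use r in auto)
      moreover have "deriv (\<lambda>w. f (w, p) - f (w, p0)) w = ?d w p - ?d w p0"
        using hol[OF p(2)] hol[OF p0] U wU by (intro deriv_diff) (auto simp: holomorphic_on_imp_differentiable_at)
      ultimately have "dist (?d w p) (?d w p0) \<le> e / 2" using r by (simp add: dist_norm)
      moreover have "dist (?d w p0) (?d w0 p0) < e / 2" using \<delta>(2)[OF wU] w by (auto simp: dist_commute)
      ultimately show ?thesis using dist_triangle[of "?d w p" "?d w0 p0" "?d w p0"] by linarith
    qed
    moreover have "open (ball w0 (min r \<delta>) \<times> X)" "(w0, p0) \<in> ball w0 (min r \<delta>) \<times> X"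
      using X r \<delta> by (auto intro: open_Times)
    ultimately show "\<forall>\<^sub>F x in at (w0, p0) within U \<times> P. dist ((\<lambda>(w, p). ?d w p) x) (?d w0 p0) < e"
      unfolding eventually_at_topological by (intro exI[of _ "ball w0 (min r \<delta>) \<times> X"]) auto
  qed
  then show "continuous (at x within U \<times> P) (\<lambda>(w, p). ?d w p)"
    by (simp add: continuous_within x)
qed

text \<open>
  Osgood's lemma: the partial derivatives are jointly continuous by Cauchy's inequality, and continuous
  partial derivatives give the total derivative.
\<close>
lemma separately_holomorphic_imp_has_derivative:
  fixes f :: "complex \<times> complex \<Rightarrow> complex"
  assumes cont: "continuous_on (U \<times> V) f" and U: "open U" and V: "open V"
    and hol1: "\<And>z. z \<in> V \<Longrightarrow> (\<lambda>w. f (w, z)) holomorphic_on U"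
    and hol2: "\<And>w. w \<in> U \<Longrightarrow> (\<lambda>z. f (w, z)) holomorphic_on V"
    and w: "w \<in> U" and z: "z \<in> V"
  shows "(f has_derivative (\<lambda>(h, l). deriv (\<lambda>w. f (w, z)) w * h + deriv (\<lambda>z. f (w, z)) z * l)) (at (w, z))"
proof -
  obtain r where r: "r > 0" "ball z r \<subseteq> V" using V z open_contains_ball by blast
  have sw: "continuous_on (V \<times> U) (\<lambda>(z, w). deriv (\<lambda>z. f (w, z)) z)"
  proof -
    have "continuous_on (V \<times> U) (\<lambda>x. f (snd x, fst x))"
      by (rule continuous_on_compose2[OF cont]) (auto intro!: continuous_intros)
    then show ?thesis
      using continuous_on_deriv_param[of V U "\<lambda>x. f (snd x, fst x)"] V hol2 by simp
  qed
  have c: "continuous_on (U \<times> V) (\<lambda>(w, z). deriv (\<lambda>z. f (w, z)) z)"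
    by (rule continuous_on_swap_pair[OF sw])
  have "((\<lambda>(w, z). f (w, z)) has_derivative
      (\<lambda>(h, l). deriv (\<lambda>w. f (w, z)) w * h + blinfun_mult_right (deriv (\<lambda>z. f (w, z)) z) l))
      (at (w, z) within U \<times> ball z r)"
  proof (rule has_derivative_partialsI)
    show "((\<lambda>w. f (w, z)) has_derivative (*) (deriv (\<lambda>w. f (w, z)) w)) (at w within U)"
      using hol1[OF z] U w holomorphic_derivI[of "\<lambda>w. f (w, z)" U w U]
      by (simp add: has_field_derivative_def)
    fix w' z' assume "w' \<in> U" "z' \<in> ball z r"
    then show "((\<lambda>z. f (w', z)) has_derivative blinfun_apply (blinfun_mult_right (deriv (\<lambda>z. f (w', z)) z')))
        (at z' within ball z r)"
      using hol2 V r holomorphic_derivI[of "\<lambda>z. f (w', z)" V z' "ball z r"]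
      by (auto simp: has_field_derivative_def)
  next
    have "continuous_on (U \<times> ball z r) (\<lambda>(w, z). deriv (\<lambda>z. f (w, z)) z)"
      using c r by (auto intro: continuous_on_subset)
    then have "continuous_on (U \<times> ball z r) (\<lambda>(w, z). blinfun_mult_right (deriv (\<lambda>z. f (w, z)) z))"
      unfolding split_beta
      by (rule bounded_linear.continuous_on[OF bounded_linear_blinfun_mult_right])
    then show "continuous (at (w, z) within U \<times> ball z r) (\<lambda>(w, z). blinfun_mult_right (deriv (\<lambda>z. f (w, z)) z))"
      using w r by (auto simp: continuous_on_eq_continuous_within)
  qed (use r in auto)
  moreover have "at (w, z) within U \<times> ball z r = at (w, z)"
    by (rule at_within_open) (use U w r in \<open>auto intro: open_Times\<close>)
  ultimately show ?thesis by simp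
qed

text \<open>
  The formula of Cauchy expresses the derivative in the second variable as an integral over a circle
  that does not depend on the first variable. This integral can be differentiated under the
  integral sign.
\<close>
lemma deriv_second_holomorphic_first:
  fixes f :: "complex \<times> complex \<Rightarrow> complex"
  assumes cont: "continuous_on (U \<times> V) f" and U: "open U" and V: "open V"
    and hol1: "\<And>z. z \<in> V \<Longrightarrow> (\<lambda>w. f (w, z)) holomorphic_on U"
    and hol2: "\<And>w. w \<in> U \<Longrightarrow> (\<lambda>z. f (w, z)) holomorphic_on V"
    and z: "z \<in> V"
  shows "(\<lambda>w. deriv (\<lambda>z. f (w, z)) z) holomorphic_on U"
proof -
  obtain r where r: "r > 0" "cball z r \<subseteq> V" using V z open_contains_cball by blast
  let ?g = "circlepath z r"
  have g: "?g t \<in> V" "?g t \<noteq> z" if "t \<in> {0..1}" for t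
  proof -
    have "?g t \<in> sphere z r" using that r path_image_circlepath[of z r] less_imp_le[OF r(1)] by (force simp: path_image_def)
    then show "?g t \<in> V" "?g t \<noteq> z" using r by auto
  qed
  define F where "F = (\<lambda>w t. f (w, ?g t) / (?g t - z)\<^sup>2 * vector_derivative ?g (at t))"
  have Fd: "deriv (\<lambda>z. f (w, z)) z = 1 / (2 * of_real pi * \<i>) * integral (cbox 0 1) (F w)" if "w \<in> U" for w
  proof -
    have "((\<lambda>z. f (w, z)) has_field_derivative
        (1 / (2 * of_real pi * \<i>) * contour_integral ?g (\<lambda>u. f (w, u) / (u - z)\<^sup>2))) (at z)"
      using holomorphic_on_subset[OF hol2[OF that] r(2)] r(1)
      by (intro Cauchy_derivative_integral_circlepath(2) holomorphic_on_imp_continuous_on)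
        (auto intro: holomorphic_on_subset ball_subset_cball)
    then show ?thesis unfolding F_def cbox_interval contour_integral_integral by (rule DERIV_imp_deriv)
  qed
  have gc: "continuous_on {0..1} ?g" using path_circlepath[of z r] by (simp add: path_def)
  have vd: "vector_derivative ?g (at t) = 2 * of_real pi * \<i> * of_real r * exp (2 * of_real pi * \<i> * of_real t)" for t
    by (simp add: vector_derivative_circlepath)
  have loc: "(\<lambda>w. integral (cbox 0 1) (F w)) holomorphic_on B" if B: "convex B" "open B" "B \<subseteq> U" for B
  proof (rule leibniz_rule_holomorphic)
    show "((\<lambda>w. F w t) has_field_derivative
        deriv (\<lambda>w. f (w, ?g t)) w / (?g t - z)\<^sup>2 * vector_derivative ?g (at t)) (at w within B)"
      if "w \<in> B" "t \<in> cbox 0 1" for w t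
      unfolding F_def using that B U hol1[OF g(1)[of t]]
      by (intro DERIV_cdivide DERIV_cmult_right holomorphic_derivI[of _ U]) auto
    have ker: "continuous_on (B \<times> cbox 0 1) (\<lambda>x. G (fst x, ?g (snd x)) / (?g (snd x) - z)\<^sup>2 * vector_derivative ?g (at (snd x)))"
      if "continuous_on (U \<times> V) G" for G :: "complex \<times> complex \<Rightarrow> complex"
    proof -
      have gc': "continuous_on (B \<times> cbox 0 1) (\<lambda>x. ?g (snd x))"
        by (rule continuous_on_compose2[OF gc]) (auto intro!: continuous_intros)
      have "continuous_on (B \<times> cbox 0 1) (\<lambda>x. G (fst x, ?g (snd x)))"
        by (rule continuous_on_compose2[OF that]) (use B g in \<open>auto intro!: continuous_intros gc'[unfolded cbox_interval]\<close>)
      then show ?thesis unfolding vd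
        by (intro continuous_intros gc') (use g in auto)
    qed
    show "continuous_on (B \<times> cbox 0 1) (\<lambda>(w, t). deriv (\<lambda>w. f (w, ?g t)) w / (?g t - z)\<^sup>2 * vector_derivative ?g (at t))"
      using ker[OF continuous_on_deriv_param[OF cont U hol1]] by (simp add: split_beta)
    show "F w integrable_on cbox 0 1" if "w \<in> B" for w
    proof (rule integrable_continuous)
      have *: "continuous_on (B \<times> cbox 0 1) (\<lambda>x. F (fst x) (snd x))"
        using ker[OF cont] by (simp add: F_def)
      have "continuous_on (cbox 0 1) (\<lambda>t. F (fst (w, t)) (snd (w, t)))"
        by (rule continuous_on_compose2[OF *]) (use that in \<open>auto intro!: continuous_intros\<close>)
      then show "continuous_on (cbox 0 1) (F w)" by simp
    qed
  qed (use B in auto)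
  have "(\<lambda>w. integral (cbox 0 1) (F w)) holomorphic_on U"
    unfolding holomorphic_on_open[OF U]
  proof (intro ballI)
    fix w assume "w \<in> U"
    then obtain s where s: "s > 0" "ball w s \<subseteq> U" using U open_contains_ball by blast
    then show "\<exists>D. ((\<lambda>w. integral (cbox 0 1) (F w)) has_field_derivative D) (at w)"
      using loc[of "ball w s"] by (auto simp: holomorphic_on_open)
  qed
  then have "(\<lambda>w. 1 / (2 * of_real pi * \<i>) * integral (cbox 0 1) (F w)) holomorphic_on U"
    by (intro holomorphic_intros)
  then show ?thesis by (rule holomorphic_transform) (simp add: Fd)
qed

definition deriv1 :: "(complex \<times> complex \<Rightarrow> complex) \<Rightarrow> complex \<times> complex \<Rightarrow> complex" where
  "deriv1 f = (\<lambda>(w, z). deriv (\<lambda>w. f (w, z)) w)"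

definition deriv2 :: "(complex \<times> complex \<Rightarrow> complex) \<Rightarrow> complex \<times> complex \<Rightarrow> complex" where
  "deriv2 f = (\<lambda>(w, z). deriv (\<lambda>z. f (w, z)) z)"

lemma holomorphic2_on_iff_separately:
  assumes U: "open U" and V: "open V"
  shows "holomorphic2_on f (U \<times> V) \<longleftrightarrow> continuous_on (U \<times> V) f \<and>
    (\<forall>z\<in>V. (\<lambda>w. f (w, z)) holomorphic_on U) \<and> (\<forall>w\<in>U. (\<lambda>z. f (w, z)) holomorphic_on V)"
proof (intro iffI conjI ballI)
  assume f: "holomorphic2_on f (U \<times> V)"
  show "continuous_on (U \<times> V) f"
    using f unfolding holomorphic2_on_def
    by (intro continuous_at_imp_continuous_on ballI) (blast intro: has_derivative_continuous)
  show "(\<lambda>w. f (w, z)) holomorphic_on U" if "z \<in> V" for z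
    unfolding holomorphic_on_open[OF U]
  proof (intro ballI)
    fix w assume "w \<in> U"
    with that f obtain A B where AB: "(f has_derivative (\<lambda>(h, l). A * h + B * l)) (at (w, z))"
      unfolding holomorphic2_on_def by blast
    have "((\<lambda>w. (w, z)) has_derivative (\<lambda>h. (h, 0))) (at w)"
      by (auto intro!: derivative_eq_intros)
    from has_derivative_compose[OF this AB]
    have "((\<lambda>w. f (w, z)) has_derivative (\<lambda>h. A * h)) (at w)"
      by simp
    then show "\<exists>D. ((\<lambda>w. f (w, z)) has_field_derivative D) (at w)"
      by (auto simp: has_field_derivative_def)
  qed
  show "(\<lambda>z. f (w, z)) holomorphic_on V" if "w \<in> U" for w
    unfolding holomorphic_on_open[OF V]
  proof (intro ballI)
    fix z assume "z \<in> V"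
    with that f obtain A B where AB: "(f has_derivative (\<lambda>(h, l). A * h + B * l)) (at (w, z))"
      unfolding holomorphic2_on_def by blast
    have "((\<lambda>z. (w, z)) has_derivative (\<lambda>h. (0, h))) (at z)"
      by (auto intro!: derivative_eq_intros)
    from has_derivative_compose[OF this AB]
    have "((\<lambda>z. f (w, z)) has_derivative (\<lambda>h. B * h)) (at z)"
      by simp
    then show "\<exists>D. ((\<lambda>z. f (w, z)) has_field_derivative D) (at z)"
      by (auto simp: has_field_derivative_def)
  qed
next
  assume "continuous_on (U \<times> V) f \<and>
    (\<forall>z\<in>V. (\<lambda>w. f (w, z)) holomorphic_on U) \<and> (\<forall>w\<in>U. (\<lambda>z. f (w, z)) holomorphic_on V)"
  then show "holomorphic2_on f (U \<times> V)"
    unfolding holomorphic2_on_def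
    using separately_holomorphic_imp_has_derivative[of U V f, OF _ U V] by blast
qed

lemma holomorphic2_has_derivative:
  assumes "holomorphic2_on f (U \<times> V)" "open U" "open V" "x \<in> U \<times> V"
  shows "(f has_derivative (\<lambda>(h, l). deriv1 f x * h + deriv2 f x * l)) (at x)"
  using separately_holomorphic_imp_has_derivative[of U V f "fst x" "snd x"] assms
  by (auto simp: holomorphic2_on_iff_separately deriv1_def deriv2_def)

text \<open>
  The operator \<open>D_J\<close> contains mixed second derivatives, so the partial derivatives of a Jacobi form
  have to be differentiable in both variables jointly.
\<close>
lemma holomorphic2_deriv1:
  assumes f: "holomorphic2_on f (U \<times> V)" and U: "open U" and V: "open V"
  shows "holomorphic2_on (deriv1 f) (U \<times> V)"
proof -
  note f' = f[unfolded holomorphic2_on_iff_separately[OF U V]]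
  have sw: "continuous_on (V \<times> U) (\<lambda>x. f (snd x, fst x))"
    by (rule continuous_on_compose2[OF conjunct1[OF f']]) (auto intro!: continuous_intros)
  show ?thesis
    unfolding holomorphic2_on_iff_separately[OF U V] deriv1_def
    using continuous_on_deriv_param[of U V f] f' U
      deriv_second_holomorphic_first[of V U "\<lambda>x. f (snd x, fst x)", OF sw V U]
    by (auto intro!: holomorphic_deriv)
qed

lemma holomorphic2_deriv2:
  assumes f: "holomorphic2_on f (U \<times> V)" and U: "open U" and V: "open V"
  shows "holomorphic2_on (deriv2 f) (U \<times> V)"
proof -
  note f' = f[unfolded holomorphic2_on_iff_separately[OF U V]]
  have "continuous_on (V \<times> U) (\<lambda>x. f (snd x, fst x))"
    by (rule continuous_on_compose2[OF conjunct1[OF f']]) (auto intro!: continuous_intros)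
  then have sw: "continuous_on (V \<times> U) (\<lambda>(z, w). deriv (\<lambda>z. f (w, z)) z)"
    using continuous_on_deriv_param[of V U "\<lambda>x. f (snd x, fst x)"] V f' by simp
  have "continuous_on (U \<times> V) (\<lambda>(w, z). deriv (\<lambda>z. f (w, z)) z)"
    by (rule continuous_on_swap_pair[OF sw])
  then show ?thesis
    unfolding holomorphic2_on_iff_separately[OF U V] deriv2_def
    using f' V deriv_second_holomorphic_first[of U V f, OF _ U V]
    by (auto intro!: holomorphic_deriv)
qed

section \<open>Wirtinger derivatives and the operator D_J\<close>

lemma upper_half_plane_open: "open upper_half_plane"
  unfolding upper_half_plane_def by (rule open_halfspace_Im_gt)

text \<open>
  The total derivative is recorded by the coefficients of \<open>d\<tau>\<close>, \<open>d(cnj \<tau>)\<close>, \<open>dz\<close>, \<open>d(cnj z)\<close>, in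
  this order. The product rule for these coefficients reduces iterated Wirtinger derivatives of
  products to algebra.
\<close>
definition has_wirtinger ::
  "(complex \<times> complex \<Rightarrow> complex) \<Rightarrow> complex \<Rightarrow> complex \<Rightarrow> complex \<Rightarrow> complex \<Rightarrow> complex \<times> complex \<Rightarrow> bool" where
  "has_wirtinger f A A' B B' x \<longleftrightarrow>
     (f has_derivative (\<lambda>(h, l). A * h + A' * cnj h + B * l + B' * cnj l)) (at x)"

lemma has_wirtinger_eqs:
  assumes "has_wirtinger f A A' B B' x"
  shows "d_tau f x = A" "d_tau_bar f x = A'" "d_z f x = B" "d_z_bar f x = B'"
proof -
  have p: "pdiff w f x = A * fst w + A' * cnj (fst w) + B * snd w + B' * cnj (snd w)" for w
  proof -
    have "((\<lambda>t::real. x + t *\<^sub>R w) has_derivative (\<lambda>t. t *\<^sub>R w)) (at 0)"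
      by (auto intro!: derivative_eq_intros)
    from has_derivative_compose[OF this, of f] assms
    have "((\<lambda>t::real. f (x + t *\<^sub>R w)) has_derivative
        (\<lambda>t. (\<lambda>(h, l). A * h + A' * cnj h + B * l + B' * cnj l) (t *\<^sub>R w))) (at 0)"
      by (simp add: has_wirtinger_def)
    then have "((\<lambda>t::real. f (x + t *\<^sub>R w)) has_vector_derivative
        (A * fst w + A' * cnj (fst w) + B * snd w + B' * cnj (snd w))) (at 0)"
      unfolding has_vector_derivative_def
      by (rule has_derivative_eq_rhs) (auto simp: split_beta scaleR_conv_of_real algebra_simps)
    then show ?thesis unfolding pdiff_def by (rule vector_derivative_at)
  qed
  show "d_tau f x = A" "d_tau_bar f x = A'" "d_z f x = B" "d_z_bar f x = B'"
    unfolding d_tau_def d_tau_bar_def d_z_def d_z_bar_def p by (simp_all add: algebra_simps)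
qed

lemma has_wirtinger_cong_open:
  assumes "has_wirtinger f A A' B B' x" "open S" "x \<in> S" "\<forall>y\<in>S. g y = f y"
  shows "has_wirtinger g A A' B B' x"
  using has_derivative_transform_within_open[of f _ x UNIV S g] assms
  unfolding has_wirtinger_def by auto

lemma has_wirtinger_mult:
  assumes "has_wirtinger f A A' B B' x" "has_wirtinger g C C' D D' x"
  shows "has_wirtinger (\<lambda>x. f x * g x) (f x * C + A * g x) (f x * C' + A' * g x)
    (f x * D + B * g x) (f x * D' + B' * g x) x"
  using has_derivative_mult[OF assms[unfolded has_wirtinger_def]] unfolding has_wirtinger_def
  by (rule has_derivative_eq_rhs) (auto simp: algebra_simps)

lemma has_wirtinger_cmult:
  assumes "has_wirtinger f A A' B B' x"
  shows "has_wirtinger (\<lambda>x. c * f x) (c * A) (c * A') (c * B) (c * B') x"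
  using has_derivative_mult_right[OF assms[unfolded has_wirtinger_def], of c] unfolding has_wirtinger_def
  by (rule has_derivative_eq_rhs) (auto simp: algebra_simps)

lemma has_wirtinger_add:
  assumes "has_wirtinger f A A' B B' x" "has_wirtinger g C C' D D' x"
  shows "has_wirtinger (\<lambda>x. f x + g x) (A + C) (A' + C') (B + D) (B' + D') x"
  using has_derivative_add[OF assms[unfolded has_wirtinger_def]] unfolding has_wirtinger_def
  by (rule has_derivative_eq_rhs) (auto simp: algebra_simps)

lemma has_wirtinger_cnj:
  assumes "has_wirtinger f A A' B B' x"
  shows "has_wirtinger (\<lambda>x. cnj (f x)) (cnj A') (cnj A) (cnj B') (cnj B) x"
  using has_derivative_cnj[OF assms[unfolded has_wirtinger_def]] unfolding has_wirtinger_def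
  by (rule has_derivative_eq_rhs) (auto simp: algebra_simps)

lemma has_wirtinger_holomorphic2:
  assumes "holomorphic2_on f (U \<times> V)" "open U" "open V" "x \<in> U \<times> V"
  shows "has_wirtinger f (deriv1 f x) 0 (deriv2 f x) 0 x"
  using holomorphic2_has_derivative[OF assms] by (simp add: has_wirtinger_def)

text \<open>
  A function of the imaginary parts alone: \<open>d_tau\<close> and \<open>d_tau_bar\<close> act on it as \<open>- \<i>/2\<close> and \<open>\<i>/2\<close> times
  the partial derivative with respect to \<open>v\<close>, and similarly for \<open>z\<close> and \<open>y\<close>.
\<close>
lemma has_wirtinger_Im:
  assumes "(g has_derivative (\<lambda>(a, b). a * gv + b * gy)) (at (Im (fst x), Im (snd x)))"
  shows "has_wirtinger (\<lambda>x. of_real (g (Im (fst x), Im (snd x))))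
    (- \<i> / 2 * of_real gv) (\<i> / 2 * of_real gv) (- \<i> / 2 * of_real gy) (\<i> / 2 * of_real gy) x"
proof -
  have "((\<lambda>x::complex \<times> complex. (Im (fst x), Im (snd x))) has_derivative (\<lambda>h. (Im (fst h), Im (snd h)))) (at x)"
    by (auto intro!: derivative_eq_intros)
  from has_derivative_of_real[OF has_derivative_compose[OF this assms]]
  show ?thesis unfolding has_wirtinger_def
    by (rule has_derivative_eq_rhs) (auto simp: complex_eq_iff)
qed

text \<open>
  \<open>v\<close> times the raising operator of Maass in the variable \<open>\<tau>\<close> at fixed \<open>p\<close>, \<open>q\<close>, transported to the
  coordinates \<open>(\<tau>, z)\<close>; see \<open>jacobi_lift_holomorphic\<close> below. The vector field \<open>v d_tau + y d_z\<close> is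
  \<open>v\<close> times the derivative along \<open>z = p \<tau> + q\<close>.
\<close>
definition jacobi_raise :: "nat \<Rightarrow> nat \<Rightarrow> (complex \<times> complex \<Rightarrow> complex) \<Rightarrow> complex \<times> complex \<Rightarrow> complex" where
  "jacobi_raise k m f = (\<lambda>(\<tau>, z). of_real (Im \<tau>) * deriv1 f (\<tau>, z) + of_real (Im z) * deriv2 f (\<tau>, z)
     + \<i> * of_real (2 * pi * m * (Im z)\<^sup>2 / Im \<tau> - k / 2) * f (\<tau>, z))"

definition jacobi_weight :: "nat \<Rightarrow> nat \<Rightarrow> complex \<times> complex \<Rightarrow> complex" where
  "jacobi_weight k m = (\<lambda>(\<tau>, z). of_real (Im \<tau> ^ k * exp (- 4 * pi * real m * (Im z)\<^sup>2 / Im \<tau>)))"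

lemma petersson_density_eq:
  "petersson_density k m \<phi> \<psi> = (\<lambda>x. \<phi> x * cnj (\<psi> x) * jacobi_weight k m x)"
  by (auto simp: petersson_density_def jacobi_weight_def)

text \<open>
  The second-order part of \<open>D_J\<close> is \<open>4 X (cnj X)\<close> for the vector field \<open>X = v d_tau + y d_z\<close>, with \<open>v\<close>
  and \<open>y\<close> moved to the left of all derivatives. On the weight \<open>\<rho>\<close> the second-order
  expression is \<open>v\<^sup>2\<close> times the second derivative of \<open>v\<^sup>k exp (- 4 \<pi> m p\<^sup>2 v)\<close> with respect to \<open>v\<close>.
  Completing the product of the two raised functions leaves the term \<open>- k \<phi> (cnj \<psi>) \<rho>\<close>.
\<close>
lemma D_J_petersson_density:
  assumes \<phi>: "holomorphic2_on \<phi> (upper_half_plane \<times> UNIV)"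
    and \<psi>: "holomorphic2_on \<psi> (upper_half_plane \<times> UNIV)"
    and x: "x \<in> upper_half_plane \<times> UNIV"
  shows "D_J k (petersson_density k m \<phi> \<psi>) x =
    (4 * jacobi_raise k m \<phi> x * cnj (jacobi_raise k m \<psi> x) - of_nat k * \<phi> x * cnj (\<psi> x)) * jacobi_weight k m x
    - (of_nat k - 1 / 2) * (of_nat k - 3 / 2) * petersson_density k m \<phi> \<psi> x"
proof -
  let ?S = "upper_half_plane \<times> UNIV :: (complex \<times> complex) set"
  \<comment> \<open>\<open>r1\<close> and \<open>r2\<close> are the logarithmic derivatives of \<open>\<rho>\<close> with respect to \<open>v\<close> and \<open>y\<close>\<close>
  define \<rho> where "\<rho> = jacobi_weight k m"
  define r1 r2 :: "real \<times> real \<Rightarrow> real" where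
    "r1 = (\<lambda>x. k / fst x + 4 * pi * m * (snd x)\<^sup>2 / (fst x)\<^sup>2)" and "r2 = (\<lambda>x. - 8 * pi * m * snd x / fst x)"
  define R1 R2 where "R1 = (\<lambda>x. \<i> / 2 * complex_of_real (r1 (Im (fst x), Im (snd x))))"
    and "R2 = (\<lambda>x. \<i> / 2 * complex_of_real (r2 (Im (fst x), Im (snd x))))"
  have S: "open ?S" by (intro open_Times upper_half_plane_open open_UNIV)
  note holo = has_wirtinger_holomorphic2[OF _ upper_half_plane_open open_UNIV]
  note d1 = holomorphic2_deriv1[OF _ upper_half_plane_open open_UNIV]
  note d2 = holomorphic2_deriv2[OF _ upper_half_plane_open open_UNIV]
  have \<rho>: "has_wirtinger \<rho> (- R1 x * \<rho> x) (R1 x * \<rho> x) (- R2 x * \<rho> x) (R2 x * \<rho> x) x" if "x \<in> ?S" for x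
  proof -
    have v: "Im (fst x) > 0" using that by (auto simp: upper_half_plane_def)
    define E where "E = (\<lambda>x :: real \<times> real. fst x ^ k * exp (- 4 * pi * real m * (snd x)\<^sup>2 / fst x))"
    let ?x = "(Im (fst x), Im (snd x))"
    have pw: "k * Im (fst x) ^ (k - Suc 0) = Im (fst x) ^ k * (k / Im (fst x))"
      using v by (cases k) auto
    have "(E has_derivative (\<lambda>(a, b). a * (r1 ?x * E ?x) + b * (r2 ?x * E ?x))) (at ?x)"
      unfolding E_def using v
      by (auto intro!: derivative_eq_intros simp: r1_def r2_def pw power2_eq_square divide_simps algebra_simps fun_eq_iff)
    note 1 = has_wirtinger_Im[OF this]
    have E: "complex_of_real (E (Im (fst x), Im (snd x))) = \<rho> x" for x
      by (simp add: E_def \<rho>_def jacobi_weight_def split_beta)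
    show ?thesis using 1 unfolding of_real_mult E R1_def R2_def by (simp add: mult.assoc)
  qed
  have R1: "has_wirtinger R1 (1 / 4 * of_real s) (- 1 / 4 * of_real s) (1 / 4 * of_real t) (- 1 / 4 * of_real t) x"
    if "x \<in> ?S" "s = - k / (Im (fst x))\<^sup>2 - 8 * pi * m * (Im (snd x))\<^sup>2 / Im (fst x) ^ 3"
      "t = 8 * pi * m * Im (snd x) / (Im (fst x))\<^sup>2" for x s t
  proof -
    have v: "Im (fst x) > 0" using that by (auto simp: upper_half_plane_def)
    have "(r1 has_derivative (\<lambda>(a, b). a * s + b * t)) (at (Im (fst x), Im (snd x)))"
      unfolding r1_def that(2,3) using v
      by (auto intro!: derivative_eq_intros)
        (auto simp: power2_eq_square power3_eq_cube power4_eq_xxxx divide_simps algebra_simps fun_eq_iff)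
    from has_wirtinger_cmult[OF has_wirtinger_Im[OF this], of "\<i> / 2"]
    show ?thesis by (simp add: R1_def)
  qed
  have R2: "has_wirtinger R2 (1 / 4 * of_real s) (- 1 / 4 * of_real s) (1 / 4 * of_real t) (- 1 / 4 * of_real t) x"
    if "x \<in> ?S" "s = 8 * pi * m * Im (snd x) / (Im (fst x))\<^sup>2" "t = - 8 * pi * m / Im (fst x)" for x s t
  proof -
    have v: "Im (fst x) > 0" using that by (auto simp: upper_half_plane_def)
    have "(r2 has_derivative (\<lambda>(a, b). a * s + b * t)) (at (Im (fst x), Im (snd x)))"
      unfolding r2_def that(2,3) using v
      by (auto intro!: derivative_eq_intros)
        (auto simp: power2_eq_square power3_eq_cube power4_eq_xxxx divide_simps algebra_simps fun_eq_iff)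
    from has_wirtinger_cmult[OF has_wirtinger_Im[OF this], of "\<i> / 2"]
    show ?thesis by (simp add: R2_def)
  qed
  let ?F = "petersson_density k m \<phi> \<psi>"
  have F: "?F = (\<lambda>x. \<phi> x * cnj (\<psi> x) * \<rho> x)" by (simp add: petersson_density_eq \<rho>_def)
  have first: "\<forall>x\<in>?S. d_tau_bar ?F x = (\<phi> x * cnj (deriv1 \<psi> x) + \<phi> x * cnj (\<psi> x) * R1 x) * \<rho> x"
    "\<forall>x\<in>?S. d_z ?F x = (deriv2 \<phi> x * cnj (\<psi> x) + - 1 * (\<phi> x * cnj (\<psi> x) * R2 x)) * \<rho> x"
    "\<forall>x\<in>?S. d_z_bar ?F x = (\<phi> x * cnj (deriv2 \<psi> x) + \<phi> x * cnj (\<psi> x) * R2 x) * \<rho> x"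
    unfolding F using has_wirtinger_eqs[OF has_wirtinger_mult[OF has_wirtinger_mult[OF holo[OF \<phi>]
          has_wirtinger_cnj[OF holo[OF \<psi>]]] \<rho>]]
    by (auto simp: algebra_simps)
  note Ha = holo[OF \<phi> x] and Ha2 = holo[OF d2[OF \<phi>] x]
  note Hb = has_wirtinger_cnj[OF holo[OF \<psi> x]]
    and Hb1 = has_wirtinger_cnj[OF holo[OF d1[OF \<psi>] x]]
    and Hb2 = has_wirtinger_cnj[OF holo[OF d2[OF \<psi>] x]]
  note H\<rho> = \<rho>[OF x] and HR1 = R1[OF x refl refl] and HR2 = R2[OF x refl refl]
  note mult = has_wirtinger_mult and add = has_wirtinger_add
  note tr = has_wirtinger_eqs[OF has_wirtinger_cong_open[OF _ S x first(1)]]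
    has_wirtinger_eqs[OF has_wirtinger_cong_open[OF _ S x first(2)]]
    has_wirtinger_eqs[OF has_wirtinger_cong_open[OF _ S x first(3)]]
  note D = tr(1)[OF mult[OF add[OF mult[OF Ha Hb1] mult[OF mult[OF Ha Hb] HR1]] H\<rho>]]
    tr(6)[OF mult[OF add[OF mult[OF Ha2 Hb] has_wirtinger_cmult[OF mult[OF mult[OF Ha Hb] HR2]]] H\<rho>]]
    tr(9)[OF mult[OF add[OF mult[OF Ha Hb2] mult[OF mult[OF Ha Hb] HR2]] H\<rho>]]
    tr(11)[OF mult[OF add[OF mult[OF Ha Hb2] mult[OF mult[OF Ha Hb] HR2]] H\<rho>]]
  obtain \<tau> z where xz: "x = (\<tau>, z)" by force
  define v y where "v = Im \<tau>" and "y = Im z"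
  have v: "v > 0" using x by (auto simp: xz v_def upper_half_plane_def)
  define V Y \<mu> where "V = complex_of_real v" and "Y = complex_of_real y" and "\<mu> = of_real pi * complex_of_real m"
  have V: "V \<noteq> 0" using v by (simp add: V_def)
  have F': "?F (\<tau>, z) = \<phi> (\<tau>, z) * cnj (\<psi> (\<tau>, z)) * \<rho> (\<tau>, z)" by (simp add: F)
  define a a1 a2 b b1 b2 where "a = \<phi> (\<tau>, z)" and "a1 = deriv1 \<phi> (\<tau>, z)" and "a2 = deriv2 \<phi> (\<tau>, z)"
    and "b = cnj (\<psi> (\<tau>, z))" and "b1 = cnj (deriv1 \<psi> (\<tau>, z))" and "b2 = cnj (deriv2 \<psi> (\<tau>, z))"
  note ab = a_def[symmetric] a1_def[symmetric] a2_def[symmetric] b_def[symmetric] b1_def[symmetric] b2_def[symmetric]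
  define A B where "A = of_nat k / V + 4 * \<mu> * Y\<^sup>2 / V\<^sup>2" and "B = - 8 * \<mu> * Y / V"
  have R: "R1 (\<tau>, z) = \<i> * (A / 2)" "R2 (\<tau>, z) = \<i> * (B / 2)"
    by (simp_all add: R1_def R2_def r1_def r2_def A_def B_def V_def Y_def \<mu>_def v_def y_def)
  define P Q where "P = V * a1 + Y * a2" and "Q = V * b1 + Y * b2"
  have raised: "jacobi_raise k m \<phi> (\<tau>, z) = P + \<i> * (2 * \<mu> * Y\<^sup>2 / V - of_nat k / 2) * a"
    "cnj (jacobi_raise k m \<psi> (\<tau>, z)) = Q - \<i> * (2 * \<mu> * Y\<^sup>2 / V - of_nat k / 2) * b"
    by (simp_all add: jacobi_raise_def P_def Q_def a_def a1_def a2_def b_def b1_def b2_def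
        V_def Y_def \<mu>_def v_def y_def)
  \<comment> \<open>the derivative of \<open>log \<rho>\<close> along the Euler field \<open>v \<partial>/\<partial>v + y \<partial>/\<partial>y\<close>\<close>
  have X: "V * A + Y * B = - 2 * (2 * \<mu> * Y\<^sup>2 / V - of_nat k / 2)"
    using V by (simp add: A_def B_def field_simps power2_eq_square)
  define C11 C12 C22 where "C11 = - of_nat k / V\<^sup>2 - 8 * \<mu> * Y\<^sup>2 / V ^ 3" and "C12 = 8 * \<mu> * Y / V\<^sup>2"
    and "C22 = - 8 * \<mu> / V"
  \<comment> \<open>the pure second-order part of the square of the Euler field, applied to \<open>log \<rho>\<close>\<close>
  have C: "V\<^sup>2 * C11 + 2 * V * Y * C12 + Y\<^sup>2 * C22 = - of_nat k"
    using V by (simp add: C11_def C12_def C22_def field_simps power2_eq_square power3_eq_cube)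
  have t11: "d_tau (d_tau_bar ?F) (\<tau>, z) = ((a1 - \<i> * (A / 2) * a) * (b1 + \<i> * (A / 2) * b) + a * b * C11 / 4) * \<rho> (\<tau>, z)"
    unfolding D[unfolded xz] by (simp add: ab R C11_def V_def Y_def \<mu>_def v_def y_def algebra_simps add_divide_distrib diff_divide_distrib)
  have t21: "d_tau_bar (d_z ?F) (\<tau>, z) = ((a2 - \<i> * (B / 2) * a) * (b1 + \<i> * (A / 2) * b) + a * b * C12 / 4) * \<rho> (\<tau>, z)"
    unfolding D[unfolded xz] by (simp add: ab R C12_def V_def Y_def \<mu>_def v_def y_def algebra_simps add_divide_distrib diff_divide_distrib)
  have t12: "d_tau (d_z_bar ?F) (\<tau>, z) = ((a1 - \<i> * (A / 2) * a) * (b2 + \<i> * (B / 2) * b) + a * b * C12 / 4) * \<rho> (\<tau>, z)"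
    unfolding D[unfolded xz] by (simp add: ab R C12_def V_def Y_def \<mu>_def v_def y_def algebra_simps add_divide_distrib diff_divide_distrib)
  have t22: "d_z (d_z_bar ?F) (\<tau>, z) = ((a2 - \<i> * (B / 2) * a) * (b2 + \<i> * (B / 2) * b) + a * b * C22 / 4) * \<rho> (\<tau>, z)"
    unfolding D[unfolded xz] by (simp add: ab R C22_def V_def Y_def \<mu>_def v_def y_def algebra_simps add_divide_distrib diff_divide_distrib)
  have "4 * V\<^sup>2 * d_tau (d_tau_bar ?F) (\<tau>, z) + 4 * Y\<^sup>2 * d_z (d_z_bar ?F) (\<tau>, z)
      + 4 * V * Y * (d_tau_bar (d_z ?F) (\<tau>, z) + d_tau (d_z_bar ?F) (\<tau>, z)) =
    (4 * (P - \<i> / 2 * (V * A + Y * B) * a) * (Q + \<i> / 2 * (V * A + Y * B) * b)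
      + a * b * (V\<^sup>2 * C11 + 2 * V * Y * C12 + Y\<^sup>2 * C22)) * \<rho> (\<tau>, z)"
    unfolding t11 t12 t21 t22 P_def Q_def by (simp add: field_simps power2_eq_square)
  also have "\<dots> = (4 * jacobi_raise k m \<phi> (\<tau>, z) * cnj (jacobi_raise k m \<psi> (\<tau>, z)) - of_nat k * a * b) * \<rho> (\<tau>, z)"
    unfolding raised X C by (simp add: field_simps)
  finally show ?thesis
    unfolding D_J_def xz prod.case Let_def by (simp add: F' \<rho>_def ab V_def Y_def v_def y_def)
qed

section \<open>Jacobi forms in the coordinates p, q\<close>

lemma e2pi_add: "e2pi (a + b) = e2pi a * e2pi b"
  by (simp add: e2pi_def exp_add ring_distribs)

lemma e2pi_0 [simp]: "e2pi 0 = 1"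
  by (simp add: e2pi_def)

lemma norm_e2pi: "cmod (e2pi w) = exp (- 2 * pi * Im w)"
  by (simp add: e2pi_def)

lemma e2pi_mult_cnj: "e2pi w * cnj (e2pi w) = of_real (exp (- 4 * pi * Im w))"
proof -
  have "e2pi w * cnj (e2pi w) = of_real ((cmod (e2pi w))\<^sup>2)"
    by (rule complex_norm_square[symmetric])
  also have "(cmod (e2pi w))\<^sup>2 = exp (- 4 * pi * Im w)"
    unfolding norm_e2pi power2_eq_square exp_add[symmetric] by simp
  finally show ?thesis .
qed

lemma continuous_e2pi [continuous_intros]:
  "continuous_on S f \<Longrightarrow> continuous_on S (\<lambda>x. e2pi (f x))"
  unfolding e2pi_def by (intro continuous_intros)

text \<open>
  The restriction of \<open>\<phi>\<close> to the curve \<open>z = p \<tau> + q\<close>, normalised by the holomorphic factor whose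
  squared modulus is \<open>exp (- 4 \<pi> m y\<^sup>2 / v)\<close>. It behaves like a modular form of weight \<open>k\<close> in \<open>\<tau>\<close>,
  except that the modular group permutes the parameters \<open>(p, q)\<close>.
\<close>
definition jacobi_lift ::
  "nat \<Rightarrow> (complex \<times> complex \<Rightarrow> complex) \<Rightarrow> real \<Rightarrow> real \<Rightarrow> complex \<Rightarrow> complex" where
  "jacobi_lift m \<phi> p q \<tau> = e2pi (of_real (m * p\<^sup>2) * \<tau>) * \<phi> (\<tau>, of_real p * \<tau> + of_real q)"

text \<open>
  \<open>v\<close> times the raising operator \<open>d/d\<tau> + k / (2 \<i> v)\<close> of Maass.
\<close>
definition maass_raise :: "nat \<Rightarrow> (complex \<Rightarrow> complex) \<Rightarrow> complex \<Rightarrow> complex" where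
  "maass_raise k f \<tau> = of_real (Im \<tau>) * deriv f \<tau> - \<i> * of_nat k / 2 * f \<tau>"

lemma holomorphic2_jacobi: "\<phi> \<in> jacobi_forms k m \<Longrightarrow> holomorphic2_on \<phi> (upper_half_plane \<times> UNIV)"
  by (simp add: jacobi_forms_def)

lemma jacobi_forms_cont: "\<phi> \<in> jacobi_forms k m \<Longrightarrow> continuous_on (upper_half_plane \<times> UNIV) \<phi>"
  using holomorphic2_jacobi holomorphic2_on_iff_separately[OF upper_half_plane_open open_UNIV] by blast

lemma jacobi_modular:
  assumes "\<phi> \<in> jacobi_forms k m" and "a * d - b * c = 1" and "\<tau> \<in> upper_half_plane"
  shows "\<phi> ((of_int a * \<tau> + of_int b) / (of_int c * \<tau> + of_int d), z / (of_int c * \<tau> + of_int d)) =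
    (of_int c * \<tau> + of_int d) ^ k * e2pi (of_nat m * of_int c * z\<^sup>2 / (of_int c * \<tau> + of_int d)) * \<phi> (\<tau>, z)"
  using assms unfolding jacobi_forms_def by blast

lemma jacobi_translate:
  assumes "\<phi> \<in> jacobi_forms k m" "\<tau> \<in> upper_half_plane"
  shows "\<phi> (\<tau> + 1, z) = \<phi> (\<tau>, z)"
proof -
  from jacobi_modular[OF assms(1), of 1 1 1 0 \<tau> z] show ?thesis using assms(2) by simp
qed

lemma jacobi_invert:
  assumes "\<phi> \<in> jacobi_forms k m" "\<tau> \<in> upper_half_plane"
  shows "\<phi> (- 1 / \<tau>, z / \<tau>) = \<tau> ^ k * e2pi (of_nat m * z\<^sup>2 / \<tau>) * \<phi> (\<tau>, z)"
proof -
  from jacobi_modular[OF assms(1), of 0 0 "-1" 1 \<tau> z] show ?thesis using assms(2) by simp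
qed

lemma jacobi_elliptic:
  assumes "\<phi> \<in> jacobi_forms k m" "\<tau> \<in> upper_half_plane"
  shows "\<phi> (\<tau>, z + 1) = \<phi> (\<tau>, z)"
    and "\<phi> (\<tau>, z + \<tau>) = e2pi (- of_nat m * (\<tau> + 2 * z)) * \<phi> (\<tau>, z)"
proof -
  have *: "\<forall>l \<mu> :: int. \<forall>\<tau>\<in>upper_half_plane. \<forall>z. \<phi> (\<tau>, z + of_int l * \<tau> + of_int \<mu>) =
      e2pi (- of_nat m * ((of_int l)\<^sup>2 * \<tau> + 2 * of_int l * z)) * \<phi> (\<tau>, z)"
    using assms(1) by (simp add: jacobi_forms_def)
  show "\<phi> (\<tau>, z + 1) = \<phi> (\<tau>, z)" using *[rule_format, of \<tau> z 0 1] assms(2) by simp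
  show "\<phi> (\<tau>, z + \<tau>) = e2pi (- of_nat m * (\<tau> + 2 * z)) * \<phi> (\<tau>, z)"
    using *[rule_format, of \<tau> z 1 0] assms(2) by simp
qed

lemma jacobi_lift_periodic_q:
  assumes "\<phi> \<in> jacobi_forms k m" "\<tau> \<in> upper_half_plane"
  shows "jacobi_lift m \<phi> p (q + 1) \<tau> = jacobi_lift m \<phi> p q \<tau>"
  using jacobi_elliptic(1)[OF assms, of "of_real p * \<tau> + of_real q"]
  by (simp add: jacobi_lift_def add.assoc)

lemma jacobi_lift_periodic_p:
  assumes "\<phi> \<in> jacobi_forms k m" "\<tau> \<in> upper_half_plane"
  shows "jacobi_lift m \<phi> (p + 1) q \<tau> = e2pi (of_real (- 2 * real m * q)) * jacobi_lift m \<phi> p q \<tau>"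
proof -
  let ?z = "of_real p * \<tau> + of_real q"
  have "jacobi_lift m \<phi> (p + 1) q \<tau> = e2pi (of_real (m * (p + 1)\<^sup>2) * \<tau>) * \<phi> (\<tau>, ?z + \<tau>)"
    by (simp add: jacobi_lift_def algebra_simps)
  also have "\<dots> = e2pi (of_real (m * (p + 1)\<^sup>2) * \<tau> + (- of_nat m * (\<tau> + 2 * ?z))) * \<phi> (\<tau>, ?z)"
    unfolding jacobi_elliptic(2)[OF assms] by (simp only: e2pi_add mult.assoc)
  also have "of_real (m * (p + 1)\<^sup>2) * \<tau> + (- of_nat m * (\<tau> + 2 * ?z)) =
      of_real (- 2 * real m * q) + of_real (m * p\<^sup>2) * \<tau>"
    by (simp add: power2_eq_square algebra_simps)
  finally show ?thesis by (simp only: e2pi_add jacobi_lift_def mult.assoc)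
qed

lemma jacobi_lift_translate:
  assumes "\<phi> \<in> jacobi_forms k m" "\<tau> \<in> upper_half_plane"
  shows "jacobi_lift m \<phi> p q (\<tau> + 1) = e2pi (of_real (m * p\<^sup>2)) * jacobi_lift m \<phi> p (q + p) \<tau>"
proof -
  have "jacobi_lift m \<phi> p q (\<tau> + 1) =
      e2pi (of_real (m * p\<^sup>2) + of_real (m * p\<^sup>2) * \<tau>) * \<phi> (\<tau> + 1, of_real p * \<tau> + of_real (q + p))"
    by (simp add: jacobi_lift_def algebra_simps)
  then show ?thesis
    unfolding jacobi_translate[OF assms] by (simp only: e2pi_add jacobi_lift_def mult.assoc)
qed

lemma jacobi_lift_invert:
  assumes "\<phi> \<in> jacobi_forms k m" "\<tau> \<in> upper_half_plane"
  shows "jacobi_lift m \<phi> (- q) p (- 1 / \<tau>) = e2pi (of_real (2 * real m * p * q)) * \<tau> ^ k * jacobi_lift m \<phi> p q \<tau>"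
proof -
  let ?z = "of_real p * \<tau> + of_real q"
  have \<tau>: "\<tau> \<noteq> 0" using assms(2) by (auto simp: upper_half_plane_def)
  have "of_real (- q) * (- 1 / \<tau>) + of_real p = ?z / \<tau>" using \<tau> by (simp add: field_simps)
  then have "jacobi_lift m \<phi> (- q) p (- 1 / \<tau>) = e2pi (of_real (m * q\<^sup>2) * (- 1 / \<tau>)) * \<phi> (- 1 / \<tau>, ?z / \<tau>)"
    by (simp only: jacobi_lift_def power2_minus)
  also have "\<dots> = e2pi (of_real (m * q\<^sup>2) * (- 1 / \<tau>) + of_nat m * ?z\<^sup>2 / \<tau>) * \<tau> ^ k * \<phi> (\<tau>, ?z)"
    unfolding jacobi_invert[OF assms] e2pi_add by (simp only: mult_ac)
  also have "of_real (m * q\<^sup>2) * (- 1 / \<tau>) + of_nat m * ?z\<^sup>2 / \<tau> =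
      of_real (2 * real m * p * q) + of_real (m * p\<^sup>2) * \<tau>"
    using \<tau> by (simp add: power2_eq_square field_simps)
  finally show ?thesis by (simp only: e2pi_add jacobi_lift_def mult_ac)
qed

lemma jacobi_lift_holomorphic:
  assumes "\<phi> \<in> jacobi_forms k m"
  shows "jacobi_lift m \<phi> p q holomorphic_on upper_half_plane"
    and "\<tau> \<in> upper_half_plane \<Longrightarrow>
      maass_raise k (jacobi_lift m \<phi> p q) \<tau> = e2pi (of_real (m * p\<^sup>2) * \<tau>) * jacobi_raise k m \<phi> (\<tau>, of_real p * \<tau> + of_real q)"
proof -
  have d: "(jacobi_lift m \<phi> p q has_field_derivative
      e2pi (of_real (m * p\<^sup>2) * \<tau>) * (2 * of_real pi * \<i> * of_real (m * p\<^sup>2) * \<phi> (\<tau>, of_real p * \<tau> + of_real q)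
        + deriv1 \<phi> (\<tau>, of_real p * \<tau> + of_real q) + of_real p * deriv2 \<phi> (\<tau>, of_real p * \<tau> + of_real q))) (at \<tau>)"
    (is "(_ has_field_derivative ?D \<tau>) _") if \<tau>: "\<tau> \<in> upper_half_plane" for \<tau>
  proof -
    let ?x = "(\<tau>, of_real p * \<tau> + of_real q)"
    have 1: "((\<lambda>\<tau>. (\<tau>, of_real p * \<tau> + of_real q)) has_derivative (\<lambda>h. (h, of_real p * h))) (at \<tau>)"
      by (auto intro!: derivative_eq_intros)
    have "(\<phi> has_derivative (\<lambda>(h, l). deriv1 \<phi> ?x * h + deriv2 \<phi> ?x * l)) (at ?x)"
      using holomorphic2_has_derivative[OF holomorphic2_jacobi[OF assms] upper_half_plane_open open_UNIV] \<tau> by auto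
    from has_derivative_compose[OF 1 this]
    have 2: "((\<lambda>\<tau>. \<phi> (\<tau>, of_real p * \<tau> + of_real q)) has_field_derivative
        (deriv1 \<phi> ?x + of_real p * deriv2 \<phi> ?x)) (at \<tau>)"
      unfolding has_field_derivative_def by (rule has_derivative_eq_rhs) (auto simp: algebra_simps)
    show ?thesis
      unfolding jacobi_lift_def[abs_def] e2pi_def
      by (auto intro!: derivative_eq_intros 2) (simp add: algebra_simps)
  qed
  show "jacobi_lift m \<phi> p q holomorphic_on upper_half_plane"
    unfolding holomorphic_on_open[OF upper_half_plane_open] using d by blast
  show "maass_raise k (jacobi_lift m \<phi> p q) \<tau> = e2pi (of_real (m * p\<^sup>2) * \<tau>) * jacobi_raise k m \<phi> (\<tau>, of_real p * \<tau> + of_real q)"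
    if \<tau>: "\<tau> \<in> upper_half_plane"
  proof -
    have v: "Im \<tau> \<noteq> 0" using \<tau> by (simp add: upper_half_plane_def)
    then show ?thesis
      unfolding maass_raise_def DERIV_imp_deriv[OF d[OF \<tau>]]
      by (simp add: jacobi_raise_def jacobi_lift_def field_simps power2_eq_square)
  qed
qed

lemma jacobi_lift_continuous:
  assumes "\<phi> \<in> jacobi_forms k m"
  shows "continuous_on (upper_half_plane \<times> UNIV) (\<lambda>(\<tau>, p, q). jacobi_lift m \<phi> p q \<tau>)"
proof -
  have "continuous_on (upper_half_plane \<times> UNIV) (\<lambda>x :: complex \<times> real \<times> real.
      \<phi> (fst x, of_real (fst (snd x)) * fst x + of_real (snd (snd x))))"
    by (rule continuous_on_compose2[OF jacobi_forms_cont[OF assms]]) (auto intro!: continuous_intros)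
  then show ?thesis unfolding jacobi_lift_def split_beta by (intro continuous_intros)
qed

lemma maass_raise_translate:
  assumes f: "f holomorphic_on upper_half_plane" and g: "g holomorphic_on upper_half_plane"
    and eq: "\<And>\<tau>. \<tau> \<in> upper_half_plane \<Longrightarrow> f (\<tau> + of_real a) = \<epsilon> * g \<tau>" and \<tau>: "\<tau> \<in> upper_half_plane"
  shows "maass_raise k f (\<tau> + of_real a) = \<epsilon> * maass_raise k g \<tau>"
proof -
  have \<tau>': "\<tau> + of_real a \<in> upper_half_plane" using \<tau> by (simp add: upper_half_plane_def)
  have "((\<lambda>\<tau>. f (\<tau> + of_real a)) has_field_derivative deriv f (\<tau> + of_real a) * 1) (at \<tau>)"
    by (rule DERIV_chain2[where f = f and g = "\<lambda>\<tau>. \<tau> + of_real a"])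
      (auto intro!: derivative_eq_intros holomorphic_derivI[OF f upper_half_plane_open \<tau>'])
  then have "((\<lambda>\<tau>. \<epsilon> * g \<tau>) has_field_derivative deriv f (\<tau> + of_real a) * 1) (at \<tau>)"
    by (rule has_field_derivative_transform_within_open[OF _ upper_half_plane_open \<tau>]) (simp add: eq)
  moreover have "((\<lambda>\<tau>. \<epsilon> * g \<tau>) has_field_derivative \<epsilon> * deriv g \<tau>) (at \<tau>)"
    by (intro DERIV_cmult holomorphic_derivI[OF g upper_half_plane_open \<tau>])
  ultimately have "deriv f (\<tau> + of_real a) = \<epsilon> * deriv g \<tau>"
    using DERIV_unique by fastforce
  then show ?thesis using eq[OF \<tau>] by (simp add: maass_raise_def algebra_simps)
qed

lemma Im_invert: "Im (- 1 / \<tau>) = Im \<tau> / (cmod \<tau>)\<^sup>2"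
  by (simp add: Im_divide cmod_power2)

lemma upper_half_plane_invert: "\<tau> \<in> upper_half_plane \<Longrightarrow> - 1 / \<tau> \<in> upper_half_plane"
  unfolding upper_half_plane_def mem_Collect_eq Im_invert by (cases "\<tau> = 0") auto

text \<open>
  The raising operator maps weight \<open>k\<close> to weight \<open>k + 2\<close>; multiplication by \<open>v\<close> turns the extra factor
  \<open>\<tau>\<^sup>2\<close> into \<open>\<tau>\<^sup>2 / (\<tau> (cnj \<tau>))\<close>. The computation comes down to \<open>v = (\<tau> - cnj \<tau>) / (2 \<i>)\<close>.
\<close>
lemma maass_raise_invert:
  assumes f: "f holomorphic_on upper_half_plane" and g: "g holomorphic_on upper_half_plane"
    and eq: "\<And>\<tau>. \<tau> \<in> upper_half_plane \<Longrightarrow> f (- 1 / \<tau>) = \<epsilon> * \<tau> ^ k * g \<tau>" and \<tau>: "\<tau> \<in> upper_half_plane"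
  shows "maass_raise k f (- 1 / \<tau>) = \<epsilon> * \<tau> ^ k * (\<tau> / cnj \<tau>) * maass_raise k g \<tau>"
proof -
  have \<tau>0: "\<tau> \<noteq> 0" using \<tau> by (auto simp: upper_half_plane_def)
  note \<tau>' = upper_half_plane_invert[OF \<tau>]
  have "((\<lambda>\<tau>. f (- 1 / \<tau>)) has_field_derivative deriv f (- 1 / \<tau>) * (1 / \<tau>\<^sup>2)) (at \<tau>)"
    by (rule DERIV_chain2[where f = f and g = "\<lambda>\<tau>. - 1 / \<tau>"], rule holomorphic_derivI[OF f upper_half_plane_open \<tau>'])
      (use \<tau>0 in \<open>auto intro!: derivative_eq_intros simp: power2_eq_square\<close>)
  then have "((\<lambda>\<tau>. \<epsilon> * \<tau> ^ k * g \<tau>) has_field_derivative deriv f (- 1 / \<tau>) * (1 / \<tau>\<^sup>2)) (at \<tau>)"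
    by (rule has_field_derivative_transform_within_open[OF _ upper_half_plane_open \<tau>]) (simp only: eq)
  moreover have "((\<lambda>\<tau>. \<epsilon> * \<tau> ^ k * g \<tau>) has_field_derivative
      \<epsilon> * \<tau> ^ k * (of_nat k / \<tau> * g \<tau> + deriv g \<tau>)) (at \<tau>)"
  proof -
    have pw: "of_nat k * \<tau> ^ (k - Suc 0) = \<tau> ^ k * (of_nat k / \<tau>)"
      using \<tau>0 by (cases k) auto
    show ?thesis
      by (auto intro!: derivative_eq_intros holomorphic_derivI[OF g upper_half_plane_open \<tau>] simp: pw)
        (simp add: algebra_simps)
  qed
  ultimately have "deriv f (- 1 / \<tau>) * (1 / \<tau>\<^sup>2) = \<epsilon> * \<tau> ^ k * (of_nat k / \<tau> * g \<tau> + deriv g \<tau>)"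
    by (rule DERIV_unique)
  then have d: "deriv f (- 1 / \<tau>) = \<tau>\<^sup>2 * (\<epsilon> * \<tau> ^ k * (of_nat k / \<tau> * g \<tau> + deriv g \<tau>))"
    using \<tau>0 by (simp add: field_simps)
  have v: "complex_of_real (Im (- 1 / \<tau>)) = of_real (Im \<tau>) / (\<tau> * cnj \<tau>)"
    unfolding Im_invert complex_norm_square[symmetric] by simp
  have im: "of_real (Im \<tau>) = (\<tau> - cnj \<tau>) / (2 * \<i>)"
    by (simp add: complex_eq_iff)
  have c0: "cnj \<tau> \<noteq> 0" using \<tau>0 by simp
  have "maass_raise k f (- 1 / \<tau>) - \<epsilon> * \<tau> ^ k * (\<tau> / cnj \<tau>) * maass_raise k g \<tau> =
      \<epsilon> * \<tau> ^ k * g \<tau> * of_nat k * (of_real (Im \<tau>) / cnj \<tau> - \<i> / 2 + \<i> / 2 * (\<tau> / cnj \<tau>))"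
    unfolding maass_raise_def d v eq[OF \<tau>] using \<tau>0 c0 by (simp add: field_simps power2_eq_square)
  also have "of_real (Im \<tau>) / cnj \<tau> - \<i> / 2 + \<i> / 2 * (\<tau> / cnj \<tau>) = 0"
    unfolding im using c0 by (simp add: field_simps)
  finally show ?thesis by simp
qed

text \<open>
  Put \<open>X = n + r p + m p\<^sup>2\<close>. Completing the square gives \<open>X = n - r\<^sup>2 / (4 m) + m (p + r / (2 m))\<^sup>2\<close>,
  hence \<open>X \<ge> \<kappa>\<close> whenever \<open>c n r \<noteq> 0\<close>. So all terms of the expansion decay at least like
  \<open>exp (- 2 \<pi> \<kappa> v)\<close> relative to height \<open>1/4\<close>. At this height a single convergent majorant
  works for all \<open>p\<close> between \<open>0\<close> and \<open>1\<close>, because an exponential of \<open>r p\<close> is bounded by the sum of its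
  values at \<open>p = 0\<close> and \<open>p = 1\<close>, that is, by the expansions at \<open>z = 0\<close> and \<open>z = \<tau>\<close> with \<open>\<tau> = \<i> / 4\<close>.
\<close>
lemma jacobi_lift_bound:
  assumes exp: "jacobi_expansion m \<phi> c" and m: "m \<ge> 1" and \<kappa>: "\<kappa> \<ge> 0"
    and gap: "\<And>n r. r\<^sup>2 \<le> 4 * int m * n \<Longrightarrow> c n r \<noteq> 0 \<Longrightarrow> \<kappa> \<le> of_int n - (of_int r)\<^sup>2 / (4 * real m)"
  shows "\<exists>C\<ge>0. \<forall>\<tau> p q. Im \<tau> \<ge> 1/4 \<longrightarrow> 0 \<le> p \<longrightarrow> p \<le> 1 \<longrightarrow>
    cmod (jacobi_lift m \<phi> p q \<tau>) \<le> C * exp (- 2 * pi * \<kappa> * Im \<tau>)"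
proof -
  let ?I = "{(n, r). r\<^sup>2 \<le> 4 * int m * n}"
  define B where "B = (\<lambda>(n, r). cmod (c n r) * exp (- 2 * pi * (of_int n / 4))
      + cmod (c n r) * exp (- 2 * pi * ((of_int n + of_int r) / 4)))"
  have abs: "(\<lambda>x. cmod ((\<lambda>(n, r). c n r * e2pi (of_int n * \<tau> + of_int r * z)) x)) summable_on ?I"
    if "Im \<tau> > 0" for \<tau> z
  proof -
    have "((\<lambda>(n, r). c n r * e2pi (of_int n * \<tau> + of_int r * z)) has_sum \<phi> (\<tau>, z)) ?I"
      using exp that unfolding jacobi_expansion_def upper_half_plane_def by blast
    then show ?thesis
      using summable_on_iff_abs_summable_on_complex has_sum_imp_summable by blast
  qed
  have B: "B summable_on ?I"
  proof -
    have "(\<lambda>x. (\<lambda>(n, r). cmod (c n r) * exp (- 2 * pi * (of_int n / 4))) x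
        + (\<lambda>(n, r). cmod (c n r) * exp (- 2 * pi * ((of_int n + of_int r) / 4))) x) summable_on ?I"
      using abs[of "\<i> / 4" 0] abs[of "\<i> / 4" "\<i> / 4"]
      by (intro summable_on_add) (simp_all add: split_beta norm_mult norm_e2pi add_divide_distrib)
    moreover have "B = (\<lambda>x. (\<lambda>(n, r). cmod (c n r) * exp (- 2 * pi * (of_int n / 4))) x
        + (\<lambda>(n, r). cmod (c n r) * exp (- 2 * pi * ((of_int n + of_int r) / 4))) x)"
      by (auto simp: B_def)
    ultimately show ?thesis by simp
  qed
  have B0: "B x \<ge> 0" for x by (simp add: B_def split_beta)
  define C where "C = exp (2 * pi * \<kappa> * (1/4)) * infsum B ?I"
  have "cmod (jacobi_lift m \<phi> p q \<tau>) \<le> C * exp (- 2 * pi * \<kappa> * Im \<tau>)"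
    if v: "Im \<tau> \<ge> 1/4" and p: "0 \<le> p" "p \<le> 1" for \<tau> p q
  proof -
    let ?z = "of_real p * \<tau> + of_real q"
    define T where "T = (\<lambda>x. e2pi (of_real (m * p\<^sup>2) * \<tau>) * (\<lambda>(n, r). c n r * e2pi (of_int n * \<tau> + of_int r * ?z)) x)"
    define E where "E = exp (- 2 * pi * \<kappa> * (Im \<tau> - 1/4))"
    have sum: "(T has_sum jacobi_lift m \<phi> p q \<tau>) ?I"
      unfolding T_def jacobi_lift_def using exp v
      by (intro has_sum_cmult_right) (auto simp: jacobi_expansion_def upper_half_plane_def)
    have le: "cmod (T x) \<le> E * B x" if "x \<in> ?I" for x
    proof -
      obtain n r where x: "x = (n, r)" by force
      then have nr: "r\<^sup>2 \<le> 4 * int m * n" using that by simp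
      define X where "X = of_int n + of_int r * p + m * p\<^sup>2"
      have Tx: "cmod (T x) = cmod (c n r) * exp (- 2 * pi * (X * Im \<tau>))"
        unfolding T_def x prod.case norm_mult norm_e2pi X_def
        by (simp add: exp_add[symmetric] algebra_simps)
      show ?thesis
      proof (cases "c n r = 0")
        case False
        have "X = (of_int n - (of_int r)\<^sup>2 / (4 * m)) + m * (p + of_int r / (2 * m))\<^sup>2"
          using m by (simp add: X_def power2_eq_square field_simps)
        also have "\<dots> \<ge> \<kappa> + 0" using gap[OF nr False] m by (intro add_mono) auto
        finally have X: "X \<ge> \<kappa>" by simp
        have "X * Im \<tau> = X * (1/4) + X * (Im \<tau> - 1/4)" by (simp add: algebra_simps)
        also have "\<dots> \<ge> X * (1/4) + \<kappa> * (Im \<tau> - 1/4)"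
          using X v by (intro add_left_mono mult_right_mono) auto
        finally have "2 * pi * (X * (1/4) + \<kappa> * (Im \<tau> - 1/4)) \<le> 2 * pi * (X * Im \<tau>)"
          by (intro mult_left_mono) auto
        then have "exp (- 2 * pi * (X * Im \<tau>)) \<le> exp (- (2 * pi * (X * (1/4) + \<kappa> * (Im \<tau> - 1/4))))"
          by simp
        also have "\<dots> = E * exp (- 2 * pi * (X / 4))"
          unfolding E_def exp_add[symmetric] by (simp add: algebra_simps)
        also have "exp (- 2 * pi * (X / 4)) \<le> exp (- 2 * pi * (of_int n / 4)) + exp (- 2 * pi * ((of_int n + of_int r) / 4))"
        proof (cases "r \<ge> 0")
          case True
          then have "of_int n \<le> X" using p by (simp add: X_def)
          then have "exp (- 2 * pi * (X / 4)) \<le> exp (- 2 * pi * (of_int n / 4))" by simp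
          then show ?thesis by (simp add: add_increasing2)
        next
          case False
          then have "of_int r * 1 \<le> of_int r * p" using p by (intro mult_left_mono_neg) auto
          then have "of_int n + of_int r \<le> X" using p by (simp add: X_def add_increasing2)
          then have "exp (- 2 * pi * (X / 4)) \<le> exp (- 2 * pi * ((of_int n + of_int r) / 4))" by simp
          then show ?thesis by (simp add: add_increasing)
        qed
        finally have "exp (- 2 * pi * (X * Im \<tau>)) \<le> E * (exp (- 2 * pi * (of_int n / 4)) + exp (- 2 * pi * ((of_int n + of_int r) / 4)))"
          by (simp add: E_def)
        then have "cmod (c n r) * exp (- 2 * pi * (X * Im \<tau>)) \<le>
            cmod (c n r) * (E * (exp (- 2 * pi * (of_int n / 4)) + exp (- 2 * pi * ((of_int n + of_int r) / 4))))"
          by (intro mult_left_mono) auto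
        then show ?thesis unfolding Tx by (simp add: B_def x algebra_simps)
      qed (use Tx B0[of x] in \<open>simp add: E_def\<close>)
    qed
    have "(\<lambda>x. cmod (T x)) summable_on ?I"
      using sum summable_on_iff_abs_summable_on_complex has_sum_imp_summable by blast
    then have "cmod (jacobi_lift m \<phi> p q \<tau>) \<le> infsum (\<lambda>x. cmod (T x)) ?I"
      using norm_has_sum_bound[OF has_sum_infsum sum] by blast
    also have "\<dots> \<le> infsum (\<lambda>x. E * B x) ?I"
      using \<open>(\<lambda>x. cmod (T x)) summable_on ?I\<close> summable_on_cmult_right[OF B] le by (rule infsum_mono)
    also have "\<dots> = E * infsum B ?I" by (rule infsum_cmult_right')
    also have "\<dots> = C * exp (- 2 * pi * \<kappa> * Im \<tau>)"
      unfolding C_def E_def by (simp add: exp_add[symmetric] algebra_simps exp_diff exp_minus field_simps)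
    finally show ?thesis .
  qed
  moreover have "C \<ge> 0" unfolding C_def by (intro mult_nonneg_nonneg infsum_nonneg) (auto simp: B0)
  ultimately show ?thesis by blast
qed

section \<open>The invariant form attached to two functions\<close>

text \<open>
  Differentiation under the integral sign in terms of the two Wirtinger derivatives, which are
  combined into a bounded linear operator.
\<close>
lemma leibniz_rule_wirtinger:
  fixes w :: "complex \<Rightarrow> 'b::euclidean_space \<Rightarrow> complex"
  assumes der: "\<And>\<tau> t. \<tau> \<in> S \<Longrightarrow> t \<in> cbox a b \<Longrightarrow>
      ((\<lambda>\<tau>. w \<tau> t) has_derivative (\<lambda>h. D \<tau> t * h + D' \<tau> t * cnj h)) (at \<tau>)"
    and w: "\<And>\<tau>. \<tau> \<in> S \<Longrightarrow> continuous_on (cbox a b) (w \<tau>)"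
    and D: "continuous_on (S \<times> cbox a b) (\<lambda>(\<tau>, t). D \<tau> t)"
    and D': "continuous_on (S \<times> cbox a b) (\<lambda>(\<tau>, t). D' \<tau> t)"
    and S: "open S" "convex S" "\<tau> \<in> S"
  shows "((\<lambda>\<tau>. integral (cbox a b) (w \<tau>)) has_derivative
    (\<lambda>h. integral (cbox a b) (D \<tau>) * h + integral (cbox a b) (D' \<tau>) * cnj h)) (at \<tau>)"
proof -
  define L where "L = (\<lambda>\<tau> t. blinfun_mult_right (D \<tau> t) + (blinfun_mult_right (D' \<tau> t) o\<^sub>L Blinfun cnj))"
  have L: "blinfun_apply (L \<tau> t) = (\<lambda>h. D \<tau> t * h + D' \<tau> t * cnj h)" for \<tau> t
    by (simp add: L_def fun_eq_iff blinfun.add_left bounded_linear_Blinfun_apply[OF bounded_linear_cnj])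
  have Lcont: "continuous_on (S \<times> cbox a b) (\<lambda>(\<tau>, t). L \<tau> t)"
  proof (rule continuous_on_blinfun_componentwise)
    show "continuous_on (S \<times> cbox a b) (\<lambda>x. blinfun_apply (case x of (\<tau>, t) \<Rightarrow> L \<tau> t) i)" for i
      using D D' by (auto simp: L split_beta intro!: continuous_intros)
  qed
  have slice: "continuous_on (cbox a b) (G \<tau>)"
    if "continuous_on (S \<times> cbox a b) (\<lambda>(\<tau>, t). G \<tau> t)" for G :: "complex \<Rightarrow> 'b \<Rightarrow> 'z::topological_space"
  proof -
    have "continuous_on (cbox a b) (\<lambda>t. (\<lambda>(\<tau>, t). G \<tau> t) (\<tau>, t))"
      by (rule continuous_on_compose2[OF that]) (use S(3) in \<open>auto intro!: continuous_intros\<close>)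
    then show ?thesis by simp
  qed
  have "((\<lambda>\<tau>. integral (cbox a b) (w \<tau>)) has_derivative integral (cbox a b) (L \<tau>)) (at \<tau> within S)"
  proof (rule leibniz_rule[OF _ _ Lcont S(3,2)])
    show "((\<lambda>\<tau>. w \<tau> t) has_derivative blinfun_apply (L \<tau> t)) (at \<tau> within S)" if "\<tau> \<in> S" "t \<in> cbox a b" for \<tau> t
      unfolding L using der[OF that] by (rule has_derivative_at_withinI)
  qed (use w in \<open>auto intro: integrable_continuous\<close>)
  moreover have "blinfun_apply (integral (cbox a b) (L \<tau>)) h =
      integral (cbox a b) (D \<tau>) * h + integral (cbox a b) (D' \<tau>) * cnj h" for h
  proof -
    have "blinfun_apply (integral (cbox a b) (L \<tau>)) h = integral (cbox a b) (\<lambda>t. D \<tau> t * h + D' \<tau> t * cnj h)"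
      using blinfun_apply_integral[OF integrable_continuous[OF slice[OF Lcont]]] by (simp add: L)
    also have "\<dots> = integral (cbox a b) (\<lambda>t. D \<tau> t * h) + integral (cbox a b) (\<lambda>t. D' \<tau> t * cnj h)"
      by (intro Henstock_Kurzweil_Integration.integral_add integrable_continuous continuous_intros slice D D')
    finally show ?thesis by simp
  qed
  then have "blinfun_apply (integral (cbox a b) (L \<tau>)) =
      (\<lambda>h. integral (cbox a b) (D \<tau>) * h + integral (cbox a b) (D' \<tau>) * cnj h)"
    by (rule ext)
  ultimately show ?thesis using at_within_open[OF S(3,1)] by simp
qed

text \<open>
  The derivative of \<open>f (cnj g) v\<^sup>k\<close> with respect to \<open>cnj \<tau>\<close>, to be read as the coefficient of the
  form \<open>w d(cnj \<tau>)\<close>.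
\<close>
definition pairing_form :: "nat \<Rightarrow> (complex \<Rightarrow> complex) \<Rightarrow> (complex \<Rightarrow> complex) \<Rightarrow> complex \<Rightarrow> complex" where
  "pairing_form k f g \<tau> = f \<tau> * cnj (maass_raise k g \<tau>) * of_real (Im \<tau> ^ k / Im \<tau>)"

text \<open>
  The hyperbolic Laplacian \<open>4 v\<^sup>2 d_tau d_tau_bar\<close> of \<open>f (cnj g) v\<^sup>k\<close>, in terms of raised functions.
\<close>
definition pairing_density :: "nat \<Rightarrow> (complex \<Rightarrow> complex) \<Rightarrow> (complex \<Rightarrow> complex) \<Rightarrow> complex \<Rightarrow> complex" where
  "pairing_density k f g \<tau> =
     (4 * maass_raise k f \<tau> * cnj (maass_raise k g \<tau>) - of_nat k * f \<tau> * cnj (g \<tau>)) * of_real (Im \<tau> ^ k)"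

text \<open>
  The derivative of the form's coefficient with respect to \<open>cnj \<tau>\<close>.
\<close>
definition pairing_form_bar :: "nat \<Rightarrow> (complex \<Rightarrow> complex) \<Rightarrow> (complex \<Rightarrow> complex) \<Rightarrow> complex \<Rightarrow> complex" where
  "pairing_form_bar k f g \<tau> = f \<tau> * of_real (Im \<tau> ^ k) *
     (cnj (deriv (deriv g) \<tau>) + \<i> * of_nat k * cnj (deriv g \<tau>) / of_real (Im \<tau>)
       - of_nat k * (of_nat k - 1) / 4 * cnj (g \<tau>) / of_real ((Im \<tau>)\<^sup>2))"

text \<open>
  Multiplied out, the form is \<open>f (cnj g' v\<^sup>k + \<i> k/2 (cnj g) v\<^sup>k / v)\<close>, to which the product
  rule applies. The coefficient of \<open>h\<close> is the one that matters; the other one only has to be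
  continuous.
\<close>
lemma pairing_form_derivative:
  assumes f: "f holomorphic_on upper_half_plane" and g: "g holomorphic_on upper_half_plane"
    and \<tau>: "\<tau> \<in> upper_half_plane"
  shows "(pairing_form k f g has_derivative
    (\<lambda>h. pairing_density k f g \<tau> / of_real (4 * (Im \<tau>)\<^sup>2) * h + pairing_form_bar k f g \<tau> * cnj h)) (at \<tau>)"
proof -
  define v where "v = Im \<tau>"
  have v: "v > 0" using \<tau> by (simp add: upper_half_plane_def v_def)
  note H = upper_half_plane_open
  let ?f = "deriv f \<tau>" and ?g = "deriv g \<tau>" and ?g2 = "deriv (deriv g) \<tau>"
  have f': "(f has_derivative (\<lambda>h. ?f * h)) (at \<tau>)"
    using holomorphic_derivI[OF f H \<tau>] by (simp add: has_field_derivative_def)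
  have g': "((\<lambda>\<tau>. cnj (g \<tau>)) has_derivative (\<lambda>h. cnj (?g * h))) (at \<tau>)"
    using holomorphic_derivI[OF g H \<tau>] by (intro has_derivative_cnj) (simp add: has_field_derivative_def)
  have g'': "((\<lambda>\<tau>. cnj (deriv g \<tau>)) has_derivative (\<lambda>h. cnj (?g2 * h))) (at \<tau>)"
    using holomorphic_derivI[OF holomorphic_deriv[OF g H] H \<tau>]
    by (intro has_derivative_cnj) (simp add: has_field_derivative_def)
  have pw: "real k * x * v ^ (k - Suc 0) = x * (real k * v ^ k) / v" for x
    using v by (cases k) auto
  have pw': "v * v ^ (k - Suc 0) = v ^ k \<or> k = 0"
    by (cases k) auto
  have r0: "((\<lambda>\<tau>. complex_of_real (Im \<tau> ^ k)) has_derivative (\<lambda>h. of_real (Im h * (k * v ^ k / v)))) (at \<tau>)"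
    by (rule has_derivative_of_real, rule has_derivative_eq_rhs)
      (auto intro!: derivative_eq_intros simp: v_def[symmetric] fun_eq_iff pw)
  have r1: "((\<lambda>\<tau>. complex_of_real (Im \<tau> ^ k / Im \<tau>)) has_derivative
      (\<lambda>h. of_real (Im h * ((real k - 1) * v ^ k / v\<^sup>2)))) (at \<tau>)"
    by (rule has_derivative_of_real, rule has_derivative_eq_rhs)
      (use v pw' in \<open>auto intro!: derivative_eq_intros simp: v_def[symmetric] fun_eq_iff field_simps power2_eq_square\<close>)
  have "((\<lambda>\<tau>. f \<tau> * (cnj (deriv g \<tau>) * of_real (Im \<tau> ^ k)
      + \<i> * of_nat k / 2 * (cnj (g \<tau>) * of_real (Im \<tau> ^ k / Im \<tau>)))) has_derivative
    (\<lambda>h. pairing_density k f g \<tau> / of_real (4 * (Im \<tau>)\<^sup>2) * h + pairing_form_bar k f g \<tau> * cnj h)) (at \<tau>)"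
  proof (rule has_derivative_eq_rhs)
    show "((\<lambda>\<tau>. f \<tau> * (cnj (deriv g \<tau>) * of_real (Im \<tau> ^ k)
      + \<i> * of_nat k / 2 * (cnj (g \<tau>) * of_real (Im \<tau> ^ k / Im \<tau>)))) has_derivative
      (\<lambda>h. f \<tau> * ((cnj (deriv g \<tau>) * of_real (Im h * (k * v ^ k / v)) + cnj (?g2 * h) * of_real (Im \<tau> ^ k))
          + \<i> * of_nat k / 2 * (cnj (g \<tau>) * of_real (Im h * ((real k - 1) * v ^ k / v\<^sup>2)) + cnj (?g * h) * of_real (Im \<tau> ^ k / Im \<tau>)))
        + ?f * h * (cnj (deriv g \<tau>) * of_real (Im \<tau> ^ k)
      + \<i> * of_nat k / 2 * (cnj (g \<tau>) * of_real (Im \<tau> ^ k / Im \<tau>))))) (at \<tau>)"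
      by (intro has_derivative_mult has_derivative_add has_derivative_mult_right f' g' g'' r0 r1)
    have im: "complex_of_real (Im h) = - \<i> / 2 * (h - cnj h)" for h
      by (simp add: complex_eq_iff)
    define V P where "V = complex_of_real v" and "P = complex_of_real (v ^ k)"
    have V: "V \<noteq> 0" using v by (simp add: V_def)
    have conv: "complex_of_real (Im h * (k * v ^ k / v)) = - \<i> / 2 * (h - cnj h) * (of_nat k * P / V)"
      "complex_of_real (Im h * ((real k - 1) * v ^ k / v\<^sup>2)) = - \<i> / 2 * (h - cnj h) * ((of_nat k - 1) * P / V\<^sup>2)"
      "complex_of_real (Im \<tau> ^ k) = P" "complex_of_real (Im \<tau> ^ k / Im \<tau>) = P / V"
      "complex_of_real (Im \<tau>) = V" "complex_of_real (4 * (Im \<tau>)\<^sup>2) = 4 * V\<^sup>2" "complex_of_real ((Im \<tau>)\<^sup>2) = V\<^sup>2" for h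
      unfolding of_real_mult[of "Im h"] im[of h] by (simp_all add: P_def V_def v_def)
    define a b c d e F G where "a = f \<tau>" and "b = ?f" and "c = cnj (g \<tau>)" and "d = cnj ?g" and "e = cnj ?g2"
      and "F = maass_raise k f \<tau>" and "G = cnj (maass_raise k g \<tau>)"
    have F: "F = V * b - \<i> * of_nat k / 2 * a" and G: "G = V * d + \<i> * of_nat k / 2 * c"
      by (simp_all add: F_def G_def maass_raise_def a_def b_def c_def d_def V_def v_def)
    have "a * ((d * (- \<i> / 2 * (h - l) * (of_nat k * P / V)) + e * l * P)
          + \<i> * of_nat k / 2 * (c * (- \<i> / 2 * (h - l) * ((of_nat k - 1) * P / V\<^sup>2)) + d * l * (P / V)))
        + b * h * (d * P + \<i> * of_nat k / 2 * (c * (P / V)))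
      = (4 * F * G - of_nat k * a * c) * P / (4 * V\<^sup>2) * h
        + a * P * (e + \<i> * of_nat k * d / V - of_nat k * (of_nat k - 1) / 4 * c / V\<^sup>2) * l" for h l
      unfolding F G using V by (simp add: field_simps power2_eq_square)
    then show "(\<lambda>h. f \<tau> * ((cnj (deriv g \<tau>) * of_real (Im h * (k * v ^ k / v)) + cnj (?g2 * h) * of_real (Im \<tau> ^ k))
          + \<i> * of_nat k / 2 * (cnj (g \<tau>) * of_real (Im h * ((real k - 1) * v ^ k / v\<^sup>2)) + cnj (?g * h) * of_real (Im \<tau> ^ k / Im \<tau>)))
        + ?f * h * (cnj (deriv g \<tau>) * of_real (Im \<tau> ^ k)
      + \<i> * of_nat k / 2 * (cnj (g \<tau>) * of_real (Im \<tau> ^ k / Im \<tau>)))) =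
      (\<lambda>h. pairing_density k f g \<tau> / of_real (4 * (Im \<tau>)\<^sup>2) * h + pairing_form_bar k f g \<tau> * cnj h)"
      unfolding pairing_density_def pairing_form_bar_def conv complex_cnj_mult
      by (simp only: a_def b_def c_def d_def e_def F_def G_def)
  qed
  then show ?thesis
  proof (rule has_derivative_transform_within_open[OF _ H \<tau>])
    fix \<tau> assume "\<tau> \<in> upper_half_plane"
    then have "complex_of_real (Im \<tau>) \<noteq> 0" by (auto simp: upper_half_plane_def)
    then show "f \<tau> * (cnj (deriv g \<tau>) * of_real (Im \<tau> ^ k)
      + \<i> * of_nat k / 2 * (cnj (g \<tau>) * of_real (Im \<tau> ^ k / Im \<tau>))) = pairing_form k f g \<tau>"
      by (simp add: pairing_form_def maass_raise_def field_simps)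
  qed
qed

lemma pairing_form_translate:
  assumes f: "f1 holomorphic_on upper_half_plane" "f2 holomorphic_on upper_half_plane"
    and g: "g1 holomorphic_on upper_half_plane" "g2 holomorphic_on upper_half_plane"
    and f_eq: "\<And>\<tau>. \<tau> \<in> upper_half_plane \<Longrightarrow> f1 (\<tau> + of_real a) = \<epsilon> * f2 \<tau>"
    and g_eq: "\<And>\<tau>. \<tau> \<in> upper_half_plane \<Longrightarrow> g1 (\<tau> + of_real a) = \<epsilon> * g2 \<tau>"
    and \<epsilon>: "\<epsilon> * cnj \<epsilon> = 1" and \<tau>: "\<tau> \<in> upper_half_plane"
  shows "pairing_form k f1 g1 (\<tau> + of_real a) = pairing_form k f2 g2 \<tau>"
    and "pairing_density k f1 g1 (\<tau> + of_real a) = pairing_density k f2 g2 \<tau>"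
proof -
  have E: "\<epsilon> * x * cnj (\<epsilon> * y) = x * cnj y" for x y
  proof -
    have "\<epsilon> * x * cnj (\<epsilon> * y) = \<epsilon> * cnj \<epsilon> * (x * cnj y)" by (simp add: mult_ac)
    then show ?thesis using \<epsilon> by simp
  qed
  have "maass_raise k f1 (\<tau> + of_real a) = \<epsilon> * maass_raise k f2 \<tau>"
    by (rule maass_raise_translate[OF f _ \<tau>]) (rule f_eq)
  moreover have "maass_raise k g1 (\<tau> + of_real a) = \<epsilon> * maass_raise k g2 \<tau>"
    by (rule maass_raise_translate[OF g _ \<tau>]) (rule g_eq)
  moreover note f_eq[OF \<tau>] g_eq[OF \<tau>]
  ultimately have eqs: "f1 (\<tau> + of_real a) = \<epsilon> * f2 \<tau>" "g1 (\<tau> + of_real a) = \<epsilon> * g2 \<tau>"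
    "maass_raise k f1 (\<tau> + of_real a) = \<epsilon> * maass_raise k f2 \<tau>" "maass_raise k g1 (\<tau> + of_real a) = \<epsilon> * maass_raise k g2 \<tau>"
    by blast+
  show "pairing_form k f1 g1 (\<tau> + of_real a) = pairing_form k f2 g2 \<tau>"
    unfolding pairing_form_def eqs E by simp
  have E': "c * (\<epsilon> * x) * cnj (\<epsilon> * y) = c * x * cnj y" for c x y
    by (simp only: mult.assoc[of c] E)
  show "pairing_density k f1 g1 (\<tau> + of_real a) = pairing_density k f2 g2 \<tau>"
    unfolding pairing_density_def eqs E' by simp
qed

text \<open>
  The weights \<open>k\<close> of \<open>f\<close> and \<open>k + 2\<close> of the raised function, the latter conjugated, combine with the
  factor of \<open>v\<^sup>k\<close> to the weight \<open>(0, 2)\<close> of a coefficient of \<open>d(cnj \<tau>)\<close>. The unimodular factor \<open>\<epsilon>\<close> is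
  common to \<open>f\<close> and \<open>g\<close> and cancels.
\<close>
lemma pairing_form_invert:
  assumes f: "f1 holomorphic_on upper_half_plane" "f2 holomorphic_on upper_half_plane"
    and g: "g1 holomorphic_on upper_half_plane" "g2 holomorphic_on upper_half_plane"
    and f_eq: "\<And>\<tau>. \<tau> \<in> upper_half_plane \<Longrightarrow> f1 (- 1 / \<tau>) = \<epsilon> * \<tau> ^ k * f2 \<tau>"
    and g_eq: "\<And>\<tau>. \<tau> \<in> upper_half_plane \<Longrightarrow> g1 (- 1 / \<tau>) = \<epsilon> * \<tau> ^ k * g2 \<tau>"
    and \<epsilon>: "\<epsilon> * cnj \<epsilon> = 1" and \<tau>: "\<tau> \<in> upper_half_plane"
  shows "pairing_form k f1 g1 (- 1 / \<tau>) = (cnj \<tau>)\<^sup>2 * pairing_form k f2 g2 \<tau>"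
proof -
  have \<tau>0: "\<tau> \<noteq> 0" "cnj \<tau> \<noteq> 0" and v: "complex_of_real (Im \<tau>) \<noteq> 0" using \<tau> by (auto simp: upper_half_plane_def)
  have im: "complex_of_real (Im (- 1 / \<tau>)) = of_real (Im \<tau>) / (\<tau> * cnj \<tau>)"
    unfolding Im_invert complex_norm_square[symmetric] by simp
  have P: "complex_of_real (Im (- 1 / \<tau>) ^ k / Im (- 1 / \<tau>)) =
      of_real (Im \<tau> ^ k / Im \<tau>) * (\<tau> * cnj \<tau>) / (\<tau> ^ k * cnj \<tau> ^ k)"
    unfolding of_real_divide of_real_power im using \<tau>0 v
    by (simp add: power_divide power_mult_distrib field_simps)
  have r: "maass_raise k g1 (- 1 / \<tau>) = \<epsilon> * \<tau> ^ k * (\<tau> / cnj \<tau>) * maass_raise k g2 \<tau>"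
    by (rule maass_raise_invert[OF g _ \<tau>]) (rule g_eq)
  have "pairing_form k f1 g1 (- 1 / \<tau>) = (\<epsilon> * cnj \<epsilon>) * (cnj \<tau>)\<^sup>2 * pairing_form k f2 g2 \<tau>"
    unfolding pairing_form_def P f_eq[OF \<tau>] r using \<tau>0
    by (simp add: field_simps power2_eq_square)
  then show ?thesis using \<epsilon> by simp
qed

text \<open>
  For a cusp form \<open>4 m n - r\<^sup>2\<close> is a positive integer in every term that occurs, which gives the
  rate \<open>\<kappa> = 1 / (4 m)\<close> in \<open>jacobi_lift_bound\<close>. The derivative is estimated by the inequality of
  Cauchy on a disc of radius \<open>1/4\<close>, which moves the height bound from \<open>1/4\<close> to \<open>1/2\<close>; this still
  covers the modular domain.
\<close>
lemma jacobi_lift_decay: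
  assumes \<phi>: "\<phi> \<in> jacobi_forms k m" and m: "m \<ge> 1"
  shows "\<exists>\<kappa> C. \<kappa> \<ge> 0 \<and> C \<ge> 0 \<and> (\<phi> \<in> jacobi_cusp_forms k m \<longrightarrow> \<kappa> > 0) \<and>
    (\<forall>\<tau> p q. Im \<tau> \<ge> 1/2 \<longrightarrow> 0 \<le> p \<longrightarrow> p \<le> 1 \<longrightarrow>
      cmod (jacobi_lift m \<phi> p q \<tau>) \<le> C * exp (- \<kappa> * Im \<tau>) \<and>
      cmod (maass_raise k (jacobi_lift m \<phi> p q) \<tau>) \<le> C * Im \<tau> * exp (- \<kappa> * Im \<tau>))"
proof -
  have "\<exists>\<kappa> c. \<kappa> \<ge> 0 \<and> (\<phi> \<in> jacobi_cusp_forms k m \<longrightarrow> \<kappa> > 0) \<and> jacobi_expansion m \<phi> c \<and>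
      (\<forall>n r. r\<^sup>2 \<le> 4 * int m * n \<longrightarrow> c n r \<noteq> 0 \<longrightarrow> \<kappa> \<le> of_int n - (of_int r)\<^sup>2 / (4 * real m))"
  proof (cases "\<phi> \<in> jacobi_cusp_forms k m")
    case True
    then obtain c where c: "jacobi_expansion m \<phi> c" "\<forall>n r. 4 * int m * n = r\<^sup>2 \<longrightarrow> c n r = 0"
      unfolding jacobi_cusp_forms_def by blast
    have "1 / (4 * real m) \<le> of_int n - (of_int r)\<^sup>2 / (4 * real m)"
      if "r\<^sup>2 \<le> 4 * int m * n" "c n r \<noteq> 0" for n r
    proof -
      have "r\<^sup>2 + 1 \<le> 4 * int m * n" using that c(2) by (smt (verit))
      then have "real_of_int (r\<^sup>2 + 1) \<le> real_of_int (4 * int m * n)" by (simp only: of_int_le_iff)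
      then show ?thesis using m by (simp add: field_simps)
    qed
    then show ?thesis using c(1) m by (intro exI[of _ "1 / (4 * real m)"] exI[of _ c]) auto
  next
    case False
    obtain c where c: "jacobi_expansion m \<phi> c" using \<phi> unfolding jacobi_forms_def by blast
    have "0 \<le> of_int n - (of_int r)\<^sup>2 / (4 * real m)" if "r\<^sup>2 \<le> 4 * int m * n" for n r
    proof -
      have "real_of_int (r\<^sup>2) \<le> real_of_int (4 * int m * n)" using that by (simp only: of_int_le_iff)
      then show ?thesis using m by (simp add: field_simps)
    qed
    then show ?thesis using c False by (intro exI[of _ 0] exI[of _ c]) auto
  qed
  then obtain \<kappa> c where \<kappa>: "\<kappa> \<ge> 0" "\<phi> \<in> jacobi_cusp_forms k m \<longrightarrow> \<kappa> > 0" and c: "jacobi_expansion m \<phi> c"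
    and gap: "\<And>n r. r\<^sup>2 \<le> 4 * int m * n \<Longrightarrow> c n r \<noteq> 0 \<Longrightarrow> \<kappa> \<le> of_int n - (of_int r)\<^sup>2 / (4 * real m)"
    by blast
  obtain C where C: "C \<ge> 0" and bound: "\<And>\<tau> p q. Im \<tau> \<ge> 1/4 \<Longrightarrow> 0 \<le> p \<Longrightarrow> p \<le> 1 \<Longrightarrow>
      cmod (jacobi_lift m \<phi> p q \<tau>) \<le> C * exp (- 2 * pi * \<kappa> * Im \<tau>)"
    using jacobi_lift_bound[OF c m \<kappa>(1) gap] by blast
  define \<kappa>' where "\<kappa>' = 2 * pi * \<kappa>"
  have \<kappa>': "\<kappa>' \<ge> 0" using \<kappa> by (simp add: \<kappa>'_def)
  define A where "A = exp (\<kappa>' / 4)"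
  have A: "A \<ge> 1" using \<kappa>' by (simp add: A_def)
  define C' where "C' = (4 * A + k) * C"
  have C': "C' \<ge> C" "C' \<ge> 0" using A C mult_right_mono[of 1 "4 * A + k" C] by (simp_all add: C'_def)
  have "cmod (jacobi_lift m \<phi> p q \<tau>) \<le> C' * exp (- \<kappa>' * Im \<tau>) \<and>
      cmod (maass_raise k (jacobi_lift m \<phi> p q) \<tau>) \<le> C' * Im \<tau> * exp (- \<kappa>' * Im \<tau>)"
    if v: "Im \<tau> \<ge> 1/2" and p: "0 \<le> p" "p \<le> 1" for \<tau> p q
  proof -
    let ?f = "jacobi_lift m \<phi> p q" and ?E = "exp (- \<kappa>' * Im \<tau>)"
    have f: "cmod (?f \<tau>) \<le> C * ?E" using bound[of \<tau> p q] v p by (simp add: \<kappa>'_def mult_ac)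
    have near: "Im \<tau> - 1/4 \<le> Im x" if "x \<in> cball \<tau> (1/4)" for x
      using that abs_Im_le_cmod[of "\<tau> - x"] by (auto simp: dist_norm)
    have sub: "cball \<tau> (1/4) \<subseteq> upper_half_plane" using near v by (force simp: upper_half_plane_def)
    have hol: "?f holomorphic_on cball \<tau> (1/4)"
      using jacobi_lift_holomorphic(1)[OF \<phi>] sub by (rule holomorphic_on_subset)
    have "cmod ((deriv ^^ 1) ?f \<tau>) \<le> fact 1 * (C * A * ?E) / (1/4) ^ 1"
    proof (rule Cauchy_inequality)
      show "?f holomorphic_on ball \<tau> (1/4)" using hol ball_subset_cball by (rule holomorphic_on_subset)
      show "continuous_on (cball \<tau> (1/4)) ?f" using hol by (rule holomorphic_on_imp_continuous_on)
      fix x assume "cmod (\<tau> - x) = 1/4"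
      then have x: "Im \<tau> - 1/4 \<le> Im x" by (intro near) (simp add: dist_norm)
      have "cmod (?f x) \<le> C * exp (- \<kappa>' * Im x)" using bound[of x p q] x v p by (simp add: \<kappa>'_def mult_ac)
      also have "\<dots> \<le> C * exp (\<kappa>' / 4 + (- \<kappa>' * Im \<tau>))"
        using C mult_left_mono[OF x \<kappa>'] by (intro mult_left_mono) (auto simp: algebra_simps)
      also have "\<dots> = C * A * ?E" by (simp only: exp_add A_def mult.assoc)
      finally show "cmod (?f x) \<le> C * A * ?E" .
    qed simp
    then have d: "cmod (deriv ?f \<tau>) \<le> 4 * A * C * ?E" by (simp add: mult_ac)
    have "cmod (maass_raise k ?f \<tau>) \<le> cmod (of_real (Im \<tau>) * deriv ?f \<tau>) + cmod (\<i> * of_nat k / 2 * ?f \<tau>)"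
      unfolding maass_raise_def by (rule norm_triangle_ineq4)
    also have "\<dots> = Im \<tau> * cmod (deriv ?f \<tau>) + (k / 2) * cmod (?f \<tau>)"
      using v by (simp add: norm_mult norm_divide)
    also have "\<dots> \<le> Im \<tau> * (4 * A * C * ?E) + (k * Im \<tau>) * (C * ?E)"
    proof (intro add_mono mult_mono)
      show "real k / 2 \<le> k * Im \<tau>" using mult_left_mono[OF v, of "real k"] by simp
    qed (use v d f C in auto)
    also have "\<dots> = C' * Im \<tau> * ?E" by (simp add: C'_def algebra_simps)
    finally have "cmod (maass_raise k ?f \<tau>) \<le> C' * Im \<tau> * ?E" .
    moreover have "cmod (?f \<tau>) \<le> C' * ?E" by (rule order_trans[OF f mult_right_mono[OF C'(1)]]) simp
    ultimately show ?thesis by blast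
  qed
  moreover have "\<phi> \<in> jacobi_cusp_forms k m \<longrightarrow> \<kappa>' > 0" using \<kappa> by (simp add: \<kappa>'_def)
  ultimately show ?thesis using \<kappa>' C' by blast
qed

section \<open>Extended and usual Petersson product\<close>

lemma e2pi_real_unimodular: "e2pi (of_real x) * cnj (e2pi (of_real x)) = 1"
  by (simp add: e2pi_mult_cnj)

lemma power_mult_exp_le:
  fixes \<kappa> x :: real
  assumes "\<kappa> > 0" "x \<ge> 0"
  shows "x ^ n * exp (- \<kappa> * x) \<le> fact n / \<kappa> ^ n"
proof -
  have "(\<kappa> * x) ^ n / fact n \<le> exp (\<kappa> * x)"
  proof -
    have "(\<kappa> * x) ^ n / fact n = (\<Sum>i\<in>{n}. (\<kappa> * x) ^ i /\<^sub>R fact i)" 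
      unfolding real_scaleR_def by (simp add: divide_inverse)
    also have "\<dots> \<le> (\<Sum>i. (\<kappa> * x) ^ i /\<^sub>R fact i)"
      by (rule sum_le_suminf) (use assms in \<open>auto intro!: summable_exp\<close>)
    finally show ?thesis by (simp add: exp_def)
  qed
  then have "(\<kappa> * x) ^ n / fact n * exp (- \<kappa> * x) \<le> exp (\<kappa> * x) * exp (- \<kappa> * x)"
    by (rule mult_right_mono) simp
  then have "(\<kappa> * x) ^ n / fact n * exp (- \<kappa> * x) \<le> 1" by (simp add: exp_minus)
  then show ?thesis using assms by (simp add: power_mult_distrib field_simps)
qed

locale jacobi_pair =
  fixes k m :: nat and \<phi> \<psi> :: "complex \<times> complex \<Rightarrow> complex"
  assumes \<phi>: "\<phi> \<in> jacobi_forms k m" and \<psi>: "\<psi> \<in> jacobi_forms k m" and m: "m \<ge> 1"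
    and cusp: "\<phi> \<in> jacobi_cusp_forms k m \<or> \<psi> \<in> jacobi_cusp_forms k m"
begin

abbreviation "f \<equiv> jacobi_lift m \<phi>"
abbreviation "g \<equiv> jacobi_lift m \<psi>"
abbreviation "F \<equiv> petersson_density k m \<phi> \<psi>"

text \<open>
  The second-order part of \<open>D_J\<close> applied to \<open>F\<close>, by \<open>D_J_petersson_density\<close>.
\<close>
definition laplace_density :: "complex \<times> complex \<Rightarrow> complex" where
  "laplace_density x = (4 * jacobi_raise k m \<phi> x * cnj (jacobi_raise k m \<psi> x) - of_nat k * \<phi> x * cnj (\<psi> x)) * jacobi_weight k m x"

lemmas hol = jacobi_lift_holomorphic(1)[OF \<phi>] jacobi_lift_holomorphic(1)[OF \<psi>]

lemma density_lift:
  assumes "\<tau> \<in> upper_half_plane"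
  shows "F (\<tau>, of_real p * \<tau> + of_real q) = f p q \<tau> * cnj (g p q \<tau>) * of_real (Im \<tau> ^ k)"
    and "laplace_density (\<tau>, of_real p * \<tau> + of_real q) = pairing_density k (f p q) (g p q) \<tau>"
proof -
  let ?x = "(\<tau>, of_real p * \<tau> + of_real q)" and ?e = "e2pi (of_real (m * p\<^sup>2) * \<tau>)"
  have v: "Im \<tau> \<noteq> 0" using assms by (simp add: upper_half_plane_def)
  have "jacobi_weight k m ?x = of_real (Im \<tau> ^ k) * of_real (exp (- 4 * pi * (m * p\<^sup>2 * Im \<tau>)))"
    using v by (simp add: jacobi_weight_def power2_eq_square algebra_simps)
  also have "complex_of_real (exp (- 4 * pi * (m * p\<^sup>2 * Im \<tau>))) = ?e * cnj ?e"
    by (simp add: e2pi_mult_cnj)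
  finally have w: "jacobi_weight k m ?x = of_real (Im \<tau> ^ k) * (?e * cnj ?e)" .
  show "F ?x = f p q \<tau> * cnj (g p q \<tau>) * of_real (Im \<tau> ^ k)"
    unfolding petersson_density_eq w by (simp add: jacobi_lift_def mult_ac)
  show "laplace_density ?x = pairing_density k (f p q) (g p q) \<tau>"
    unfolding laplace_density_def w pairing_density_def jacobi_lift_holomorphic(2)[OF \<phi> assms]
      jacobi_lift_holomorphic(2)[OF \<psi> assms]
    by (simp add: jacobi_lift_def algebra_simps)
qed

lemma lift_coordinates:
  assumes "\<tau> \<in> upper_half_plane"
  obtains p q where "z = of_real p * \<tau> + of_real q" "p = Im z / Im \<tau>"
proof -
  have "z = of_real (Im z / Im \<tau>) * \<tau> + of_real (Re z - Im z / Im \<tau> * Re \<tau>)"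
    using assms by (simp add: complex_eq_iff upper_half_plane_def)
  then show ?thesis using that by blast
qed

lemma pairing_periodic:
  assumes \<tau>: "\<tau> \<in> upper_half_plane"
  shows "pairing_form k (f p (q + 1)) (g p (q + 1)) \<tau> = pairing_form k (f p q) (g p q) \<tau>"
    and "pairing_density k (f p (q + 1)) (g p (q + 1)) \<tau> = pairing_density k (f p q) (g p q) \<tau>"
    and "pairing_form k (f (p + 1) q) (g (p + 1) q) \<tau> = pairing_form k (f p q) (g p q) \<tau>"
  using pairing_form_translate[OF hol(1) hol(1) hol(2) hol(2), of p "q + 1" 0 1 p q p "q + 1" p q \<tau> k]
    pairing_form_translate[OF hol(1) hol(1) hol(2) hol(2), of "p + 1" q 0 "e2pi (of_real (- 2 * real m * q))" p q "p + 1" q p q \<tau> k]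
    jacobi_lift_periodic_q[OF \<phi>] jacobi_lift_periodic_q[OF \<psi>]
    jacobi_lift_periodic_p[OF \<phi>] jacobi_lift_periodic_p[OF \<psi>] e2pi_real_unimodular[of "- 2 * real m * q"] \<tau>
  by auto

lemma density_continuous: "continuous_on (upper_half_plane \<times> UNIV) F" "continuous_on (upper_half_plane \<times> UNIV) laplace_density"
proof -
  note H = upper_half_plane_open open_UNIV
  have w: "continuous_on (upper_half_plane \<times> UNIV) (jacobi_weight k m)"
    unfolding jacobi_weight_def split_beta
    by (intro continuous_intros) (auto simp: upper_half_plane_def)
  have c: "continuous_on (upper_half_plane \<times> UNIV) \<theta>" "continuous_on (upper_half_plane \<times> UNIV) (jacobi_raise k m \<theta>)"
    if \<theta>: "\<theta> \<in> jacobi_forms k m" for \<theta>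
  proof -
    show c0: "continuous_on (upper_half_plane \<times> UNIV) \<theta>" by (rule jacobi_forms_cont[OF \<theta>])
    have c1: "continuous_on (upper_half_plane \<times> UNIV) (deriv1 \<theta>)"
      using holomorphic2_deriv1[OF holomorphic2_jacobi[OF \<theta>] H] holomorphic2_on_iff_separately[OF H] by blast
    have c2: "continuous_on (upper_half_plane \<times> UNIV) (deriv2 \<theta>)"
      using holomorphic2_deriv2[OF holomorphic2_jacobi[OF \<theta>] H] holomorphic2_on_iff_separately[OF H] by blast
    show "continuous_on (upper_half_plane \<times> UNIV) (jacobi_raise k m \<theta>)"
      unfolding jacobi_raise_def split_beta prod.collapse
      by (intro continuous_intros c0 c1 c2) (auto simp: upper_half_plane_def)
  qed
  show "continuous_on (upper_half_plane \<times> UNIV) F"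
    unfolding petersson_density_eq by (intro continuous_intros c w \<phi> \<psi>)
  show "continuous_on (upper_half_plane \<times> UNIV) laplace_density"
    unfolding laplace_density_def[abs_def] by (intro continuous_intros c w \<phi> \<psi>)
qed

lemma density_elliptic:
  assumes \<tau>: "\<tau> \<in> upper_half_plane"
  shows "laplace_density (\<tau>, z + 1) = laplace_density (\<tau>, z)"
proof -
  obtain p q where z: "z = of_real p * \<tau> + of_real q" using lift_coordinates[OF \<tau>] by metis
  then have z1: "z + 1 = of_real p * \<tau> + of_real (q + 1)" by simp
  show "laplace_density (\<tau>, z + 1) = laplace_density (\<tau>, z)"
    unfolding z1 unfolding z density_lift(2)[OF \<tau>] by (rule pairing_periodic(2)[OF \<tau>])
qed

text \<open>
  One of the two lifts is bounded and the other one decays exponentially, which beats every power of \<open>v\<close>. The extra factor \<open>1 / v\<close> in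
  the bound of the form makes the boundary term at the cusp vanish in the limit.
\<close>
lemma pairing_bounds:
  obtains M where "\<And>\<tau> p q. Im \<tau> \<ge> 1/2 \<Longrightarrow> 0 \<le> p \<Longrightarrow> p \<le> 1 \<Longrightarrow>
      cmod (f p q \<tau> * cnj (g p q \<tau>) * of_real (Im \<tau> ^ k)) \<le> M"
    "\<And>\<tau> p q. Im \<tau> \<ge> 1/2 \<Longrightarrow> 0 \<le> p \<Longrightarrow> p \<le> 1 \<Longrightarrow> cmod (pairing_density k (f p q) (g p q) \<tau>) \<le> M"
    "\<And>\<tau> p q. Im \<tau> \<ge> 1/2 \<Longrightarrow> 0 \<le> p \<Longrightarrow> p \<le> 1 \<Longrightarrow> cmod (pairing_form k (f p q) (g p q) \<tau>) \<le> M / Im \<tau>"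
proof -
  obtain \<kappa>1 C1 where 1: "\<kappa>1 \<ge> 0" "C1 \<ge> 0" "\<phi> \<in> jacobi_cusp_forms k m \<longrightarrow> \<kappa>1 > 0"
    "\<And>\<tau> p q. Im \<tau> \<ge> 1/2 \<Longrightarrow> 0 \<le> p \<Longrightarrow> p \<le> 1 \<Longrightarrow> cmod (f p q \<tau>) \<le> C1 * exp (- \<kappa>1 * Im \<tau>)"
    "\<And>\<tau> p q. Im \<tau> \<ge> 1/2 \<Longrightarrow> 0 \<le> p \<Longrightarrow> p \<le> 1 \<Longrightarrow> cmod (maass_raise k (f p q) \<tau>) \<le> C1 * Im \<tau> * exp (- \<kappa>1 * Im \<tau>)"
    using jacobi_lift_decay[OF \<phi> m] by blast
  obtain \<kappa>2 C2 where 2: "\<kappa>2 \<ge> 0" "C2 \<ge> 0" "\<psi> \<in> jacobi_cusp_forms k m \<longrightarrow> \<kappa>2 > 0"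
    "\<And>\<tau> p q. Im \<tau> \<ge> 1/2 \<Longrightarrow> 0 \<le> p \<Longrightarrow> p \<le> 1 \<Longrightarrow> cmod (g p q \<tau>) \<le> C2 * exp (- \<kappa>2 * Im \<tau>)"
    "\<And>\<tau> p q. Im \<tau> \<ge> 1/2 \<Longrightarrow> 0 \<le> p \<Longrightarrow> p \<le> 1 \<Longrightarrow> cmod (maass_raise k (g p q) \<tau>) \<le> C2 * Im \<tau> * exp (- \<kappa>2 * Im \<tau>)"
    using jacobi_lift_decay[OF \<psi> m] by blast
  define \<kappa> C where "\<kappa> = \<kappa>1 + \<kappa>2" and "C = C1 * C2"
  have \<kappa>: "\<kappa> > 0" and C: "C \<ge> 0" using 1 2 cusp by (auto simp: \<kappa>_def C_def)
  define E where "E = (\<lambda>n. fact n / \<kappa> ^ n)"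
  have E: "x ^ n * exp (- \<kappa> * x) \<le> E n" if "x \<ge> 1/2" for x n
    unfolding E_def using \<kappa> that by (intro power_mult_exp_le) auto
  have E0: "E n \<ge> 0" for n using \<kappa> by (simp add: E_def)
  have split: "exp (- \<kappa>1 * x) * exp (- \<kappa>2 * x) = exp (- \<kappa> * x)" for x
    by (simp add: \<kappa>_def exp_add[symmetric] algebra_simps)
  define M where "M = C * E k + (4 * C * E (k + 2) + k * (C * E k)) + C * E (k + 1)"
  have M: "C * E k \<le> M" "4 * C * E (k + 2) + k * (C * E k) \<le> M" "C * E (k + 1) \<le> M"
    using C E0 by (auto simp: M_def intro!: add_nonneg_nonneg mult_nonneg_nonneg)
  show thesis
  proof (rule that)
    fix \<tau> p q assume v: "Im \<tau> \<ge> 1/2" and p: "0 \<le> p" "p \<le> (1::real)"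
    define v where "v = Im \<tau>"
    have v: "v \<ge> 1/2" using v by (simp add: v_def)
    have v0: "\<bar>v\<bar> = v" "v > 0" using v by auto
    note b = 1(4,5)[of \<tau> p q] 2(4,5)[of \<tau> p q]
    have "cmod (f p q \<tau>) * cmod (g p q \<tau>) \<le> (C1 * exp (- \<kappa>1 * v)) * (C2 * exp (- \<kappa>2 * v))"
      using b v p 1 2 by (intro mult_mono) (auto simp: v_def)
    also have "\<dots> = C * exp (- \<kappa> * v)" unfolding split[symmetric] C_def by (simp only: mult_ac)
    finally have fg: "cmod (f p q \<tau>) * cmod (g p q \<tau>) \<le> C * exp (- \<kappa> * v)" .
    have "cmod (f p q \<tau>) * cmod (maass_raise k (g p q) \<tau>) \<le> (C1 * exp (- \<kappa>1 * v)) * (C2 * v * exp (- \<kappa>2 * v))"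
      using b v p 1 2 by (intro mult_mono) (auto simp: v_def)
    also have "\<dots> = C * exp (- \<kappa> * v) * v" unfolding split[symmetric] C_def by (simp only: mult_ac)
    finally have fr: "cmod (f p q \<tau>) * cmod (maass_raise k (g p q) \<tau>) \<le> C * exp (- \<kappa> * v) * v" .
    have "cmod (maass_raise k (f p q) \<tau>) * cmod (maass_raise k (g p q) \<tau>) \<le> (C1 * v * exp (- \<kappa>1 * v)) * (C2 * v * exp (- \<kappa>2 * v))"
      using b v p 1 2 by (intro mult_mono) (auto simp: v_def)
    also have "\<dots> = C * exp (- \<kappa> * v) * v\<^sup>2" unfolding split[symmetric] C_def power2_eq_square by (simp only: mult_ac)
    finally have rr: "cmod (maass_raise k (f p q) \<tau>) * cmod (maass_raise k (g p q) \<tau>) \<le> C * exp (- \<kappa> * v) * v\<^sup>2" .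
    have Cv: "C * exp (- \<kappa> * v) * v ^ n \<le> C * E n" for n
      using mult_left_mono[OF E[OF v, of n] C] by (simp add: mult_ac)
    have fgk: "cmod (f p q \<tau>) * cmod (g p q \<tau>) * v ^ k \<le> C * E k"
      by (rule order_trans[OF mult_right_mono[OF fg] Cv[of k]]) (use v0 in simp)
    then show "cmod (f p q \<tau> * cnj (g p q \<tau>) * of_real (Im \<tau> ^ k)) \<le> M"
      using M(1) v0 by (simp add: norm_mult norm_power v_def[symmetric])
    have "cmod (maass_raise k (f p q) \<tau>) * cmod (maass_raise k (g p q) \<tau>) * v ^ k \<le> C * exp (- \<kappa> * v) * v ^ (k + 2)"
      using mult_right_mono[OF rr, of "v ^ k"] v0 by (simp add: power_add power2_eq_square mult_ac)
    then have rrk: "cmod (maass_raise k (f p q) \<tau>) * cmod (maass_raise k (g p q) \<tau>) * v ^ k \<le> C * E (k + 2)"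
      using Cv[of "k + 2"] by linarith
    have "cmod (pairing_density k (f p q) (g p q) \<tau>) \<le>
        (cmod (4 * maass_raise k (f p q) \<tau> * cnj (maass_raise k (g p q) \<tau>)) + cmod (of_nat k * f p q \<tau> * cnj (g p q \<tau>))) * v ^ k"
      unfolding pairing_density_def norm_mult[of "_ - _"] using v0
      by (intro mult_mono norm_triangle_ineq4) (auto simp: norm_power v_def)
    also have "\<dots> = 4 * (cmod (maass_raise k (f p q) \<tau>) * cmod (maass_raise k (g p q) \<tau>) * v ^ k)
        + k * (cmod (f p q \<tau>) * cmod (g p q \<tau>) * v ^ k)"
      by (simp add: norm_mult algebra_simps)
    also have "\<dots> \<le> 4 * (C * E (k + 2)) + k * (C * E k)"
      using rrk fgk by (intro add_mono mult_left_mono) auto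
    finally show "cmod (pairing_density k (f p q) (g p q) \<tau>) \<le> M" using M(2) by simp
    have "cmod (f p q \<tau>) * cmod (maass_raise k (g p q) \<tau>) * v ^ k \<le> C * exp (- \<kappa> * v) * v ^ (k + 1)"
      using mult_right_mono[OF fr, of "v ^ k"] v0 by (simp add: power_add mult_ac)
    then have "cmod (f p q \<tau>) * cmod (maass_raise k (g p q) \<tau>) * v ^ k \<le> M"
      using Cv[of "k + 1"] M(3) by linarith
    then have "cmod (f p q \<tau>) * cmod (maass_raise k (g p q) \<tau>) * v ^ k / v \<le> M / v"
      using v0 by (intro divide_right_mono) auto
    then show "cmod (pairing_form k (f p q) (g p q) \<tau>) \<le> M / Im \<tau>"
      using v0 by (simp add: pairing_form_def norm_mult norm_divide norm_power v_def[symmetric])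
  qed
qed

lemma density_integrable: "jacobi_integrable F" "jacobi_integrable laplace_density"
proof -
  obtain M where M: "\<And>\<tau> p q. Im \<tau> \<ge> 1/2 \<Longrightarrow> 0 \<le> p \<Longrightarrow> p \<le> 1 \<Longrightarrow>
      cmod (f p q \<tau> * cnj (g p q \<tau>) * of_real (Im \<tau> ^ k)) \<le> M"
    "\<And>\<tau> p q. Im \<tau> \<ge> 1/2 \<Longrightarrow> 0 \<le> p \<Longrightarrow> p \<le> 1 \<Longrightarrow> cmod (pairing_density k (f p q) (g p q) \<tau>) \<le> M"
    using pairing_bounds by metis
  have *: "cmod (F x) \<le> M" "cmod (laplace_density x) \<le> M" if "x \<in> jacobi_fund_domain" for x
  proof -
    obtain \<tau> z where x: "x = (\<tau>, z)" by force
    have d: "\<tau> \<in> modular_domain" "0 \<le> Im z" "Im z < Im \<tau>" using that by (auto simp: x jacobi_fund_domain_eq)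
    have v: "Im \<tau> \<ge> 1/2" by (rule modular_domain_Im[OF d(1)])
    then have \<tau>: "\<tau> \<in> upper_half_plane" by (simp add: upper_half_plane_def)
    obtain p q where z: "z = of_real p * \<tau> + of_real q" and pz: "p = Im z / Im \<tau>" using lift_coordinates[OF \<tau>] by metis
    have p: "0 \<le> p" "p \<le> 1" unfolding pz using d v by simp_all
    show "cmod (F x) \<le> M" "cmod (laplace_density x) \<le> M"
      unfolding x z density_lift[OF \<tau>] by (rule M[OF v p])+
  qed
  show "jacobi_integrable F" "jacobi_integrable laplace_density"
    using jacobi_integrableI[OF density_continuous(1) *(1)] jacobi_integrableI[OF density_continuous(2) *(2)] by blast+
qed

lemma pairing_continuous:
  shows "continuous_on (upper_half_plane \<times> UNIV) (\<lambda>(\<tau>, t). pairing_form k (f (fst t) (snd t)) (g (fst t) (snd t)) \<tau>)"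
    and "continuous_on (upper_half_plane \<times> UNIV) (\<lambda>(\<tau>, t). pairing_density k (f (fst t) (snd t)) (g (fst t) (snd t)) \<tau> / of_real (4 * (Im \<tau>)\<^sup>2))"
    and "continuous_on (upper_half_plane \<times> UNIV) (\<lambda>(\<tau>, t). pairing_form_bar k (f (fst t) (snd t)) (g (fst t) (snd t)) \<tau>)"
proof -
  let ?S = "upper_half_plane \<times> UNIV :: (complex \<times> real \<times> real) set"
  note H = upper_half_plane_open
  have c: "continuous_on ?S (\<lambda>x. jacobi_lift m \<theta> (fst (snd x)) (snd (snd x)) (fst x))"
    "continuous_on ?S (\<lambda>x. deriv (jacobi_lift m \<theta> (fst (snd x)) (snd (snd x))) (fst x))"
    "continuous_on ?S (\<lambda>x. deriv (deriv (jacobi_lift m \<theta> (fst (snd x)) (snd (snd x)))) (fst x))"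
    if \<theta>: "\<theta> \<in> jacobi_forms k m" for \<theta>
  proof -
    note hol = jacobi_lift_holomorphic(1)[OF \<theta>]
    show c0: "continuous_on ?S (\<lambda>x. jacobi_lift m \<theta> (fst (snd x)) (snd (snd x)) (fst x))"
      using jacobi_lift_continuous[OF \<theta>] by (simp add: split_beta)
    show c1: "continuous_on ?S (\<lambda>x. deriv (jacobi_lift m \<theta> (fst (snd x)) (snd (snd x))) (fst x))"
      using continuous_on_deriv_param[OF c0 H] hol by (simp add: split_beta)
    show "continuous_on ?S (\<lambda>x. deriv (deriv (jacobi_lift m \<theta> (fst (snd x)) (snd (snd x)))) (fst x))"
      using continuous_on_deriv_param[OF c1 H] holomorphic_deriv[OF hol H] by (simp add: split_beta)
  qed
  note cs = c[OF \<phi>] c[OF \<psi>]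
  show "continuous_on ?S (\<lambda>(\<tau>, t). pairing_form k (f (fst t) (snd t)) (g (fst t) (snd t)) \<tau>)"
    unfolding pairing_form_def maass_raise_def split_beta
    by (intro continuous_intros cs) (auto simp: upper_half_plane_def)
  show "continuous_on ?S (\<lambda>(\<tau>, t). pairing_density k (f (fst t) (snd t)) (g (fst t) (snd t)) \<tau> / of_real (4 * (Im \<tau>)\<^sup>2))"
    unfolding pairing_density_def maass_raise_def split_beta
    by (intro continuous_intros cs) (auto simp: upper_half_plane_def)
  show "continuous_on ?S (\<lambda>(\<tau>, t). pairing_form_bar k (f (fst t) (snd t)) (g (fst t) (snd t)) \<tau>)"
    unfolding pairing_form_bar_def split_beta
    by (intro continuous_intros cs) (auto simp: upper_half_plane_def)
qed

text \<open>
  After integration over the fibres the integrand is \<open>d_tau W\<close> up to a constant, where \<open>W\<close> is the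
  integral of the invariant form over the torus. The two generators of the modular group act on \<open>W\<close>
  through a shear and a rotation of the torus, which do not change the integral.
\<close>
lemma jacobi_integral_laplace_density: "jacobi_integral laplace_density = 0"
proof -
  let ?C = "cbox (0, 0) (1, 1) :: (real \<times> real) set"
  define w where "w = (\<lambda>\<tau> t. pairing_form k (f (fst t) (snd t)) (g (fst t) (snd t)) \<tau>)"
  define D where "D = (\<lambda>\<tau> t. pairing_density k (f (fst t) (snd t)) (g (fst t) (snd t)) \<tau> / of_real (4 * (Im \<tau>)\<^sup>2))"
  define D' where "D' = (\<lambda>\<tau> t. pairing_form_bar k (f (fst t) (snd t)) (g (fst t) (snd t)) \<tau>)"
  have lc: "continuous_on (upper_half_plane \<times> T) (\<lambda>(\<tau>, t). w \<tau> t)" "continuous_on (upper_half_plane \<times> T) (\<lambda>(\<tau>, t). D \<tau> t)"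
    "continuous_on (upper_half_plane \<times> T) (\<lambda>(\<tau>, t). D' \<tau> t)" for T
    using pairing_continuous unfolding w_def D_def D'_def by (auto elim!: continuous_on_subset)
  have w_cont: "continuous_on T (w \<tau>)" if "\<tau> \<in> upper_half_plane" for \<tau> T
  proof -
    have "continuous_on T (\<lambda>t. (\<lambda>(\<tau>, t). w \<tau> t) (\<tau>, t))"
      by (rule continuous_on_compose2[OF lc(1)[of UNIV]]) (use that in \<open>auto intro!: continuous_intros\<close>)
    then show ?thesis by simp
  qed
  define W where "W = (\<lambda>\<tau>. integral ?C (w \<tau>))"
  have W: "W \<tau> = torus_integral (\<lambda>p q. w \<tau> (p, q))" for \<tau>
    by (simp add: W_def torus_integral_def split_beta)
  have w_cont': "continuous_on UNIV (\<lambda>(p, q). w \<tau> (p, q))" if "\<tau> \<in> upper_half_plane" for \<tau>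
    using w_cont[OF that] by (simp add: split_beta)
  have I: "torus_integral (\<lambda>p q. laplace_density (\<tau>, of_real p * \<tau> + of_real q)) / of_real ((Im \<tau>)\<^sup>2) = 4 * integral ?C (D \<tau>)"
    if \<tau>: "\<tau> \<in> upper_half_plane" for \<tau>
  proof -
    have "integral ?C (D \<tau>) = integral ?C (\<lambda>t. pairing_density k (f (fst t) (snd t)) (g (fst t) (snd t)) \<tau>) / of_real (4 * (Im \<tau>)\<^sup>2)"
      unfolding D_def by (rule Henstock_Kurzweil_Integration.integral_divide)
    then show ?thesis
      by (simp add: torus_integral_def density_lift(2)[OF \<tau>] case_prod_unfold)
  qed
  let ?I = "\<lambda>\<tau>. torus_integral (\<lambda>p q. laplace_density (\<tau>, of_real p * \<tau> + of_real q)) / of_real ((Im \<tau>)\<^sup>2)"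
  have fib: "set_integrable lborel modular_domain ?I"
    "jacobi_integral laplace_density = (LINT \<tau>:modular_domain|lborel. ?I \<tau>)"
    by (rule jacobi_integral_fibres[OF density_continuous(2) density_integrable(2)], erule density_elliptic)+
  have uhp: "modular_domain \<subseteq> upper_half_plane" by (auto simp: modular_domain_def upper_half_plane_def)
  have int: "set_integrable lborel modular_domain (\<lambda>\<tau>. integral ?C (D \<tau>))"
  proof -
    have "set_integrable lborel modular_domain (\<lambda>\<tau>. 4 * integral ?C (D \<tau>))"
      using fib(1) by (subst set_integrable_cong[OF refl refl]) (use I uhp in auto)
    from set_integrable_mult_right[OF this, of "1/4"] show ?thesis by simp
  qed
  have "jacobi_integral laplace_density = (LINT \<tau>:modular_domain|lborel. 4 * integral ?C (D \<tau>))"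
    unfolding fib(2) by (rule set_lebesgue_integral_cong) (use I uhp in auto)
  also have "\<dots> = 4 * (LINT \<tau>:modular_domain|lborel. integral ?C (D \<tau>))" by simp
  also have "(LINT \<tau>:modular_domain|lborel. integral ?C (D \<tau>)) = 0"
  proof -
    obtain M where M: "\<And>\<tau> p q. Im \<tau> \<ge> 1/2 \<Longrightarrow> 0 \<le> p \<Longrightarrow> p \<le> 1 \<Longrightarrow> cmod (pairing_form k (f p q) (g p q) \<tau>) \<le> M / Im \<tau>"
      using pairing_bounds by metis
    show ?thesis
    proof (rule stokes_modular_domain[of W _ "\<lambda>\<tau>. integral ?C (D' \<tau>)" M])
      show "(W has_derivative (\<lambda>h. integral ?C (D \<tau>) * h + integral ?C (D' \<tau>) * cnj h)) (at \<tau>)"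
        if "\<tau> \<in> upper_half_plane" for \<tau>
        unfolding W_def
      proof (rule leibniz_rule_wirtinger[OF _ w_cont lc(2,3) upper_half_plane_open _ that])
        show "((\<lambda>\<tau>. w \<tau> t) has_derivative (\<lambda>h. D \<tau> t * h + D' \<tau> t * cnj h)) (at \<tau>)"
          if "\<tau> \<in> upper_half_plane" for \<tau> t
          unfolding w_def D_def D'_def by (rule pairing_form_derivative[OF hol that])
        show "convex upper_half_plane"
          unfolding upper_half_plane_def by (rule convex_halfspace_Im_gt)
      qed
      show "continuous_on upper_half_plane (\<lambda>\<tau>. integral ?C (D \<tau>))"
        "continuous_on upper_half_plane (\<lambda>\<tau>. integral ?C (D' \<tau>))"
        by (intro integral_continuous_on_param lc)+
      show "W (\<tau> + 1) = W \<tau>" if \<tau>: "\<tau> \<in> upper_half_plane" for \<tau>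
      proof -
        have "w (\<tau> + 1) (p, q) = w \<tau> (p, q + p)" for p q
          using pairing_form_translate(1)[OF hol(1) hol(1) hol(2) hol(2), of p q 1 "e2pi (of_real (m * p\<^sup>2))" p "q + p" p q p "q + p" \<tau> k]
            jacobi_lift_translate[OF \<phi>] jacobi_lift_translate[OF \<psi>] e2pi_real_unimodular[of "m * p\<^sup>2"] \<tau>
          by (simp add: w_def)
        then have "W (\<tau> + 1) = torus_integral (\<lambda>p q. w \<tau> (p, q + p))"
          unfolding W by simp
        also have "\<dots> = W \<tau>"
          unfolding W by (rule torus_integral_shear[OF w_cont'[OF \<tau>]])
            (auto simp: w_def pairing_periodic[OF \<tau>] intro: continuous_intros)
        finally show ?thesis .
      qed
      show "W (- 1 / \<tau>) = (cnj \<tau>)\<^sup>2 * W \<tau>" if \<tau>: "\<tau> \<in> upper_half_plane" for \<tau>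
      proof -
        note \<tau>' = upper_half_plane_invert[OF \<tau>]
        have inv: "w (- 1 / \<tau>) (- q, p) = (cnj \<tau>)\<^sup>2 * w \<tau> (p, q)" for p q
          unfolding w_def fst_conv snd_conv
          by (rule pairing_form_invert[OF hol(1) hol(1) hol(2) hol(2), where \<epsilon> = "e2pi (of_real (2 * real m * p * q))"])
            (use jacobi_lift_invert[OF \<phi>] jacobi_lift_invert[OF \<psi>] e2pi_real_unimodular[of "2 * real m * p * q"] \<tau> in auto)
        have "W (- 1 / \<tau>) = torus_integral (\<lambda>p q. w (- 1 / \<tau>) (- q, p))"
          unfolding W by (rule torus_integral_rotate[OF w_cont'[OF \<tau>'], symmetric])
            (simp add: w_def pairing_periodic(3)[OF \<tau>'] del: divide_minus_left minus_divide_left)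
        also have "\<dots> = (cnj \<tau>)\<^sup>2 * W \<tau>"
          unfolding inv W torus_integral_def split_beta by (rule Henstock_Kurzweil_Integration.integral_mult_right)
        finally show ?thesis .
      qed
      show "cmod (W \<tau>) \<le> M / Im \<tau>" if v: "Im \<tau> \<ge> 1" for \<tau>
      proof -
        have \<tau>: "\<tau> \<in> upper_half_plane" using v by (simp add: upper_half_plane_def)
        have "cmod (w \<tau> (0, 0)) \<le> M / Im \<tau>" using M[of \<tau> 0 0] v by (simp add: w_def)
        then have "M / Im \<tau> \<ge> 0" by (rule order_trans[OF norm_ge_zero])
        moreover have "cmod (w \<tau> t) \<le> M / Im \<tau>" if "t \<in> ?C" for t
          unfolding w_def using that v by (intro M) (auto simp: cbox_Pair_eq)
        ultimately have "cmod (W \<tau>) \<le> M / Im \<tau> * measure lborel ?C"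
          unfolding W_def by (intro integrable_bound integrable_continuous w_cont[OF \<tau>])
        then show ?thesis by (simp add: content_Pair)
      qed
    qed (rule int)
  qed
  finally show ?thesis by simp
qed

lemma ext_petersson_eq:
  "jacobi_integrable (D_J k F)"
  "ext_petersson k m \<phi> \<psi> = - ((of_nat k - 1 / 2) * (of_nat k - 3 / 2)) * petersson k m \<phi> \<psi>"
proof -
  define c :: complex where "c = (of_nat k - 1 / 2) * (of_nat k - 3 / 2)"
  let ?n = "\<lambda>G x. G x / complex_of_real (Im (fst x) ^ 3)"
  have eq: "?n (D_J k F) x = ?n laplace_density x - c * ?n F x" if "x \<in> jacobi_fund_domain" for x
    using D_J_petersson_density[OF holomorphic2_jacobi[OF \<phi>] holomorphic2_jacobi[OF \<psi>], of x k m]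
      jacobi_fund_domain_subset that
    by (auto simp: laplace_density_def c_def diff_divide_distrib)
  note int = density_integrable[unfolded jacobi_integrable_def split_beta prod.collapse]
  have int': "set_integrable lborel jacobi_fund_domain (\<lambda>x. ?n laplace_density x - c * ?n F x)"
    by (intro set_integral_diff(1) set_integrable_mult_right int)
  then show "jacobi_integrable (D_J k F)"
    unfolding jacobi_integrable_def split_beta prod.collapse
    by (subst set_integrable_cong[OF refl refl eq])
  have "ext_petersson k m \<phi> \<psi> = (LINT x:jacobi_fund_domain|lborel. ?n laplace_density x - c * ?n F x)"
    unfolding ext_petersson_def jacobi_integral_def split_beta prod.collapse
    by (rule set_lebesgue_integral_cong) (use eq in auto)
  also have "\<dots> = jacobi_integral laplace_density - c * petersson k m \<phi> \<psi>"
    unfolding petersson_def jacobi_integral_def split_beta prod.collapse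
    by (simp only: set_integral_diff(2)[OF int(2) set_integrable_mult_right[OF int(1)]] set_integral_mult_right)
  finally show "ext_petersson k m \<phi> \<psi> = - ((of_nat k - 1 / 2) * (of_nat k - 3 / 2)) * petersson k m \<phi> \<psi>"
    by (simp add: jacobi_integral_laplace_density c_def)
qed

end

theorem corollary3p4:
  fixes k :: nat
  assumes "even k" and "k > 0"
  shows "\<exists>d :: complex. (real k \<noteq> 1 / 2 \<and> real k \<noteq> 3 / 2 \<longrightarrow> d \<noteq> 0) \<and>
    (\<forall>m :: nat. m \<ge> 1 \<longrightarrow>
      (\<forall>\<phi>\<in>jacobi_forms k m. \<forall>\<psi>\<in>jacobi_forms k m.
         \<phi> \<in> jacobi_cusp_forms k m \<or> \<psi> \<in> jacobi_cusp_forms k m \<longrightarrow>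
         jacobi_integrable (petersson_density k m \<phi> \<psi>) \<and>
         jacobi_integrable (D_J k (petersson_density k m \<phi> \<psi>)) \<and>
         ext_petersson k m \<phi> \<psi> = d * petersson k m \<phi> \<psi>))"
proof (intro exI[of _ "- ((of_nat k - 1 / 2) * (of_nat k - 3 / 2)) :: complex"] conjI allI impI ballI)
  assume k: "real k \<noteq> 1 / 2 \<and> real k \<noteq> 3 / 2"
  have "(of_nat k :: complex) \<noteq> of_real a" if "real k \<noteq> a" for a
    using that by (metis of_real_eq_iff of_real_of_nat_eq)
  from this[of "1/2"] this[of "3/2"] k
  show "- ((of_nat k - 1 / 2) * (of_nat k - 3 / 2)) \<noteq> (0 :: complex)" by simp
next
  fix m :: nat and \<phi> \<psi>
  assume "m \<ge> 1" "\<phi> \<in> jacobi_forms k m" "\<psi> \<in> jacobi_forms k m"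
    "\<phi> \<in> jacobi_cusp_forms k m \<or> \<psi> \<in> jacobi_cusp_forms k m"
  then interpret jacobi_pair k m \<phi> \<psi> by unfold_locales
  show "jacobi_integrable (petersson_density k m \<phi> \<psi>)" by (rule density_integrable(1))
  show "jacobi_integrable (D_J k (petersson_density k m \<phi> \<psi>))"
    "ext_petersson k m \<phi> \<psi> = - ((of_nat k - 1 / 2) * (of_nat k - 3 / 2)) * petersson k m \<phi> \<psi>"
    by (rule ext_petersson_eq)+
qed

end
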